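(* Let $\mathcal{A}$ be a locally noetherian Grothendieck cosmos such that the unit object $I$ is finitely presented and $\mathcal{A}$ is generated by a small set of invertible-filtered objects. Assume in addition that for any $M\in\mathcal{A}$ and any $x\in\operatorname{LSupp}M$ there exists $y\in\operatorname{LAss}M$ such that $y$ belongs to the topological closure of $\{x\}$ in $\operatorname{LSpec}\mathcal{A}$. Then there is an order-preserving bijection (both sides ordered by inclusion) between (i) the set of L-closed torsion-free classes of $\mathcal{A}_{\mathrm{noeth}}$, and (ii) the power set of $\operatorname{LSpec}\mathcal{A}$. The bijection is given by $$\Phi\mapsto \operatorname{LAss}^{-1}(\Phi):=\{M\in\mathcal{A}_{\mathrm{noeth}}\mid \operatorname{LAss}(M)\subseteq\Phi\},\qquad \mathcal{X}\mapsto\operatorname{LAss}\mathcal{X}:=\bigcup_{X\in\mathcal{X}}\operatorname{LAss}(X),$$ where $\Phi$ is a subset of $\operatorname{LSpec}\mathcal{A}$ and $\mathcal{X}$ is an L-closed torsion-free class.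
   Context: All subcategories are full and closed under isomorphisms. A Grothendieck cosmos is a symmetric monoidal closed category $(\mathcal{A},\otimes,I)$ whose underlying category is a Grothendieck category; it is locally noetherian if the underlying Grothendieck category is. $\mathcal{A}_{\mathrm{noeth}}$ is the full subcategory of noetherian objects. An object $L$ is invertible if $L\otimes M\cong I$ for some $M$. An object is invertible-filtered if it has a finite filtration by subobjects with all successive quotients invertible. A subcategory $\mathcal{X}$ is L-closed if $X\otimes L\in\mathcal{X}$ for all $X\in\mathcal{X}$ and all invertible $L\in\mathcal{A}$. A torsion-free class of an abelian category is an additive subcategory closed under subobjects and extensions. Atom spectrum (Kanda): an object $H\neq 0$ of $\mathcal{A}$ is monoform if for every nonzero subobject $L$ of $H$, the objects $H$ and $H/L$ have no common nonzero subobject (up to isomorphism). Two monoform objects are atom-equivalent if they have a common nonzero subobject. $\operatorname{Spec}\mathcal{A}$ is the set of atom-equivalence classes $\overline{H}$ of monoform objects $H$. For $M\in\mathcal{A}$, $\operatorname{Supp}M:=\{\overline{H}\mid H\text{ is a monoform subquotient of }M\}$ and $\operatorname{Ass}M:=\{\overline{H}\mid H\text{ is a monoform subobject of }M\}$. $\operatorname{Spec}\mathcal{A}$ has the topology with open basis $\{\operatorname{Supp}M\mid M\in\mathcal{A}\}$. The Picard group $\operatorname{Pic}\mathcal{A}$ (isomorphism classes of invertible objects under $\otimes$) acts on $\operatorname{Spec}\mathcal{A}$ by $L\cdot\overline{H}=\overline{H\otimes L}$. The orbit atom spectrum is the quotient space $\operatorname{LSpec}\mathcal{A}:=\operatorname{Spec}\mathcal{A}/\operatorname{Pic}\mathcal{A}$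 with quotient map $\pi$, and $\operatorname{LSupp}M:=\pi(\operatorname{Supp}M)$, $\operatorname{LAss}M:=\pi(\operatorname{Ass}M)$. *)

theory Defs
  imports "HOL-Analysis.Analysis" "HOL-Algebra.Group_Action"
begin

unbundle cardinal_syntax

section \<open>Size\<close>

text \<open>A Grothendieck universe enters only through its cardinality \<open>\<kappa>\<close>, an uncountable strongly
  inaccessible cardinal; a set is small if it has fewer than \<open>\<kappa>\<close> elements, that is, if it is
  equipollent to an element of the universe. Up to bijection, small sets are the small subsets of
  the type underlying \<open>\<kappa>\<close>, which is why index sets and index categories below live over that type.\<close>

definition universe_card :: "'k rel \<Rightarrow> bool" where
  "universe_card \<kappa> \<longleftrightarrow> Card_order \<kappa> \<and> natLeq <o \<kappa> \<and> regularCard \<kappa> \<and>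
     (\<forall>S \<subseteq> Field \<kappa>. |S| <o \<kappa> \<longrightarrow> |Pow S| <o \<kappa>)"

definition small :: "'k rel \<Rightarrow> 'a set \<Rightarrow> bool" where
  "small \<kappa> S \<longleftrightarrow> |S| <o \<kappa>"


section \<open>Categories\<close>

record ('o, 'm) cat =
  Obj :: "'o set"
  Arr :: "'m set"
  Dom :: "'m \<Rightarrow> 'o"
  Cod :: "'m \<Rightarrow> 'o"
  Idn :: "'o \<Rightarrow> 'm"
  Cmp :: "'m \<Rightarrow> 'm \<Rightarrow> 'm" (infixr "\<cdot>\<index>" 70)

definition Hom :: "('o, 'm, 'z) cat_scheme \<Rightarrow> 'o \<Rightarrow> 'o \<Rightarrow> 'm set" where
  "Hom C a b = {f \<in> Arr C. Dom C f = a \<and> Cod C f = b}"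

locale category =
  fixes C :: "('o, 'm, 'z) cat_scheme" (structure)
  assumes dom_cod: "f \<in> Arr C \<Longrightarrow> Dom C f \<in> Obj C \<and> Cod C f \<in> Obj C"
    and idn_in_Hom: "a \<in> Obj C \<Longrightarrow> Idn C a \<in> Hom C a a"
    and cmp_in_Hom: "f \<in> Hom C a b \<Longrightarrow> g \<in> Hom C b c \<Longrightarrow> g \<cdot> f \<in> Hom C a c"
    and cmp_idn_right: "f \<in> Hom C a b \<Longrightarrow> f \<cdot> Idn C a = f"
    and cmp_idn_left: "f \<in> Hom C a b \<Longrightarrow> Idn C b \<cdot> f = f"
    and cmp_assoc: "f \<in> Hom C a b \<Longrightarrow> g \<in> Hom C b c \<Longrightarrow> h \<in> Hom C c d \<Longrightarrow>
      (h \<cdot> g) \<cdot> f = h \<cdot> (g \<cdot> f)"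

definition full_sub :: "('o, 'm, 'z) cat_scheme \<Rightarrow> 'o set \<Rightarrow> ('o, 'm, 'z) cat_scheme" where
  "full_sub C S = C\<lparr>Obj := S, Arr := {f \<in> Arr C. Dom C f \<in> S \<and> Cod C f \<in> S}\<rparr>"

definition is_iso :: "('o, 'm, 'z) cat_scheme \<Rightarrow> 'm \<Rightarrow> bool" where
  "is_iso C f \<longleftrightarrow> f \<in> Arr C \<and>
     (\<exists>g \<in> Hom C (Cod C f) (Dom C f).
        g \<cdot>\<^bsub>C\<^esub> f = Idn C (Dom C f) \<and> f \<cdot>\<^bsub>C\<^esub> g = Idn C (Cod C f))"

definition isomorphic :: "('o, 'm, 'z) cat_scheme \<Rightarrow> 'o \<Rightarrow> 'o \<Rightarrow> bool" where
  "isomorphic C a b \<longleftrightarrow> (\<exists>f \<in> Hom C a b. is_iso C f)"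

definition is_mono :: "('o, 'm, 'z) cat_scheme \<Rightarrow> 'm \<Rightarrow> bool" where
  "is_mono C f \<longleftrightarrow> f \<in> Arr C \<and>
     (\<forall>x. \<forall>g \<in> Hom C x (Dom C f). \<forall>h \<in> Hom C x (Dom C f). f \<cdot>\<^bsub>C\<^esub> g = f \<cdot>\<^bsub>C\<^esub> h \<longrightarrow> g = h)"

definition is_epi :: "('o, 'm, 'z) cat_scheme \<Rightarrow> 'm \<Rightarrow> bool" where
  "is_epi C f \<longleftrightarrow> f \<in> Arr C \<and>
     (\<forall>x. \<forall>g \<in> Hom C (Cod C f) x. \<forall>h \<in> Hom C (Cod C f) x. g \<cdot>\<^bsub>C\<^esub> f = h \<cdot>\<^bsub>C\<^esub> f \<longrightarrow> g = h)"

definition is_zero :: "('o, 'm, 'z) cat_scheme \<Rightarrow> 'o \<Rightarrow> bool" where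
  "is_zero C z \<longleftrightarrow> z \<in> Obj C \<and>
     (\<forall>a \<in> Obj C. (\<exists>!f. f \<in> Hom C a z) \<and> (\<exists>!f. f \<in> Hom C z a))"

definition zero_arrow :: "('o, 'm, 'z) cat_scheme \<Rightarrow> 'm \<Rightarrow> bool" where
  "zero_arrow C f \<longleftrightarrow>
     (\<exists>z g h. is_zero C z \<and> g \<in> Hom C (Dom C f) z \<and> h \<in> Hom C z (Cod C f) \<and> f = h \<cdot>\<^bsub>C\<^esub> g)"

definition is_kernel :: "('o, 'm, 'z) cat_scheme \<Rightarrow> 'm \<Rightarrow> 'm \<Rightarrow> bool" where
  "is_kernel C f k \<longleftrightarrow> f \<in> Arr C \<and> k \<in> Arr C \<and> Cod C k = Dom C f \<and> zero_arrow C (f \<cdot>\<^bsub>C\<^esub> k) \<and>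
     (\<forall>x. \<forall>g \<in> Hom C x (Dom C f). zero_arrow C (f \<cdot>\<^bsub>C\<^esub> g) \<longrightarrow>
        (\<exists>!u. u \<in> Hom C x (Dom C k) \<and> k \<cdot>\<^bsub>C\<^esub> u = g))"

definition is_cokernel :: "('o, 'm, 'z) cat_scheme \<Rightarrow> 'm \<Rightarrow> 'm \<Rightarrow> bool" where
  "is_cokernel C f q \<longleftrightarrow> f \<in> Arr C \<and> q \<in> Arr C \<and> Dom C q = Cod C f \<and> zero_arrow C (q \<cdot>\<^bsub>C\<^esub> f) \<and>
     (\<forall>x. \<forall>g \<in> Hom C (Cod C f) x. zero_arrow C (g \<cdot>\<^bsub>C\<^esub> f) \<longrightarrow>
        (\<exists>!u. u \<in> Hom C (Cod C q) x \<and> u \<cdot>\<^bsub>C\<^esub> q = g))"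

definition short_exact :: "('o, 'm, 'z) cat_scheme \<Rightarrow> 'm \<Rightarrow> 'm \<Rightarrow> bool" where
  "short_exact C f g \<longleftrightarrow> is_kernel C g f \<and> is_cokernel C f g"

definition is_product ::
  "('o, 'm, 'z) cat_scheme \<Rightarrow> 'i set \<Rightarrow> ('i \<Rightarrow> 'o) \<Rightarrow> 'o \<Rightarrow> ('i \<Rightarrow> 'm) \<Rightarrow> bool" where
  "is_product C J X c p \<longleftrightarrow> c \<in> Obj C \<and> (\<forall>j \<in> J. p j \<in> Hom C c (X j)) \<and>
     (\<forall>d \<in> Obj C. \<forall>q. (\<forall>j \<in> J. q j \<in> Hom C d (X j)) \<longrightarrow>
        (\<exists>!u. u \<in> Hom C d c \<and> (\<forall>j \<in> J. p j \<cdot>\<^bsub>C\<^esub> u = q j)))"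

definition is_coproduct ::
  "('o, 'm, 'z) cat_scheme \<Rightarrow> 'i set \<Rightarrow> ('i \<Rightarrow> 'o) \<Rightarrow> 'o \<Rightarrow> ('i \<Rightarrow> 'm) \<Rightarrow> bool" where
  "is_coproduct C J X c i \<longleftrightarrow> c \<in> Obj C \<and> (\<forall>j \<in> J. i j \<in> Hom C (X j) c) \<and>
     (\<forall>d \<in> Obj C. \<forall>q. (\<forall>j \<in> J. q j \<in> Hom C (X j) d) \<longrightarrow>
        (\<exists>!u. u \<in> Hom C c d \<and> (\<forall>j \<in> J. u \<cdot>\<^bsub>C\<^esub> i j = q j)))"


section \<open>Functors and colimits\<close>

record ('i, 'j, 'o, 'm) func =
  FObj :: "'i \<Rightarrow> 'o"
  FArr :: "'j \<Rightarrow> 'm"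

definition is_functor ::
  "('i, 'j, 'y) cat_scheme \<Rightarrow> ('o, 'm, 'z) cat_scheme \<Rightarrow> ('i, 'j, 'o, 'm) func \<Rightarrow> bool" where
  "is_functor J C F \<longleftrightarrow> category J \<and> category C \<and>
     (\<forall>i \<in> Obj J. FObj F i \<in> Obj C \<and> FArr F (Idn J i) = Idn C (FObj F i)) \<and>
     (\<forall>f \<in> Arr J. FArr F f \<in> Hom C (FObj F (Dom J f)) (FObj F (Cod J f))) \<and>
     (\<forall>f \<in> Arr J. \<forall>g \<in> Arr J. Dom J g = Cod J f \<longrightarrow> FArr F (g \<cdot>\<^bsub>J\<^esub> f) = FArr F g \<cdot>\<^bsub>C\<^esub> FArr F f)"

definition is_nat_trans ::
  "('i, 'j, 'y) cat_scheme \<Rightarrow> ('o, 'm, 'z) cat_scheme \<Rightarrow> ('i, 'j, 'o, 'm) func \<Rightarrow>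
    ('i, 'j, 'o, 'm) func \<Rightarrow> ('i \<Rightarrow> 'm) \<Rightarrow> bool" where
  "is_nat_trans J C F G t \<longleftrightarrow> is_functor J C F \<and> is_functor J C G \<and>
     (\<forall>i \<in> Obj J. t i \<in> Hom C (FObj F i) (FObj G i)) \<and>
     (\<forall>f \<in> Arr J. t (Cod J f) \<cdot>\<^bsub>C\<^esub> FArr F f = FArr G f \<cdot>\<^bsub>C\<^esub> t (Dom J f))"

definition is_cocone ::
  "('i, 'j, 'y) cat_scheme \<Rightarrow> ('o, 'm, 'z) cat_scheme \<Rightarrow> ('i, 'j, 'o, 'm) func \<Rightarrow> 'o \<Rightarrow>
    ('i \<Rightarrow> 'm) \<Rightarrow> bool" where
  "is_cocone J C F c s \<longleftrightarrow> c \<in> Obj C \<and> (\<forall>i \<in> Obj J. s i \<in> Hom C (FObj F i) c) \<and>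
     (\<forall>f \<in> Arr J. s (Cod J f) \<cdot>\<^bsub>C\<^esub> FArr F f = s (Dom J f))"

definition is_colimit ::
  "('i, 'j, 'y) cat_scheme \<Rightarrow> ('o, 'm, 'z) cat_scheme \<Rightarrow> ('i, 'j, 'o, 'm) func \<Rightarrow> 'o \<Rightarrow>
    ('i \<Rightarrow> 'm) \<Rightarrow> bool" where
  "is_colimit J C F c s \<longleftrightarrow> is_functor J C F \<and> is_cocone J C F c s \<and>
     (\<forall>d t. is_cocone J C F d t \<longrightarrow> (\<exists>!u. u \<in> Hom C c d \<and> (\<forall>i \<in> Obj J. u \<cdot>\<^bsub>C\<^esub> s i = t i)))"

text \<open>Every small category is isomorphic to one with objects in \<open>'k\<close> and arrows in \<open>'k \<times> 'k\<close>. The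
  arrow type is chosen so that a preordered subset of \<open>'k\<close> is such a category without any coding.\<close>

definition small_filtered :: "'k rel \<Rightarrow> ('k, 'k \<times> 'k) cat \<Rightarrow> bool" where
  "small_filtered \<kappa> J \<longleftrightarrow> category J \<and> small \<kappa> (Obj J) \<and> small \<kappa> (Arr J) \<and> Obj J \<noteq> {} \<and>
     (\<forall>i \<in> Obj J. \<forall>j \<in> Obj J. \<exists>k \<in> Obj J. Hom J i k \<noteq> {} \<and> Hom J j k \<noteq> {}) \<and>
     (\<forall>i j. \<forall>f \<in> Hom J i j. \<forall>g \<in> Hom J i j. \<exists>k. \<exists>h \<in> Hom J j k. h \<cdot>\<^bsub>J\<^esub> f = h \<cdot>\<^bsub>J\<^esub> g)"


section \<open>Grothendieck categories\<close>

definition preadditive :: "('o, 'm, 'z) cat_scheme \<Rightarrow> bool" where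
  "preadditive C \<longleftrightarrow> category C \<and> (\<exists>add.
     (\<forall>a \<in> Obj C. \<forall>b \<in> Obj C. \<exists>z. comm_group \<lparr>carrier = Hom C a b, monoid.mult = add, one = z\<rparr>) \<and>
     (\<forall>a b c. \<forall>f \<in> Hom C a b. \<forall>f' \<in> Hom C a b. \<forall>g \<in> Hom C b c. \<forall>g' \<in> Hom C b c.
        g \<cdot>\<^bsub>C\<^esub> add f f' = add (g \<cdot>\<^bsub>C\<^esub> f) (g \<cdot>\<^bsub>C\<^esub> f') \<and>
        add g g' \<cdot>\<^bsub>C\<^esub> f = add (g \<cdot>\<^bsub>C\<^esub> f) (g' \<cdot>\<^bsub>C\<^esub> f)))"

definition abelian :: "('o, 'm, 'z) cat_scheme \<Rightarrow> bool" where
  "abelian C \<longleftrightarrow> preadditive C \<and> (\<exists>z. is_zero C z) \<and>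
     (\<forall>X :: bool \<Rightarrow> 'o. range X \<subseteq> Obj C \<longrightarrow>
        (\<exists>c p. is_product C UNIV X c p) \<and> (\<exists>c i. is_coproduct C UNIV X c i)) \<and>
     (\<forall>f \<in> Arr C. (\<exists>k. is_kernel C f k) \<and> (\<exists>q. is_cokernel C f q)) \<and>
     (\<forall>f. is_mono C f \<longrightarrow> (\<exists>g. is_kernel C g f)) \<and>
     (\<forall>f. is_epi C f \<longrightarrow> (\<exists>g. is_cokernel C g f))"

definition locally_small :: "'k rel \<Rightarrow> ('o, 'm, 'z) cat_scheme \<Rightarrow> bool" where
  "locally_small \<kappa> C \<longleftrightarrow> (\<forall>a \<in> Obj C. \<forall>b \<in> Obj C. small \<kappa> (Hom C a b))"

definition has_small_coproducts :: "'k rel \<Rightarrow> ('o, 'm, 'z) cat_scheme \<Rightarrow> bool" where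
  "has_small_coproducts \<kappa> C \<longleftrightarrow>
     (\<forall>(J :: 'k set) X. small \<kappa> J \<and> X ` J \<subseteq> Obj C \<longrightarrow> (\<exists>c i. is_coproduct C J X c i))"

definition exact_filtered_colimits :: "'k rel \<Rightarrow> ('o, 'm, 'z) cat_scheme \<Rightarrow> bool" where
  "exact_filtered_colimits \<kappa> C \<longleftrightarrow>
     (\<forall>J F G H \<alpha> \<beta> a r b s c t u v.
        small_filtered \<kappa> J \<and> is_nat_trans J C F G \<alpha> \<and> is_nat_trans J C G H \<beta> \<and>
        (\<forall>j \<in> Obj J. short_exact C (\<alpha> j) (\<beta> j)) \<and>
        is_colimit J C F a r \<and> is_colimit J C G b s \<and> is_colimit J C H c t \<and>
        u \<in> Hom C a b \<and> (\<forall>j \<in> Obj J. u \<cdot>\<^bsub>C\<^esub> r j = s j \<cdot>\<^bsub>C\<^esub> \<alpha> j) \<and>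
        v \<in> Hom C b c \<and> (\<forall>j \<in> Obj J. v \<cdot>\<^bsub>C\<^esub> s j = t j \<cdot>\<^bsub>C\<^esub> \<beta> j)
        \<longrightarrow> short_exact C u v)"

definition generating :: "('o, 'm, 'z) cat_scheme \<Rightarrow> 'o set \<Rightarrow> bool" where
  "generating C S \<longleftrightarrow> S \<subseteq> Obj C \<and>
     (\<forall>a b. \<forall>f \<in> Hom C a b. \<forall>g \<in> Hom C a b. f \<noteq> g \<longrightarrow>
        (\<exists>s \<in> S. \<exists>h \<in> Hom C s a. f \<cdot>\<^bsub>C\<^esub> h \<noteq> g \<cdot>\<^bsub>C\<^esub> h))"

definition grothendieck_category :: "'k rel \<Rightarrow> ('o, 'm, 'z) cat_scheme \<Rightarrow> bool" where
  "grothendieck_category \<kappa> C \<longleftrightarrow> abelian C \<and> locally_small \<kappa> C \<and> has_small_coproducts \<kappa> C \<and>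
     exact_filtered_colimits \<kappa> C \<and> (\<exists>s. generating C {s})"

text \<open>Subobjects are represented by monomorphisms, preordered by factorization.\<close>

definition subobject_le :: "('o, 'm, 'z) cat_scheme \<Rightarrow> 'm \<Rightarrow> 'm \<Rightarrow> bool" where
  "subobject_le C m n \<longleftrightarrow> (\<exists>h \<in> Hom C (Dom C m) (Dom C n). m = n \<cdot>\<^bsub>C\<^esub> h)"

definition noetherian_object :: "('o, 'm, 'z) cat_scheme \<Rightarrow> 'o \<Rightarrow> bool" where
  "noetherian_object C M \<longleftrightarrow> M \<in> Obj C \<and>
     (\<forall>s :: nat \<Rightarrow> 'm. (\<forall>n. is_mono C (s n) \<and> Cod C (s n) = M \<and> subobject_le C (s n) (s (Suc n)))
        \<longrightarrow> (\<exists>N. \<forall>n \<ge> N. subobject_le C (s n) (s N)))"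

definition noeth :: "('o, 'm, 'z) cat_scheme \<Rightarrow> ('o, 'm, 'z) cat_scheme" where
  "noeth C = full_sub C {M. noetherian_object C M}"

definition locally_noetherian :: "'k rel \<Rightarrow> ('o, 'm, 'z) cat_scheme \<Rightarrow> bool" where
  "locally_noetherian \<kappa> C \<longleftrightarrow>
     (\<exists>S. small \<kappa> S \<and> generating C S \<and> (\<forall>M \<in> S. noetherian_object C M))"

text \<open>\<open>Hom(P, -)\<close> preserves small filtered colimits. The two clauses express that the canonical map
  \<open>colim Hom(P, F j) \<rightarrow> Hom(P, c)\<close> is surjective and injective, respectively.\<close>

definition finitely_presented :: "'k rel \<Rightarrow> ('o, 'm, 'z) cat_scheme \<Rightarrow> 'o \<Rightarrow> bool" where
  "finitely_presented \<kappa> C P \<longleftrightarrow> P \<in> Obj C \<and>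
     (\<forall>J F c s. small_filtered \<kappa> J \<and> is_colimit J C F c s \<longrightarrow>
        (\<forall>f \<in> Hom C P c. \<exists>j \<in> Obj J. \<exists>g \<in> Hom C P (FObj F j). f = s j \<cdot>\<^bsub>C\<^esub> g) \<and>
        (\<forall>i \<in> Obj J. \<forall>j \<in> Obj J. \<forall>g \<in> Hom C P (FObj F i). \<forall>h \<in> Hom C P (FObj F j).
           s i \<cdot>\<^bsub>C\<^esub> g = s j \<cdot>\<^bsub>C\<^esub> h \<longrightarrow>
           (\<exists>k. \<exists>u \<in> Hom J i k. \<exists>v \<in> Hom J j k. FArr F u \<cdot>\<^bsub>C\<^esub> g = FArr F v \<cdot>\<^bsub>C\<^esub> h)))"

definition additive_subcategory :: "('o, 'm, 'z) cat_scheme \<Rightarrow> 'o set \<Rightarrow> bool" where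
  "additive_subcategory C X \<longleftrightarrow> X \<subseteq> Obj C \<and>
     (\<forall>a \<in> X. \<forall>b. isomorphic C a b \<longrightarrow> b \<in> X) \<and>
     (\<forall>z. is_zero C z \<longrightarrow> z \<in> X) \<and>
     (\<forall>(Y :: bool \<Rightarrow> 'o) c i. range Y \<subseteq> X \<and> is_coproduct C UNIV Y c i \<longrightarrow> c \<in> X)"

definition torsion_free_class :: "('o, 'm, 'z) cat_scheme \<Rightarrow> 'o set \<Rightarrow> bool" where
  "torsion_free_class C X \<longleftrightarrow> additive_subcategory C X \<and>
     (\<forall>m. is_mono C m \<and> Cod C m \<in> X \<longrightarrow> Dom C m \<in> X) \<and>
     (\<forall>f g. short_exact C f g \<and> Dom C f \<in> X \<and> Cod C g \<in> X \<longrightarrow> Cod C f \<in> X)"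


section \<open>Symmetric monoidal closed categories\<close>

record ('o, 'm) smcat = "('o, 'm) cat" +
  TObj :: "'o \<Rightarrow> 'o \<Rightarrow> 'o" (infixr "\<boxtimes>\<index>" 75)
  TArr :: "'m \<Rightarrow> 'm \<Rightarrow> 'm" (infixr "\<star>\<index>" 75)
  Unit :: "'o"
  Assoc :: "'o \<Rightarrow> 'o \<Rightarrow> 'o \<Rightarrow> 'm"
  LUnit :: "'o \<Rightarrow> 'm"
  RUnit :: "'o \<Rightarrow> 'm"
  Sym :: "'o \<Rightarrow> 'o \<Rightarrow> 'm"

locale symmetric_monoidal = category A for A :: "('o, 'm, 'z) smcat_scheme" (structure) +
  assumes unit_obj: "Unit A \<in> Obj A"
    and tensor_obj: "x \<in> Obj A \<Longrightarrow> y \<in> Obj A \<Longrightarrow> x \<boxtimes> y \<in> Obj A"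
    and tensor_arr: "f \<in> Hom A x x' \<Longrightarrow> g \<in> Hom A y y' \<Longrightarrow> f \<star> g \<in> Hom A (x \<boxtimes> y) (x' \<boxtimes> y')"
    and tensor_idn: "x \<in> Obj A \<Longrightarrow> y \<in> Obj A \<Longrightarrow> Idn A x \<star> Idn A y = Idn A (x \<boxtimes> y)"
    and tensor_cmp: "f \<in> Hom A x x' \<Longrightarrow> f' \<in> Hom A x' x'' \<Longrightarrow> g \<in> Hom A y y' \<Longrightarrow> g' \<in> Hom A y' y'' \<Longrightarrow>
      (f' \<cdot> f) \<star> (g' \<cdot> g) = (f' \<star> g') \<cdot> (f \<star> g)"
    and assoc_iso: "x \<in> Obj A \<Longrightarrow> y \<in> Obj A \<Longrightarrow> z \<in> Obj A \<Longrightarrow>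
      Assoc A x y z \<in> Hom A ((x \<boxtimes> y) \<boxtimes> z) (x \<boxtimes> (y \<boxtimes> z)) \<and> is_iso A (Assoc A x y z)"
    and assoc_nat: "f \<in> Hom A x x' \<Longrightarrow> g \<in> Hom A y y' \<Longrightarrow> h \<in> Hom A z z' \<Longrightarrow>
      Assoc A x' y' z' \<cdot> ((f \<star> g) \<star> h) = (f \<star> (g \<star> h)) \<cdot> Assoc A x y z"
    and lunit_iso: "x \<in> Obj A \<Longrightarrow> LUnit A x \<in> Hom A (Unit A \<boxtimes> x) x \<and> is_iso A (LUnit A x)"
    and lunit_nat: "f \<in> Hom A x x' \<Longrightarrow> LUnit A x' \<cdot> (Idn A (Unit A) \<star> f) = f \<cdot> LUnit A x"
    and runit_iso: "x \<in> Obj A \<Longrightarrow> RUnit A x \<in> Hom A (x \<boxtimes> Unit A) x \<and> is_iso A (RUnit A x)"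
    and runit_nat: "f \<in> Hom A x x' \<Longrightarrow> RUnit A x' \<cdot> (f \<star> Idn A (Unit A)) = f \<cdot> RUnit A x"
    and sym_hom: "x \<in> Obj A \<Longrightarrow> y \<in> Obj A \<Longrightarrow> Sym A x y \<in> Hom A (x \<boxtimes> y) (y \<boxtimes> x)"
    and sym_nat: "f \<in> Hom A x x' \<Longrightarrow> g \<in> Hom A y y' \<Longrightarrow>
      Sym A x' y' \<cdot> (f \<star> g) = (g \<star> f) \<cdot> Sym A x y"
    and sym_sym: "x \<in> Obj A \<Longrightarrow> y \<in> Obj A \<Longrightarrow> Sym A y x \<cdot> Sym A x y = Idn A (x \<boxtimes> y)"
    and pentagon: "w \<in> Obj A \<Longrightarrow> x \<in> Obj A \<Longrightarrow> y \<in> Obj A \<Longrightarrow> z \<in> Obj A \<Longrightarrow>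
      Assoc A w x (y \<boxtimes> z) \<cdot> Assoc A (w \<boxtimes> x) y z =
      (Idn A w \<star> Assoc A x y z) \<cdot> Assoc A w (x \<boxtimes> y) z \<cdot> (Assoc A w x y \<star> Idn A z)"
    and triangle: "x \<in> Obj A \<Longrightarrow> y \<in> Obj A \<Longrightarrow>
      (Idn A x \<star> LUnit A y) \<cdot> Assoc A x (Unit A) y = RUnit A x \<star> Idn A y"
    and hexagon: "x \<in> Obj A \<Longrightarrow> y \<in> Obj A \<Longrightarrow> z \<in> Obj A \<Longrightarrow>
      Assoc A y z x \<cdot> Sym A x (y \<boxtimes> z) \<cdot> Assoc A x y z =
      (Idn A y \<star> Sym A x z) \<cdot> Assoc A y x z \<cdot> (Sym A x y \<star> Idn A z)"

text \<open>Closedness: every functor \<open>- \<otimes> y\<close> has a right adjoint, given by universal arrows \<open>h \<otimes> y \<rightarrow> z\<close>.\<close>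

definition monoidal_closed :: "('o, 'm, 'z) smcat_scheme \<Rightarrow> bool" where
  "monoidal_closed A \<longleftrightarrow> (\<forall>y \<in> Obj A. \<forall>z \<in> Obj A. \<exists>h \<in> Obj A. \<exists>ev \<in> Hom A (h \<boxtimes>\<^bsub>A\<^esub> y) z.
     \<forall>x \<in> Obj A. \<forall>f \<in> Hom A (x \<boxtimes>\<^bsub>A\<^esub> y) z.
       \<exists>!g. g \<in> Hom A x h \<and> ev \<cdot>\<^bsub>A\<^esub> (g \<star>\<^bsub>A\<^esub> Idn A y) = f)"

definition grothendieck_cosmos :: "'k rel \<Rightarrow> ('o, 'm, 'z) smcat_scheme \<Rightarrow> bool" where
  "grothendieck_cosmos \<kappa> A \<longleftrightarrow> symmetric_monoidal A \<and> monoidal_closed A \<and> grothendieck_category \<kappa> A"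

definition invertible_object :: "('o, 'm, 'z) smcat_scheme \<Rightarrow> 'o \<Rightarrow> bool" where
  "invertible_object A L \<longleftrightarrow> L \<in> Obj A \<and> (\<exists>M \<in> Obj A. isomorphic A (L \<boxtimes>\<^bsub>A\<^esub> M) (Unit A))"

text \<open>A filtration \<open>0 = M\<^sub>0 \<subseteq> \<dots> \<subseteq> M\<^sub>n = M\<close> is given by monomorphisms \<open>s i\<close> into \<open>M\<close>.\<close>

definition invertible_filtered :: "('o, 'm, 'z) smcat_scheme \<Rightarrow> 'o \<Rightarrow> bool" where
  "invertible_filtered A M \<longleftrightarrow> (\<exists>(n :: nat) s.
     (\<forall>i \<le> n. is_mono A (s i) \<and> Cod A (s i) = M) \<and> is_zero A (Dom A (s 0)) \<and> is_iso A (s n) \<and>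
     (\<forall>i < n. \<exists>h \<in> Hom A (Dom A (s i)) (Dom A (s (Suc i))). s i = s (Suc i) \<cdot>\<^bsub>A\<^esub> h \<and>
        (\<exists>q. is_cokernel A h q \<and> invertible_object A (Cod A q))))"

definition L_closed :: "('o, 'm, 'z) smcat_scheme \<Rightarrow> 'o set \<Rightarrow> bool" where
  "L_closed A X \<longleftrightarrow> (\<forall>x \<in> X. \<forall>L. invertible_object A L \<longrightarrow> x \<boxtimes>\<^bsub>A\<^esub> L \<in> X)"


section \<open>The atom spectrum\<close>

definition common_nonzero_subobject :: "('o, 'm, 'z) cat_scheme \<Rightarrow> 'o \<Rightarrow> 'o \<Rightarrow> bool" where
  "common_nonzero_subobject C a b \<longleftrightarrow> (\<exists>m n. is_mono C m \<and> is_mono C n \<and> Dom C m = Dom C n \<and>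
     \<not> is_zero C (Dom C m) \<and> Cod C m = a \<and> Cod C n = b)"

definition monoform :: "('o, 'm, 'z) cat_scheme \<Rightarrow> 'o \<Rightarrow> bool" where
  "monoform C H \<longleftrightarrow> H \<in> Obj C \<and> \<not> is_zero C H \<and>
     (\<forall>m q. is_mono C m \<and> Cod C m = H \<and> \<not> is_zero C (Dom C m) \<and> is_cokernel C m q \<longrightarrow>
        \<not> common_nonzero_subobject C H (Cod C q))"

definition atom_rel :: "('o, 'm, 'z) cat_scheme \<Rightarrow> 'o rel" where
  "atom_rel C = {(H, H'). monoform C H \<and> monoform C H' \<and> common_nonzero_subobject C H H'}"

definition atom :: "('o, 'm, 'z) cat_scheme \<Rightarrow> 'o \<Rightarrow> 'o set" where
  "atom C H = atom_rel C `` {H}"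

definition Spec :: "('o, 'm, 'z) cat_scheme \<Rightarrow> 'o set set" where
  "Spec C = {H. monoform C H} // atom_rel C"

definition Supp :: "('o, 'm, 'z) cat_scheme \<Rightarrow> 'o \<Rightarrow> 'o set set" where
  "Supp C M = {atom C H | H. monoform C H \<and>
     (\<exists>m e. is_mono C m \<and> is_epi C e \<and> Cod C m = M \<and> Dom C e = Dom C m \<and> Cod C e = H)}"

definition Ass :: "('o, 'm, 'z) cat_scheme \<Rightarrow> 'o \<Rightarrow> 'o set set" where
  "Ass C M = {atom C H | H. monoform C H \<and> (\<exists>m. is_mono C m \<and> Dom C m = H \<and> Cod C m = M)}"

text \<open>In an abelian category the supports form a base, so the topology they generate is the one that
  has them as an open basis.\<close>

definition Spec_top :: "('o, 'm, 'z) cat_scheme \<Rightarrow> 'o set topology" where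
  "Spec_top C = topology_generated_by {Supp C M | M. M \<in> Obj C}"


section \<open>The orbit atom spectrum\<close>

definition iso_class :: "('o, 'm, 'z) cat_scheme \<Rightarrow> 'o \<Rightarrow> 'o set" where
  "iso_class C a = {b. isomorphic C a b}"

text \<open>Multiplication and action are given on classes by taking the union over all representatives;
  as the results do not depend on the representatives, all sets in these unions coincide.\<close>

definition Pic :: "('o, 'm, 'z) smcat_scheme \<Rightarrow> 'o set monoid" where
  "Pic A = \<lparr>carrier = {iso_class A L | L. invertible_object A L},
     monoid.mult = (\<lambda>k l. \<Union>K \<in> k. \<Union>L \<in> l. iso_class A (K \<boxtimes>\<^bsub>A\<^esub> L)),
     one = iso_class A (Unit A)\<rparr>"

definition Pic_act :: "('o, 'm, 'z) smcat_scheme \<Rightarrow> 'o set \<Rightarrow> 'o set \<Rightarrow> 'o set" where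
  "Pic_act A l = (\<lambda>x \<in> Spec A. \<Union>H \<in> x. \<Union>L \<in> l. atom A (H \<boxtimes>\<^bsub>A\<^esub> L))"

definition LSpec :: "('o, 'm, 'z) smcat_scheme \<Rightarrow> 'o set set set" where
  "LSpec A = orbits (Pic A) (Spec A) (Pic_act A)"

definition LSpec_proj :: "('o, 'm, 'z) smcat_scheme \<Rightarrow> 'o set \<Rightarrow> 'o set set" where
  "LSpec_proj A x = orbit (Pic A) (Pic_act A) x"

definition LSpec_top :: "('o, 'm, 'z) smcat_scheme \<Rightarrow> 'o set set topology" where
  "LSpec_top A = topology (\<lambda>U. U \<subseteq> LSpec A \<and> openin (Spec_top A) {x \<in> Spec A. LSpec_proj A x \<in> U})"

definition LSupp :: "('o, 'm, 'z) smcat_scheme \<Rightarrow> 'o \<Rightarrow> 'o set set set" where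
  "LSupp A M = LSpec_proj A ` Supp A M"

definition LAss :: "('o, 'm, 'z) smcat_scheme \<Rightarrow> 'o \<Rightarrow> 'o set set set" where
  "LAss A M = LSpec_proj A ` Ass A M"

definition LAss_inv :: "('o, 'm, 'z) smcat_scheme \<Rightarrow> 'o set set set \<Rightarrow> 'o set" where
  "LAss_inv A \<Phi> = {M \<in> Obj (noeth A). LAss A M \<subseteq> \<Phi>}"

definition LAss_class :: "('o, 'm, 'z) smcat_scheme \<Rightarrow> 'o set \<Rightarrow> 'o set set set" where
  "LAss_class A X = (\<Union>M \<in> X. LAss A M)"

lemma openin_LSpec_top:
  "openin (LSpec_top A) U \<longleftrightarrow>
     U \<subseteq> LSpec A \<and> openin (Spec_top A) {x \<in> Spec A. LSpec_proj A x \<in> U}"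
proof -
  let ?pre = "\<lambda>U. {x \<in> Spec A. LSpec_proj A x \<in> U}"
  have "istopology (\<lambda>U. U \<subseteq> LSpec A \<and> openin (Spec_top A) (?pre U))"
    unfolding istopology_def
  proof (intro conjI allI impI)
    fix S T
    assume "S \<subseteq> LSpec A \<and> openin (Spec_top A) (?pre S)"
      and "T \<subseteq> LSpec A \<and> openin (Spec_top A) (?pre T)"
    moreover have "?pre (S \<inter> T) = ?pre S \<inter> ?pre T" by blast
    ultimately show "S \<inter> T \<subseteq> LSpec A" "openin (Spec_top A) (?pre (S \<inter> T))" by auto
  next
    fix K
    assume *: "\<forall>S \<in> K. S \<subseteq> LSpec A \<and> openin (Spec_top A) (?pre S)"
    then show "\<Union>K \<subseteq> LSpec A" by blast
    have "?pre (\<Union>K) = (\<Union>S \<in> K. ?pre S)" by blast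
    then show "openin (Spec_top A) (?pre (\<Union>K))" using * by auto
  qed
  then show ?thesis by (simp add: LSpec_top_def topology_inverse')
qed

end

theory Submission
  imports Defs
begin

text \<open>Say that an arrow \<open>j: J \<rightarrow> I\<close> kills \<open>X\<close> if \<open>j \<otimes> X = 0\<close>; the largest subobject of \<open>I\<close> with this
  property is the annihilator of \<open>X\<close>. The unit \<open>I\<close> is noetherian, being finitely presented, and every
  nonzero object has a nonzero subobject that is a quotient of an invertible object. Maximal
  annihilators therefore exist, and every nonzero object contains a prime object: a nonzero quotient
  of an invertible object all of whose nonzero subobjects have the same annihilator. Prime objects
  are monoform. Primes in the same Picard orbit have the same annihilator, and primes with the same
  annihilator become isomorphic after twisting with invertible objects, so that an L-closed class
  contains both or neither of them.

  The main point is that a noetherian \<open>M\<close> with \<open>LAss M \<subseteq> LAss \<X>\<close> belongs to \<open>\<X>\<close>. Otherwise take a maximal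
  subobject \<open>Q'\<close> of \<open>M\<close> in \<open>\<X>\<close> and \<open>Q' \<subset> Q \<subseteq> M\<close> with \<open>C = Q/Q'\<close> prime; let \<open>a\<close> be the annihilator
  of \<open>C\<close>. Then \<open>a \<otimes> Q \<rightarrow> Q\<close> has its image in \<open>Q'\<close>, and an argument of Artin--Rees type yields \<open>Z \<subseteq> Q\<close>
  killed by \<open>a\<close> such that \<open>Z \<in> \<X>\<close> would imply \<open>Q \<in> \<X>\<close>. Hence the image of \<open>Z\<close> in \<open>C\<close> is not zero and
  contains a prime \<open>D\<close>, whose orbit lies in \<open>LSupp Z\<close>. By hypothesis \<open>LAss Z\<close> contains the orbit of a
  prime \<open>E\<close> in the closure of that of \<open>D\<close>, whence the annihilator of \<open>E\<close> is contained in that of \<open>D\<close>,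
  which is \<open>a\<close>; conversely \<open>a\<close> kills \<open>E\<close> because it kills \<open>Z\<close>. As the orbit of \<open>E\<close> is in
  \<open>LAss M \<subseteq> LAss \<X>\<close>, it follows that \<open>C \<in> \<X>\<close> and \<open>Q \<in> \<X>\<close>, contradicting the choice of \<open>Q'\<close>.\<close>

section \<open>Categories\<close>

text \<open>The obstacle throughout is that tensoring is only right exact: closedness makes it a
  left adjoint, so epimorphisms and cokernels are preserved, while monomorphisms are only known to
  survive tensoring with invertible objects. Hence ideals J of I are handled through the vanishing
  of arrows \<open>j \<odot> X\<close>, and this vanishing passes to subobjects because I \<otimes>
  - is naturally the identity. Primes with the same annihilator agree up to twists since each
  becomes, after a twist, a quotient of I, and such a quotient is determined by what kills it. The
  Artin--Rees step filters the noetherian annihilator by quotients of invertible objects. For L with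
  inverse M, an arrow L \<otimes> Q -> Y amounts to an arrow Q -> Y \<otimes> M, whose target is
  again in the class by L-closedness; its kernel is the required subobject. Closure in
  \<open>LSpec_top\<close> bounds annihilators because \<open>LSupp A E\<close> is open: if the
  orbit of E lies in the closure of that of D, some nonzero subobject of D embeds in a twist of a
  subquotient of E, so D inherits whatever kills E.\<close>

lemma in_Hom [simp]: "f \<in> Hom C a b \<longleftrightarrow> f \<in> Arr C \<and> Dom C f = a \<and> Cod C f = b"
  by (auto simp: Hom_def)

context category
begin

lemma obj_of_arr [simp]: "f \<in> Arr C \<Longrightarrow> Dom C f \<in> Obj C" "f \<in> Arr C \<Longrightarrow> Cod C f \<in> Obj C"
  using dom_cod by auto

lemma cmp_simps [simp]:
  assumes "f \<in> Arr C" "g \<in> Arr C" "Dom C g = Cod C f"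
  shows "g \<cdot> f \<in> Arr C" "Dom C (g \<cdot> f) = Dom C f" "Cod C (g \<cdot> f) = Cod C g"
  using cmp_in_Hom[of f "Dom C f" "Cod C f" g "Cod C g"] assms by auto

lemma idn_simps [simp]:
  assumes "a \<in> Obj C"
  shows "Idn C a \<in> Arr C" "Dom C (Idn C a) = a" "Cod C (Idn C a) = a"
  using idn_in_Hom[OF assms] by auto

lemma cmp_idn [simp]:
  "f \<in> Arr C \<Longrightarrow> Dom C f = a \<Longrightarrow> f \<cdot> Idn C a = f"
  "f \<in> Arr C \<Longrightarrow> Cod C f = a \<Longrightarrow> Idn C a \<cdot> f = f"
  using cmp_idn_left[of f "Dom C f" "Cod C f"] cmp_idn_right[of f "Dom C f" "Cod C f"] by auto

lemma assoc [simp]: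
  assumes "f \<in> Arr C" "g \<in> Arr C" "h \<in> Arr C" "Dom C g = Cod C f" "Dom C h = Cod C g"
  shows "(h \<cdot> g) \<cdot> f = h \<cdot> g \<cdot> f"
  using cmp_assoc[of f "Dom C f" "Cod C f" g "Cod C g" h "Cod C h"] assms by auto

text \<open>Simplification brackets composites to the right, so an equation for
  \<open>g \<cdot> f\<close> does not match inside \<open>g \<cdot> f \<cdot> x\<close>; this
  supplies it with the tail \<open>x\<close> attached.\<close>

lemma cmp_extend:
  assumes "g \<cdot> f = h" "f \<in> Arr C" "g \<in> Arr C" "Dom C g = Cod C f" "x \<in> Arr C" "Cod C x = Dom C f"
  shows "g \<cdot> f \<cdot> x = h \<cdot> x"
  using assms assoc[of x f g] by simp

lemma zero_objD: "is_zero C z \<Longrightarrow> z \<in> Obj C"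
  by (simp add: is_zero_def)

lemma zero_obj_unique:
  assumes "is_zero C z" "f \<in> Arr C" "g \<in> Arr C" "Dom C f = Dom C g" "Cod C f = Cod C g"
    "Dom C f = z \<or> Cod C f = z"
  shows "f = g"
proof -
  have "f \<in> Hom C (Dom C f) (Cod C f)" "g \<in> Hom C (Dom C f) (Cod C f)" using assms by auto
  moreover have "\<exists>!h. h \<in> Hom C (Dom C f) (Cod C f)"
    using assms(1,6) obj_of_arr[OF assms(2)] unfolding is_zero_def by blast
  ultimately show ?thesis by blast
qed

lemma zero_obj_ex:
  assumes "is_zero C z" "a \<in> Obj C"
  shows "\<exists>f \<in> Arr C. Dom C f = a \<and> Cod C f = z" "\<exists>f \<in> Arr C. Dom C f = z \<and> Cod C f = a"
  using assms unfolding is_zero_def by auto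

lemma zero_arr [simp]: "zero_arrow C f \<Longrightarrow> f \<in> Arr C"
  unfolding zero_arrow_def by auto

lemma zero_arrowE:
  assumes "zero_arrow C f"
  obtains z g h where "is_zero C z" "g \<in> Arr C" "Dom C g = Dom C f" "Cod C g = z" "h \<in> Arr C"
    "Dom C h = z" "Cod C h = Cod C f" "h \<cdot> g = f"
  using assms unfolding zero_arrow_def by (metis in_Hom)

lemma zero_arrowI:
  assumes "is_zero C z" "f \<in> Arr C" "Dom C f = z \<or> Cod C f = z"
  shows "zero_arrow C f"
proof -
  have d: "Dom C f \<in> Obj C" "Cod C f \<in> Obj C" using assms by auto
  obtain g where g: "g \<in> Arr C" "Dom C g = Dom C f" "Cod C g = z" using zero_obj_ex[OF assms(1)] d by metis
  obtain h where h: "h \<in> Arr C" "Dom C h = z" "Cod C h = Cod C f" using zero_obj_ex[OF assms(1)] d by metis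
  have "f = h \<cdot> g" using assms(3)
    by (intro zero_obj_unique[OF assms(1)]) (use assms g h in auto)
  then show ?thesis unfolding zero_arrow_def using assms(1) g h by auto
qed

lemma zero_cmpR [simp]:
  assumes "zero_arrow C f" "e \<in> Arr C" "Cod C e = Dom C f"
  shows "zero_arrow C (f \<cdot> e)"
proof -
  obtain z g h where h: "is_zero C z" "g \<in> Arr C" "Dom C g = Dom C f" "Cod C g = z" "h \<in> Arr C"
    "Dom C h = z" "Cod C h = Cod C f" "h \<cdot> g = f" using zero_arrowE[OF assms(1)] by metis
  have "h \<cdot> g \<cdot> e = f \<cdot> e" by (rule cmp_extend) (use h assms in auto)
  moreover have "f \<in> Arr C" using assms by simp
  ultimately show ?thesis using h(1-7) assms unfolding zero_arrow_def
    by (intro exI[of _ z] exI[of _ "g \<cdot> e"] exI[of _ h]) simp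
qed

lemma zero_cmpL [simp]:
  assumes "zero_arrow C f" "e \<in> Arr C" "Dom C e = Cod C f"
  shows "zero_arrow C (e \<cdot> f)"
proof -
  obtain z g h where h: "is_zero C z" "g \<in> Arr C" "Dom C g = Dom C f" "Cod C g = z" "h \<in> Arr C"
    "Dom C h = z" "Cod C h = Cod C f" "h \<cdot> g = f" using zero_arrowE[OF assms(1)] by metis
  have "(e \<cdot> h) \<cdot> g = e \<cdot> f" using h assms by simp
  moreover have "f \<in> Arr C" using assms by simp
  ultimately show ?thesis using h(1-7) assms(2-) unfolding zero_arrow_def
    by (intro exI[of _ z] exI[of _ "g"] exI[of _ "e \<cdot> h"]) simp
qed

text \<open>The arrow \<open>i\<close> between the two zero objects carries one factorization into
  the other: \<open>i \<cdot> a = c\<close> and \<open>d \<cdot> i = b\<close> by uniqueness at a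
  zero object.\<close>

lemma zero_arrow_unique:
  assumes "zero_arrow C f" "zero_arrow C g" "Dom C f = Dom C g" "Cod C f = Cod C g"
  shows "f = g"
proof -
  obtain z a b where h: "is_zero C z" "a \<in> Arr C" "Dom C a = Dom C f" "Cod C a = z" "b \<in> Arr C"
    "Dom C b = z" "Cod C b = Cod C f" "b \<cdot> a = f" using zero_arrowE[OF assms(1)] by metis
  obtain y c d where k: "is_zero C y" "c \<in> Arr C" "Dom C c = Dom C g" "Cod C c = y" "d \<in> Arr C"
    "Dom C d = y" "Cod C d = Cod C g" "d \<cdot> c = g" using zero_arrowE[OF assms(2)] by metis
  obtain i where i: "i \<in> Arr C" "Dom C i = z" "Cod C i = y" using zero_obj_ex[OF k(1), of z] zero_objD[OF h(1)] by auto
  have "i \<cdot> a = c" by (rule zero_obj_unique[OF k(1)]) (use h k i assms in auto)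
  moreover have "d \<cdot> i = b" by (rule zero_obj_unique[OF h(1)]) (use h k i assms in auto)
  then have "d \<cdot> i \<cdot> a = b \<cdot> a" by (rule cmp_extend) (use h k i assms in auto)
  ultimately show ?thesis using h(8) k(8) by simp
qed

text \<open>If the identity factors through a zero object, every arrow into or out of
  \<open>x\<close> is zero, and parallel zero arrows agree.\<close>

lemma zero_iff_idn: "is_zero C x \<longleftrightarrow> x \<in> Obj C \<and> zero_arrow C (Idn C x)"
proof
  assume "is_zero C x"
  then show "x \<in> Obj C \<and> zero_arrow C (Idn C x)" using zero_arrowI[of x "Idn C x"] zero_objD by auto
next
  assume a: "x \<in> Obj C \<and> zero_arrow C (Idn C x)"
  then obtain z g h where h: "is_zero C z" "g \<in> Arr C" "Dom C g = x" "Cod C g = z" "h \<in> Arr C"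
    "Dom C h = z" "Cod C h = x" "h \<cdot> g = Idn C x" using zero_arrowE[of "Idn C x"] idn_simps[of x] by metis
  have u1: "zero_arrow C f" if "f \<in> Arr C" "Cod C f = x" for f
    using zero_cmpR[of "Idn C x" f] a that by simp
  have u2: "zero_arrow C f" if "f \<in> Arr C" "Dom C f = x" for f
    using zero_cmpL[of "Idn C x" f] a that by simp
  show "is_zero C x" unfolding is_zero_def
  proof (intro conjI ballI)
    fix b assume b: "b \<in> Obj C"
    obtain c where c: "c \<in> Arr C" "Dom C c = b" "Cod C c = z" using zero_obj_ex[OF h(1) b] by auto
    obtain d where d: "d \<in> Arr C" "Dom C d = z" "Cod C d = b" using zero_obj_ex[OF h(1) b] by auto
    show "\<exists>!f. f \<in> Hom C b x"
      by (rule ex1I[of _ "h \<cdot> c"]) (use c d h u1 in \<open>auto intro!: zero_arrow_unique\<close>)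
    show "\<exists>!f. f \<in> Hom C x b"
      by (rule ex1I[of _ "d \<cdot> g"]) (use c d h u2 in \<open>auto intro!: zero_arrow_unique\<close>)
  qed (use a in auto)
qed

section \<open>Monomorphisms, epimorphisms, isomorphisms, kernels and cokernels\<close>

lemma monoI:
  assumes "f \<in> Arr C" "\<And>g h. g \<in> Arr C \<Longrightarrow> h \<in> Arr C \<Longrightarrow> Dom C g = Dom C h \<Longrightarrow> Cod C g = Dom C f \<Longrightarrow>
    Cod C h = Dom C f \<Longrightarrow> f \<cdot> g = f \<cdot> h \<Longrightarrow> g = h"
  shows "is_mono C f"
  using assms unfolding is_mono_def by (metis in_Hom)

lemma epiI:
  assumes "f \<in> Arr C" "\<And>g h. g \<in> Arr C \<Longrightarrow> h \<in> Arr C \<Longrightarrow> Cod C g = Cod C h \<Longrightarrow> Dom C g = Cod C f \<Longrightarrow>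
    Dom C h = Cod C f \<Longrightarrow> g \<cdot> f = h \<cdot> f \<Longrightarrow> g = h"
  shows "is_epi C f"
  using assms unfolding is_epi_def by (metis in_Hom)

lemma mono_arr [simp]: "is_mono C f \<Longrightarrow> f \<in> Arr C" by (simp add: is_mono_def)
lemma epi_arr [simp]: "is_epi C f \<Longrightarrow> f \<in> Arr C" by (simp add: is_epi_def)
lemma iso_arr [simp]: "is_iso C f \<Longrightarrow> f \<in> Arr C" by (simp add: is_iso_def)

lemma monoD:
  assumes "is_mono C f" "f \<cdot> g = f \<cdot> h" "g \<in> Arr C" "h \<in> Arr C" "Dom C g = Dom C h" "Cod C g = Dom C f"
    "Cod C h = Dom C f"
  shows "g = h"
  using assms unfolding is_mono_def by (metis in_Hom)

lemma epiD:
  assumes "is_epi C f" "g \<cdot> f = h \<cdot> f" "g \<in> Arr C" "h \<in> Arr C" "Cod C g = Cod C h" "Dom C g = Cod C f"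
    "Dom C h = Cod C f"
  shows "g = h"
  using assms unfolding is_epi_def by (metis in_Hom)

lemma isoE:
  assumes "is_iso C f"
  obtains g where "g \<in> Arr C" "Dom C g = Cod C f" "Cod C g = Dom C f" "g \<cdot> f = Idn C (Dom C f)"
    "f \<cdot> g = Idn C (Cod C f)" "is_iso C g"
  using assms unfolding is_iso_def by (metis in_Hom)

lemma isoI:
  assumes "f \<in> Arr C" "g \<in> Arr C" "Dom C g = Cod C f" "Cod C g = Dom C f" "g \<cdot> f = Idn C (Dom C f)"
    "f \<cdot> g = Idn C (Cod C f)"
  shows "is_iso C f"
  using assms unfolding is_iso_def by auto

lemma iso_mono:
  assumes "is_iso C f" shows "is_mono C f"
proof -
  obtain g where g: "g \<in> Arr C" "Dom C g = Cod C f" "Cod C g = Dom C f" "g \<cdot> f = Idn C (Dom C f)"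
    using isoE[OF assms] by metis
  show ?thesis
  proof (rule monoI)
    fix x y assume a: "x \<in> Arr C" "y \<in> Arr C" "Dom C x = Dom C y" "Cod C x = Dom C f" "Cod C y = Dom C f" "f \<cdot> x = f \<cdot> y"
    have "g \<cdot> f \<cdot> x = Idn C (Dom C f) \<cdot> x" by (rule cmp_extend) (use assms g a in auto)
    moreover have "g \<cdot> f \<cdot> y = Idn C (Dom C f) \<cdot> y" by (rule cmp_extend) (use assms g a in auto)
    ultimately show "x = y" using a(1-5) unfolding a(6) by simp
  qed (use assms in auto)
qed

lemma iso_epi:
  assumes "is_iso C f" shows "is_epi C f"
proof -
  obtain g where g: "g \<in> Arr C" "Dom C g = Cod C f" "Cod C g = Dom C f" "f \<cdot> g = Idn C (Cod C f)"
    using isoE[OF assms] by metis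
  show ?thesis
  proof (rule epiI)
    fix x y assume a: "x \<in> Arr C" "y \<in> Arr C" "Cod C x = Cod C y" "Dom C x = Cod C f" "Dom C y = Cod C f" "x \<cdot> f = y \<cdot> f"
    have "(x \<cdot> f) \<cdot> g = (y \<cdot> f) \<cdot> g" using a by simp
    then show "x = y" using a(1-5) g assms by simp
  qed (use assms in auto)
qed

lemma mono_cmp: "is_mono C f \<Longrightarrow> is_mono C g \<Longrightarrow> Dom C g = Cod C f \<Longrightarrow> is_mono C (g \<cdot> f)"
  by (rule monoI) (auto dest: monoD)

lemma epi_cmp:
  assumes "is_epi C f" "is_epi C g" "Dom C g = Cod C f" shows "is_epi C (g \<cdot> f)"
proof (rule epiI)
  fix x y assume a: "x \<in> Arr C" "y \<in> Arr C" "Cod C x = Cod C y" "Dom C x = Cod C (g \<cdot> f)" "Dom C y = Cod C (g \<cdot> f)"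
    "x \<cdot> g \<cdot> f = y \<cdot> g \<cdot> f"
  have "x \<cdot> g = y \<cdot> g" by (rule epiD[OF assms(1)]) (use a assms in auto)
  then show "x = y" by (rule epiD[OF assms(2)]) (use a assms in auto)
qed (use assms in auto)

lemma mono_cancel: "is_mono C (g \<cdot> f) \<Longrightarrow> f \<in> Arr C \<Longrightarrow> g \<in> Arr C \<Longrightarrow> Dom C g = Cod C f \<Longrightarrow> is_mono C f"
proof (rule monoI)
  fix x y assume a: "is_mono C (g \<cdot> f)" "f \<in> Arr C" "g \<in> Arr C" "Dom C g = Cod C f"
   "x \<in> Arr C" "y \<in> Arr C" "Dom C x = Dom C y" "Cod C x = Dom C f" "Cod C y = Dom C f" "f \<cdot> x = f \<cdot> y"
  show "x = y" by (rule monoD[OF a(1)]) (use a(2-) in auto)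
qed

lemma epi_cancel: "is_epi C (g \<cdot> f) \<Longrightarrow> f \<in> Arr C \<Longrightarrow> g \<in> Arr C \<Longrightarrow> Dom C g = Cod C f \<Longrightarrow> is_epi C g"
proof (rule epiI)
  fix x y assume a: "is_epi C (g \<cdot> f)" "f \<in> Arr C" "g \<in> Arr C" "Dom C g = Cod C f"
   "x \<in> Arr C" "y \<in> Arr C" "Cod C x = Cod C y" "Dom C x = Cod C g" "Dom C y = Cod C g" "x \<cdot> g = y \<cdot> g"
  have "x \<cdot> g \<cdot> f = y \<cdot> g \<cdot> f" using a assoc[of f g x] assoc[of f g y] by simp
  then show "x = y" by (rule epiD[OF a(1)]) (use a(2-9) in auto)
qed

lemma iso_cmp:
  assumes "is_iso C f" "is_iso C g" "Dom C g = Cod C f" shows "is_iso C (g \<cdot> f)"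
proof -
  obtain f' where f': "f' \<in> Arr C" "Dom C f' = Cod C f" "Cod C f' = Dom C f" "f' \<cdot> f = Idn C (Dom C f)"
    "f \<cdot> f' = Idn C (Cod C f)" using isoE[OF assms(1)] by metis
  obtain g' where g': "g' \<in> Arr C" "Dom C g' = Cod C g" "Cod C g' = Dom C g" "g' \<cdot> g = Idn C (Dom C g)"
    "g \<cdot> g' = Idn C (Cod C g)" using isoE[OF assms(2)] by metis
  have 1: "g' \<cdot> g \<cdot> f = Idn C (Dom C g) \<cdot> f" by (rule cmp_extend) (use assms f' g' in auto)
  have 2: "f \<cdot> f' \<cdot> g' = Idn C (Cod C f) \<cdot> g'" by (rule cmp_extend) (use assms f' g' in auto)
  show ?thesis by (rule isoI[of _ "f' \<cdot> g'"]) (use assms f' g' 1 2 in auto)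
qed

lemma isomorphicI: "is_iso C f \<Longrightarrow> isomorphic C (Dom C f) (Cod C f)"
  unfolding isomorphic_def by (intro bexI[of _ f]) auto

lemma isomorphicD: "isomorphic C a b \<Longrightarrow> \<exists>f. is_iso C f \<and> Dom C f = a \<and> Cod C f = b"
  unfolding isomorphic_def by auto

lemma idn_iso: "a \<in> Obj C \<Longrightarrow> is_iso C (Idn C a)"
  by (rule isoI[of _ "Idn C a"]) auto

lemma isomorphic_refl: "a \<in> Obj C \<Longrightarrow> isomorphic C a a"
  using isomorphicI[OF idn_iso] by simp

lemma isomorphic_sym: "isomorphic C a b \<Longrightarrow> isomorphic C b a"
  using isomorphicD isomorphicI isoE by metis

lemma isomorphic_trans: "isomorphic C a b \<Longrightarrow> isomorphic C b c \<Longrightarrow> isomorphic C a c"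
proof -
  assume "isomorphic C a b" "isomorphic C b c"
  then obtain f g where h: "is_iso C f" "Dom C f = a" "Cod C f = b" "is_iso C g" "Dom C g = b" "Cod C g = c"
    using isomorphicD by metis
  then have "is_iso C (g \<cdot> f)" using iso_cmp by simp
  from isomorphicI[OF this] show ?thesis using h by simp
qed

lemma zero_isomorphic: 
  assumes "is_zero C a" "isomorphic C a b" shows "is_zero C b"
proof -
  obtain f where f: "is_iso C f" "Dom C f = a" "Cod C f = b" using isomorphicD[OF assms(2)] by auto
  obtain g where g: "g \<in> Arr C" "Dom C g = b" "Cod C g = a" "f \<cdot> g = Idn C b" using isoE[OF f(1)] f by metis
  have "zero_arrow C (f \<cdot> g)" by (rule zero_cmpR[OF zero_arrowI[OF assms(1)]]) (use f g in auto)
  then have "zero_arrow C (Idn C b)" unfolding g(4) .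
  moreover have "b \<in> Obj C" using f iso_arr obj_of_arr by metis
  ultimately show ?thesis using zero_iff_idn by blast
qed

lemma kernelD:
  assumes "is_kernel C f k"
  shows "f \<in> Arr C" "k \<in> Arr C" "Cod C k = Dom C f" "zero_arrow C (f \<cdot> k)"
  using assms unfolding is_kernel_def by auto

lemma kernel_lift:
  assumes "is_kernel C f k" "g \<in> Arr C" "Cod C g = Dom C f" "zero_arrow C (f \<cdot> g)"
  shows "\<exists>u \<in> Arr C. Dom C u = Dom C g \<and> Cod C u = Dom C k \<and> k \<cdot> u = g"
  using assms unfolding is_kernel_def by (metis in_Hom)

lemma kernel_mono:
  assumes "is_kernel C f k" shows "is_mono C k"
proof (rule monoI)
  note k = kernelD[OF assms]
  fix x y assume a: "x \<in> Arr C" "y \<in> Arr C" "Dom C x = Dom C y" "Cod C x = Dom C k" "Cod C y = Dom C k" "k \<cdot> x = k \<cdot> y"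
  have "zero_arrow C ((f \<cdot> k) \<cdot> x)" by (rule zero_cmpR) (use k a in auto)
  then have "zero_arrow C (f \<cdot> (k \<cdot> x))" using k a by simp
  then have "\<exists>!u. u \<in> Hom C (Dom C x) (Dom C k) \<and> k \<cdot> u = k \<cdot> x"
    using assms k a unfolding is_kernel_def by simp
  then show "x = y" using a by (metis in_Hom)
qed (use kernelD[OF assms] in auto)

lemma cokernelD:
  assumes "is_cokernel C f q"
  shows "f \<in> Arr C" "q \<in> Arr C" "Dom C q = Cod C f" "zero_arrow C (q \<cdot> f)"
  using assms unfolding is_cokernel_def by auto

lemma cokernel_desc:
  assumes "is_cokernel C f q" "g \<in> Arr C" "Dom C g = Cod C f" "zero_arrow C (g \<cdot> f)"
  shows "\<exists>u \<in> Arr C. Cod C u = Cod C g \<and> Dom C u = Cod C q \<and> u \<cdot> q = g"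
  using assms unfolding is_cokernel_def by (metis in_Hom)

lemma cokernel_epi:
  assumes "is_cokernel C f q" shows "is_epi C q"
proof (rule epiI)
  note k = cokernelD[OF assms]
  fix x y assume a: "x \<in> Arr C" "y \<in> Arr C" "Cod C x = Cod C y" "Dom C x = Cod C q" "Dom C y = Cod C q" "x \<cdot> q = y \<cdot> q"
  have "zero_arrow C (x \<cdot> (q \<cdot> f))" by (rule zero_cmpL) (use k a in auto)
  then have "zero_arrow C ((x \<cdot> q) \<cdot> f)" using k a by simp
  then have "\<exists>!u. u \<in> Hom C (Cod C q) (Cod C x) \<and> u \<cdot> q = x \<cdot> q"
    using assms k a unfolding is_cokernel_def by simp
  then show "x = y" using a by (metis in_Hom)
qed (use cokernelD[OF assms] in auto)

lemma kernelI:
  assumes "f \<in> Arr C" "is_mono C k" "Cod C k = Dom C f" "zero_arrow C (f \<cdot> k)"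
    "\<And>g. g \<in> Arr C \<Longrightarrow> Cod C g = Dom C f \<Longrightarrow> zero_arrow C (f \<cdot> g) \<Longrightarrow> 
      \<exists>u \<in> Arr C. Dom C u = Dom C g \<and> Cod C u = Dom C k \<and> k \<cdot> u = g"
  shows "is_kernel C f k"
  unfolding is_kernel_def
proof (intro conjI allI ballI impI)
  fix x g assume g: "g \<in> Hom C x (Dom C f)" "zero_arrow C (f \<cdot> g)"
  then obtain u where u: "u \<in> Arr C" "Dom C u = Dom C g" "Cod C u = Dom C k" "k \<cdot> u = g" using assms(5)[of g] by auto
  show "\<exists>!u. u \<in> Hom C x (Dom C k) \<and> k \<cdot> u = g"
    by (rule ex1I[of _ u]) (use u g in \<open>auto intro!: monoD[OF assms(2)]\<close>)
qed (use assms in auto)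

lemma cokernelI:
  assumes "f \<in> Arr C" "is_epi C k" "Dom C k = Cod C f" "zero_arrow C (k \<cdot> f)"
    "\<And>g. g \<in> Arr C \<Longrightarrow> Dom C g = Cod C f \<Longrightarrow> zero_arrow C (g \<cdot> f) \<Longrightarrow> 
      \<exists>u \<in> Arr C. Cod C u = Cod C g \<and> Dom C u = Cod C k \<and> u \<cdot> k = g"
  shows "is_cokernel C f k"
  unfolding is_cokernel_def
proof (intro conjI allI ballI impI)
  fix x g assume g: "g \<in> Hom C (Cod C f) x" "zero_arrow C (g \<cdot> f)"
  then obtain u where u: "u \<in> Arr C" "Cod C u = Cod C g" "Dom C u = Cod C k" "u \<cdot> k = g" using assms(5)[of g] by auto
  show "\<exists>!u. u \<in> Hom C (Cod C k) x \<and> u \<cdot> k = g"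
    by (rule ex1I[of _ u]) (use u g in \<open>auto intro!: epiD[OF assms(2)]\<close>)
qed (use assms in auto)

end

section \<open>Abelian categories\<close>

locale abelian_category =
  fixes C :: "('o, 'm, 'z) cat_scheme" (structure)
  assumes abelian: "abelian C"

sublocale abelian_category \<subseteq> category
  using abelian unfolding abelian_def preadditive_def by blast

context abelian_category
begin

lemma zero_exists: "\<exists>z. is_zero C z"
  using abelian unfolding abelian_def by blast

lemma zero_arrow_exists:
  assumes "a \<in> Obj C" "b \<in> Obj C"
  shows "\<exists>f. zero_arrow C f \<and> Dom C f = a \<and> Cod C f = b"
proof -
  obtain z where z: "is_zero C z" using zero_exists ..
  obtain g where g: "g \<in> Arr C" "Dom C g = a" "Cod C g = z" using zero_obj_ex[OF z assms(1)] by auto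
  obtain h where h: "h \<in> Arr C" "Dom C h = z" "Cod C h = b" using zero_obj_ex[OF z assms(2)] by auto
  show ?thesis by (rule exI[of _ "h \<cdot> g"]) (use g h zero_arrowI[OF z] in auto)
qed

text \<open>The addition of arrows is only known to exist. It enters solely through the difference
  \<open>d = f - h\<close> of two parallel arrows, of which just these consequences of bilinearity are used.\<close>

lemma difference:
  assumes "f \<in> Hom C a b" "h \<in> Hom C a b"
  shows "\<exists>d \<in> Hom C a b. 
    (\<forall>g \<in> Arr C. Dom C g = b \<longrightarrow> (zero_arrow C (g \<cdot> d) \<longleftrightarrow> g \<cdot> f = g \<cdot> h)) \<and>
    (\<forall>e \<in> Arr C. Cod C e = a \<longrightarrow> (zero_arrow C (d \<cdot> e) \<longleftrightarrow> f \<cdot> e = h \<cdot> e) \<and>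
       (zero_arrow C (h \<cdot> e) \<longrightarrow> d \<cdot> e = f \<cdot> e))"
proof -
  have "preadditive C" using abelian unfolding abelian_def by blast
  then have "\<exists>add. (\<forall>a \<in> Obj C. \<forall>b \<in> Obj C. \<exists>z. comm_group \<lparr>carrier = Hom C a b, monoid.mult = add, one = z\<rparr>) \<and>
     (\<forall>a b c. \<forall>f \<in> Hom C a b. \<forall>f' \<in> Hom C a b. \<forall>g \<in> Hom C b c. \<forall>g' \<in> Hom C b c.
        g \<cdot> add f f' = add (g \<cdot> f) (g \<cdot> f') \<and> add g g' \<cdot> f = add (g \<cdot> f) (g' \<cdot> f))"
    unfolding preadditive_def by (rule conjunct2)
  then obtain add where add: "(\<forall>a \<in> Obj C. \<forall>b \<in> Obj C. \<exists>z. comm_group \<lparr>carrier = Hom C a b, monoid.mult = add, one = z\<rparr>) \<and>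
     (\<forall>a b c. \<forall>f \<in> Hom C a b. \<forall>f' \<in> Hom C a b. \<forall>g \<in> Hom C b c. \<forall>g' \<in> Hom C b c.
        g \<cdot> add f f' = add (g \<cdot> f) (g \<cdot> f') \<and> add g g' \<cdot> f = add (g \<cdot> f) (g' \<cdot> f))"
    by (rule exE)
  have grp: "\<And>a b. a \<in> Obj C \<Longrightarrow> b \<in> Obj C \<Longrightarrow>
      \<exists>z. comm_group \<lparr>carrier = Hom C a b, monoid.mult = add, one = z\<rparr>"
    using add by blast
  have bil: "\<And>a b c f f' g g'. f \<in> Hom C a b \<Longrightarrow> f' \<in> Hom C a b \<Longrightarrow> g \<in> Hom C b c \<Longrightarrow> g' \<in> Hom C b c \<Longrightarrow>
        g \<cdot> add f f' = add (g \<cdot> f) (g \<cdot> f') \<and> add g g' \<cdot> f = add (g \<cdot> f) (g' \<cdot> f)"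
    using add by blast
  \<comment> \<open>The unit of the additive group and the zero arrow are unrelated by definition.
    The zero arrow \<open>n\<close> factors through a zero object, into which there is only one
    arrow, so \<open>add n n = n\<close> by bilinearity and \<open>n\<close> is the group
    unit.\<close>
  have zero_unit: "zero_arrow C u \<longleftrightarrow> add u v = v" if uv: "u \<in> Hom C x y" "v \<in> Hom C x y" for u v x y
  proof -
    have xy: "x \<in> Obj C" "y \<in> Obj C" using uv by auto
    obtain e where "comm_group \<lparr>carrier = Hom C x y, monoid.mult = add, one = e\<rparr>" using grp xy by blast
    then interpret G: comm_group "\<lparr>carrier = Hom C x y, monoid.mult = add, one = e\<rparr>" .
    obtain n where n: "zero_arrow C n" "Dom C n = x" "Cod C n = y" using zero_arrow_exists[OF xy] by auto
    obtain z p q where z: "is_zero C z" "p \<in> Arr C" "Dom C p = x" "Cod C p = z" "q \<in> Arr C"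
      "Dom C q = z" "Cod C q = y" "q \<cdot> p = n" using zero_arrowE[OF n(1)] n by metis
    have zo: "z \<in> Obj C" using z zero_objD by auto
    have pp: "add p p \<in> Hom C x z"
    proof -
      obtain e where "comm_group \<lparr>carrier = Hom C x z, monoid.mult = add, one = e\<rparr>" using grp xy zo by blast
      then interpret K: comm_group "\<lparr>carrier = Hom C x z, monoid.mult = add, one = e\<rparr>" .
      show ?thesis using K.m_closed[of p p] z by simp
    qed
    have "add p p = p" by (rule zero_obj_unique[OF z(1)]) (use pp z in auto)
    moreover have "q \<cdot> add p p = add (q \<cdot> p) (q \<cdot> p)" using bil[of p x z p q y q] z(2-7) by simp
    ultimately have "add n n = n" using z(8) by simp
    then have "n = e" using G.r_cancel_one[of n n] n by simp
    moreover have "zero_arrow C u \<longleftrightarrow> u = n" using n uv zero_arrow_unique[of u n] by auto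
    ultimately show ?thesis using G.r_cancel_one[of v u] uv by simp
  qed
  have ab: "a \<in> Obj C" "b \<in> Obj C" using assms by auto
  obtain d where d: "d \<in> Hom C a b" "add d h = f"
  proof -
    obtain e where "comm_group \<lparr>carrier = Hom C a b, monoid.mult = add, one = e\<rparr>" using grp ab by blast
    then interpret G: comm_group "\<lparr>carrier = Hom C a b, monoid.mult = add, one = e\<rparr>" .
    let ?G = "\<lparr>carrier = Hom C a b, monoid.mult = add, one = e\<rparr>"
    let ?i = "inv\<^bsub>?G\<^esub> h"
    have i: "?i \<in> Hom C a b" using G.inv_closed[of h] assms by simp
    have "add (add f ?i) h = add f (add ?i h)" using G.m_assoc[of f ?i h] i assms by simp
    also have "\<dots> = f" using G.l_inv[of h] G.r_one[of f] assms by simp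
    finally show ?thesis using that[of "add f ?i"] G.m_closed[of f ?i] i assms by simp
  qed
  show ?thesis
  proof (rule bexI[of _ d], intro conjI ballI impI)
    fix g assume g: "g \<in> Arr C" "Dom C g = b"
    have "add (g \<cdot> d) (g \<cdot> h) = g \<cdot> f" using bil[of d a b h g "Cod C g" g] d assms g by simp
    then show "zero_arrow C (g \<cdot> d) \<longleftrightarrow> g \<cdot> f = g \<cdot> h"
      using zero_unit[of "g \<cdot> d" a "Cod C g" "g \<cdot> h"] d(1) assms g by simp
  next
    fix e assume e: "e \<in> Arr C" "Cod C e = a"
    have *: "add (d \<cdot> e) (h \<cdot> e) = f \<cdot> e" using bil[of e "Dom C e" a e d b h] d assms e by simp
    then show "zero_arrow C (d \<cdot> e) \<longleftrightarrow> f \<cdot> e = h \<cdot> e"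
      using zero_unit[of "d \<cdot> e" "Dom C e" b "h \<cdot> e"] d(1) assms e by simp
    assume z: "zero_arrow C (h \<cdot> e)"
    have "add (h \<cdot> e) (d \<cdot> e) = d \<cdot> e" using zero_unit[of "h \<cdot> e" "Dom C e" b "d \<cdot> e"] z d(1) assms e by simp
    moreover obtain o' where "comm_group \<lparr>carrier = Hom C (Dom C e) b, monoid.mult = add, one = o'\<rparr>"
      using grp ab e by (metis obj_of_arr(1))
    then interpret G: comm_group "\<lparr>carrier = Hom C (Dom C e) b, monoid.mult = add, one = o'\<rparr>" .
    have "add (h \<cdot> e) (d \<cdot> e) = add (d \<cdot> e) (h \<cdot> e)" using G.m_comm[of "h \<cdot> e" "d \<cdot> e"] d(1) assms e by simp
    ultimately show "d \<cdot> e = f \<cdot> e" using * by simp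
  qed (use d in auto)
qed

text \<open>Two arrows that \<open>f\<close> identifies have a difference killed by
  \<open>f\<close>; this difference is zero, and composing it with the identity shows that the
  arrows agree.\<close>

lemma mono0I:
  assumes "f \<in> Arr C" "\<And>g. g \<in> Arr C \<Longrightarrow> Cod C g = Dom C f \<Longrightarrow> zero_arrow C (f \<cdot> g) \<Longrightarrow> zero_arrow C g"
  shows "is_mono C f"
proof (rule monoI)
  fix x y assume a: "x \<in> Arr C" "y \<in> Arr C" "Dom C x = Dom C y" "Cod C x = Dom C f" "Cod C y = Dom C f" "f \<cdot> x = f \<cdot> y"
  have "x \<in> Hom C (Dom C y) (Dom C f)" "y \<in> Hom C (Dom C y) (Dom C f)" using a by auto
  from difference[OF this] obtain d where d: "d \<in> Arr C" "Dom C d = Dom C y" "Cod C d = Dom C f"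
    "zero_arrow C (f \<cdot> d)" "\<And>e. e \<in> Arr C \<Longrightarrow> Cod C e = Dom C y \<Longrightarrow> zero_arrow C (d \<cdot> e) \<longleftrightarrow> x \<cdot> e = y \<cdot> e"
    using assms(1) a(6) by auto
  have "zero_arrow C d" using assms(2)[of d] d(1-4) by simp
  then have "zero_arrow C (d \<cdot> Idn C (Dom C y))" using d(1-3) a(2) by simp
  then show "x = y" using d(5)[of "Idn C (Dom C y)"] a(1-5) by simp
qed (fact assms)

lemma epi0I:
  assumes "f \<in> Arr C" "\<And>g. g \<in> Arr C \<Longrightarrow> Dom C g = Cod C f \<Longrightarrow> zero_arrow C (g \<cdot> f) \<Longrightarrow> zero_arrow C g"
  shows "is_epi C f"
proof (rule epiI)
  fix x y assume a: "x \<in> Arr C" "y \<in> Arr C" "Cod C x = Cod C y" "Dom C x = Cod C f" "Dom C y = Cod C f" "x \<cdot> f = y \<cdot> f"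
  have "x \<in> Hom C (Cod C f) (Cod C y)" "y \<in> Hom C (Cod C f) (Cod C y)" using a by auto
  from difference[OF this] obtain d where d: "d \<in> Arr C" "Dom C d = Cod C f" "Cod C d = Cod C y"
    "zero_arrow C (d \<cdot> f)" "\<And>e. e \<in> Arr C \<Longrightarrow> Cod C e = Cod C f \<Longrightarrow> zero_arrow C (d \<cdot> e) \<longleftrightarrow> x \<cdot> e = y \<cdot> e"
    using assms(1) a(6) by auto
  have "zero_arrow C d" using assms(2)[of d] d(1-4) by simp
  then have "zero_arrow C (d \<cdot> Idn C (Cod C f))" using d(1-3) assms(1) by simp
  then show "x = y" using d(5)[of "Idn C (Cod C f)"] a(1-5) assms(1) by simp
qed (fact assms)

lemma mono_zero:
  assumes "is_mono C f" "g \<in> Arr C" "Cod C g = Dom C f" "zero_arrow C (f \<cdot> g)"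
  shows "zero_arrow C g"
proof -
  obtain n where n: "zero_arrow C n" "Dom C n = Dom C g" "Cod C n = Dom C f"
    using zero_arrow_exists[of "Dom C g" "Dom C f"] assms by auto
  have "f \<cdot> n = f \<cdot> g" by (rule zero_arrow_unique) (use n assms in auto)
  then have "n = g" by (rule monoD[OF assms(1)]) (use n assms in auto)
  then show ?thesis using n by simp
qed

lemma epi_zero:
  assumes "is_epi C f" "g \<in> Arr C" "Dom C g = Cod C f" "zero_arrow C (g \<cdot> f)"
  shows "zero_arrow C g"
proof -
  obtain n where n: "zero_arrow C n" "Cod C n = Cod C g" "Dom C n = Cod C f"
    using zero_arrow_exists[of "Cod C f" "Cod C g"] assms by auto
  have "n \<cdot> f = g \<cdot> f" by (rule zero_arrow_unique) (use n assms in auto)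
  then have "n = g" by (rule epiD[OF assms(1)]) (use n assms in auto)
  then show ?thesis using n by simp
qed

lemma kernel_exists: "f \<in> Arr C \<Longrightarrow> \<exists>k. is_kernel C f k"
  and cokernel_exists: "f \<in> Arr C \<Longrightarrow> \<exists>q. is_cokernel C f q"
  using abelian unfolding abelian_def by blast+

text \<open>Since \<open>m\<close> is the kernel of some \<open>g\<close>, which factors through
  \<open>q\<close>, whatever \<open>q\<close> kills is killed by \<open>g\<close> and lifts to
  \<open>m\<close>.\<close>

lemma mono_kernel_of_cokernel:
  assumes "is_mono C m" "is_cokernel C m q"
  shows "is_kernel C q m"
proof -
  obtain g where g: "is_kernel C g m" using assms abelian unfolding abelian_def by blast
  note k = kernelD[OF g] and c = cokernelD[OF assms(2)]
  obtain w where w: "w \<in> Arr C" "Cod C w = Cod C g" "Dom C w = Cod C q" "w \<cdot> q = g"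
    using cokernel_desc[OF assms(2), of g] k by auto
  show ?thesis
  proof (rule kernelI)
    fix x assume x: "x \<in> Arr C" "Cod C x = Dom C q" "zero_arrow C (q \<cdot> x)"
    have "zero_arrow C (w \<cdot> q \<cdot> x)" by (rule zero_cmpL) (use w c x in auto)
    moreover have "w \<cdot> q \<cdot> x = g \<cdot> x" by (rule cmp_extend[OF w(4)]) (use w c x in auto)
    ultimately show "\<exists>u \<in> Arr C. Dom C u = Dom C x \<and> Cod C u = Dom C m \<and> m \<cdot> u = x"
      using kernel_lift[OF g, of x] x k c by simp
  qed (use assms k c in auto)
qed

lemma epi_cokernel_of_kernel:
  assumes "is_epi C m" "is_kernel C m q"
  shows "is_cokernel C q m"
proof -
  obtain g where g: "is_cokernel C g m" using assms abelian unfolding abelian_def by blast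
  note k = cokernelD[OF g] and c = kernelD[OF assms(2)]
  obtain w where w: "w \<in> Arr C" "Dom C w = Dom C g" "Cod C w = Dom C q" "q \<cdot> w = g"
    using kernel_lift[OF assms(2), of g] k by auto
  show ?thesis
  proof (rule cokernelI)
    fix x assume x: "x \<in> Arr C" "Dom C x = Cod C q" "zero_arrow C (x \<cdot> q)"
    have "zero_arrow C ((x \<cdot> q) \<cdot> w)" by (rule zero_cmpR) (use w c x in auto)
    moreover have "(x \<cdot> q) \<cdot> w = x \<cdot> g" using w c x by simp
    ultimately show "\<exists>u \<in> Arr C. Cod C u = Cod C x \<and> Dom C u = Cod C m \<and> u \<cdot> m = x"
      using cokernel_desc[OF g, of x] x k c by simp
  qed (use assms k c in auto)
qed

text \<open>\<open>f\<close> is the kernel of some \<open>g\<close>, and \<open>g\<close> vanishes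
  because \<open>f\<close> is epi. So the identity of the codomain lifts to a section, which is a
  two-sided inverse by cancelling \<open>f\<close>.\<close>

lemma mono_epi_iso:
  assumes "is_mono C f" "is_epi C f" shows "is_iso C f"
proof -
  obtain g where g: "is_kernel C g f" using assms abelian unfolding abelian_def by blast
  note k = kernelD[OF g]
  have "zero_arrow C g" by (rule epi_zero[OF assms(2)]) (use k in auto)
  then have "zero_arrow C (g \<cdot> Idn C (Cod C f))" using k by simp
  then obtain u where u: "u \<in> Arr C" "Dom C u = Cod C f" "Cod C u = Dom C f" "f \<cdot> u = Idn C (Cod C f)"
    using kernel_lift[OF g, of "Idn C (Cod C f)"] k by auto
  have "f \<cdot> u \<cdot> f = Idn C (Cod C f) \<cdot> f" by (rule cmp_extend[OF u(4)]) (use u k in auto)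
  then have "u \<cdot> f = Idn C (Dom C f)" using monoD[OF assms(1), of "u \<cdot> f" "Idn C (Dom C f)"] u k by simp
  then show ?thesis using isoI[of f u] u k by auto
qed

text \<open>\<open>m\<close> is the kernel of the cokernel \<open>c\<close> of \<open>f\<close>. If
  \<open>g\<close> kills \<open>e\<close> and has kernel \<open>k\<close>, then \<open>f\<close>
  factors through the smaller subobject \<open>m \<cdot> k\<close>; the cokernel of the latter
  factors through \<open>c\<close> and so kills \<open>m\<close>, which splits \<open>k\<close> and
  forces \<open>g\<close> to be zero.\<close>

lemma image:
  assumes "f \<in> Arr C"
  shows "\<exists>e m. is_epi C e \<and> is_mono C m \<and> Dom C m = Cod C e \<and> Dom C e = Dom C f \<and> Cod C m = Cod C f \<and> m \<cdot> e = f"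
proof -
  obtain c where c: "is_cokernel C f c" using cokernel_exists[OF assms] by auto
  note cD = cokernelD[OF c]
  obtain m where m: "is_kernel C c m" using kernel_exists[of c] cD by auto
  note mD = kernelD[OF m]
  obtain e where e: "e \<in> Arr C" "Dom C e = Dom C f" "Cod C e = Dom C m" "m \<cdot> e = f"
    using kernel_lift[OF m, of f] cD by auto
  have "is_epi C e"
  proof (rule epi0I)
    fix g assume g: "g \<in> Arr C" "Dom C g = Cod C e" "zero_arrow C (g \<cdot> e)"
    obtain k where k: "is_kernel C g k" using kernel_exists g by auto
    note kD = kernelD[OF k]
    obtain e' where e': "e' \<in> Arr C" "Dom C e' = Dom C e" "Cod C e' = Dom C k" "k \<cdot> e' = e"
      using kernel_lift[OF k, of e] g e by auto
    have mk: "is_mono C (m \<cdot> k)" by (rule mono_cmp) (use kernel_mono[OF m] kernel_mono[OF k] kD mD e g in auto)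
    have mkd: "m \<cdot> k \<in> Arr C" "Dom C (m \<cdot> k) = Dom C k" "Cod C (m \<cdot> k) = Cod C m" using kD mD e g by auto
    obtain u where u: "is_cokernel C (m \<cdot> k) u" using cokernel_exists[of "m \<cdot> k"] mk by auto
    note uD = cokernelD[OF u]
    have f: "(m \<cdot> k) \<cdot> e' = f" using e e' mD kD g by simp
    have "zero_arrow C ((u \<cdot> m \<cdot> k) \<cdot> e')" by (rule zero_cmpR[OF uD(4)]) (use uD e' mkd in auto)
    moreover have "(u \<cdot> m \<cdot> k) \<cdot> e' = u \<cdot> (m \<cdot> k) \<cdot> e'" by (rule assoc) (use uD e' mkd in auto)
    ultimately have "zero_arrow C (u \<cdot> f)" unfolding f by simp
    then obtain w where w: "w \<in> Arr C" "Cod C w = Cod C u" "Dom C w = Cod C c" "w \<cdot> c = u"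
      using cokernel_desc[OF c, of u] uD mD cD mkd by auto
    have "w \<cdot> c \<cdot> m = u \<cdot> m" by (rule cmp_extend[OF w(4)]) (use w cD mD in auto)
    moreover have "zero_arrow C (w \<cdot> c \<cdot> m)" by (rule zero_cmpL) (use w cD mD in auto)
    ultimately have "zero_arrow C (u \<cdot> m)" by simp
    then obtain s where s: "s \<in> Arr C" "Dom C s = Dom C m" "Cod C s = Dom C k" "(m \<cdot> k) \<cdot> s = m"
      using kernel_lift[OF mono_kernel_of_cokernel[OF mk u], of m] mD uD mkd by auto
    have "k \<cdot> s = Idn C (Dom C m)"
      by (rule monoD[OF kernel_mono[OF m]]) (use s mD kD e g in auto)
    moreover have "zero_arrow C ((g \<cdot> k) \<cdot> s)" by (rule zero_cmpR) (use s kD in auto)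
    ultimately show "zero_arrow C g" using s kD g e mD by simp
  qed (fact e)
  then show ?thesis using e mD kernel_mono[OF m] cD by (intro exI[of _ e] exI[of _ m]) simp
qed

lemma cokernel_unique:
  assumes "is_cokernel C f q" "is_cokernel C f q'"
  shows "\<exists>i. is_iso C i \<and> Dom C i = Cod C q \<and> Cod C i = Cod C q' \<and> i \<cdot> q = q'"
proof -
  note q = cokernelD[OF assms(1)] and q' = cokernelD[OF assms(2)]
  obtain i where i: "i \<in> Arr C" "Cod C i = Cod C q'" "Dom C i = Cod C q" "i \<cdot> q = q'"
    using cokernel_desc[OF assms(1), of q'] q q' by auto
  obtain j where j: "j \<in> Arr C" "Cod C j = Cod C q" "Dom C j = Cod C q'" "j \<cdot> q' = q"
    using cokernel_desc[OF assms(2), of q] q q' by auto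
  have "(j \<cdot> i) \<cdot> q = Idn C (Cod C q) \<cdot> q" using i j q by simp
  then have 1: "j \<cdot> i = Idn C (Cod C q)" by (rule epiD[OF cokernel_epi[OF assms(1)]]) (use i j q in auto)
  have "(i \<cdot> j) \<cdot> q' = Idn C (Cod C q') \<cdot> q'" using i j q' by simp
  then have 2: "i \<cdot> j = Idn C (Cod C q')" by (rule epiD[OF cokernel_epi[OF assms(2)]]) (use i j q' in auto)
  show ?thesis using isoI[of i j] i j 1 2 by auto
qed

lemma kernel_comp_mono:
  assumes "is_mono C m" "e \<in> Arr C" "Dom C m = Cod C e"
  shows "is_kernel C (m \<cdot> e) k \<longleftrightarrow> is_kernel C e k"
proof -
  have z: "zero_arrow C ((m \<cdot> e) \<cdot> x) \<longleftrightarrow> zero_arrow C (e \<cdot> x)" if "x \<in> Arr C" "Cod C x = Dom C e" for x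
    using mono_zero[OF assms(1), of "e \<cdot> x"] assms that by auto
  show ?thesis using z assms unfolding is_kernel_def by auto
qed

text \<open>The epi part of the image factorization of \<open>f\<close> has the same kernel
  \<open>n\<close>, hence is another cokernel of \<open>n\<close> and agrees with \<open>q\<close>
  up to an isomorphism.\<close>

lemma first_isomorphism:
  assumes "is_kernel C f n" "is_cokernel C n q"
  shows "\<exists>v. is_mono C v \<and> Dom C v = Cod C q \<and> Cod C v = Cod C f \<and> v \<cdot> q = f"
proof -
  note n = kernelD[OF assms(1)] and q = cokernelD[OF assms(2)]
  obtain e m where h: "is_epi C e" "is_mono C m" "Dom C m = Cod C e" "Dom C e = Dom C f" "Cod C m = Cod C f" "m \<cdot> e = f"
    using image[OF n(1)] by metis
  have "is_kernel C e n" using kernel_comp_mono[of m e n] h assms(1) by auto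
  from epi_cokernel_of_kernel[OF h(1) this] obtain i where i: "is_iso C i" "Dom C i = Cod C q" "Cod C i = Cod C e" "i \<cdot> q = e"
    using cokernel_unique[OF assms(2)] by blast
  have "m \<cdot> i \<cdot> q = f" using i h by simp
  then have "(m \<cdot> i) \<cdot> q = f" using i h q n by simp
  moreover have "is_mono C (m \<cdot> i)" by (rule mono_cmp) (use h i iso_mono in auto)
  ultimately show ?thesis by (intro exI[of _ "m \<cdot> i"]) (use i h in auto)
qed

text \<open>The pullback is the kernel \<open>k\<close> of the difference \<open>d\<close> of
  \<open>p \<cdot> u\<close> and \<open>m \<cdot> v\<close> on the product. As
  \<open>d \<cdot> i = p\<close> for the first injection \<open>i\<close>, \<open>d\<close> is epi
  and thus the cokernel of \<open>k\<close>. If \<open>g\<close> kills \<open>v \<cdot> k\<close>,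
  then \<open>g \<cdot> v\<close> factors as \<open>w \<cdot> d\<close>; evaluating on
  \<open>i\<close> makes \<open>w\<close> zero, and then evaluating on \<open>j\<close> makes
  \<open>g\<close> zero.\<close>

lemma pullback_epi:
  assumes "is_epi C p" "m \<in> Arr C" "Cod C m = Cod C p"
  shows "\<exists>a b. a \<in> Arr C \<and> is_epi C b \<and> Dom C a = Dom C b \<and> Cod C a = Dom C p \<and> Cod C b = Dom C m \<and> p \<cdot> a = m \<cdot> b"
proof -
  define X where "X = (\<lambda>t. if t then Dom C p else Dom C m)"
  have "range X \<subseteq> Obj C" using assms by (auto simp: X_def)
  then obtain c \<pi> where c: "is_product C UNIV X c \<pi>" using abelian unfolding abelian_def by blast
  define u where "u = \<pi> True"
  define v where "v = \<pi> False"
  have cO: "c \<in> Obj C" using c unfolding is_product_def by auto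
  have uv: "u \<in> Arr C" "Dom C u = c" "Cod C u = Dom C p" "v \<in> Arr C" "Dom C v = c" "Cod C v = Dom C m"
    using c unfolding is_product_def u_def v_def X_def by (auto split: if_splits)
  have pair: "\<exists>w \<in> Arr C. Dom C w = d \<and> Cod C w = c \<and> u \<cdot> w = s \<and> v \<cdot> w = t"
    if "s \<in> Hom C d (Dom C p)" "t \<in> Hom C d (Dom C m)" for s t d
  proof -
    have "\<forall>j \<in> UNIV. (if j then s else t) \<in> Hom C d (X j)" using that by (auto simp: X_def)
    moreover have "d \<in> Obj C" using that by auto
    moreover have "\<forall>d \<in> Obj C. \<forall>q. (\<forall>j \<in> UNIV. q j \<in> Hom C d (X j)) \<longrightarrow>
        (\<exists>!w. w \<in> Hom C d c \<and> (\<forall>j \<in> UNIV. \<pi> j \<cdot> w = q j))"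
      using c unfolding is_product_def by (elim conjE)
    ultimately have "\<exists>!w. w \<in> Hom C d c \<and> (\<forall>j \<in> UNIV. \<pi> j \<cdot> w = (if j then s else t))"
      by - (drule bspec, assumption, drule spec[of _ "\<lambda>j. if j then s else t"], erule mp)
    then obtain w where w: "w \<in> Hom C d c" "\<And>j. \<pi> j \<cdot> w = (if j then s else t)" by blast
    have "u \<cdot> w = s" "v \<cdot> w = t" using w(2)[of True] w(2)[of False] by (simp_all add: u_def v_def)
    then show ?thesis using w(1) by auto
  qed
  obtain n where n: "zero_arrow C n" "Dom C n = Dom C p" "Cod C n = Dom C m" 
    using zero_arrow_exists[of "Dom C p" "Dom C m"] assms by auto
  obtain n' where n': "zero_arrow C n'" "Dom C n' = Dom C m" "Cod C n' = Dom C p" 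
    using zero_arrow_exists[of "Dom C m" "Dom C p"] assms by auto
  obtain i where i: "i \<in> Arr C" "Dom C i = Dom C p" "Cod C i = c" "u \<cdot> i = Idn C (Dom C p)" "v \<cdot> i = n"
    using pair[of "Idn C (Dom C p)" "Dom C p" n] n assms by auto
  obtain j where j: "j \<in> Arr C" "Dom C j = Dom C m" "Cod C j = c" "u \<cdot> j = n'" "v \<cdot> j = Idn C (Dom C m)"
    using pair[of n' "Dom C m" "Idn C (Dom C m)"] n' assms by auto
  have "p \<cdot> u \<in> Hom C c (Cod C p)" "m \<cdot> v \<in> Hom C c (Cod C p)" using uv assms by auto
  from difference[OF this] obtain d where d: "d \<in> Arr C" "Dom C d = c" "Cod C d = Cod C p"
    "\<And>g. g \<in> Arr C \<Longrightarrow> Dom C g = Cod C p \<Longrightarrow> (zero_arrow C (g \<cdot> d) \<longleftrightarrow> g \<cdot> p \<cdot> u = g \<cdot> m \<cdot> v)"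
    "\<And>e. e \<in> Arr C \<Longrightarrow> Cod C e = c \<Longrightarrow> zero_arrow C (d \<cdot> e) \<longleftrightarrow> (p \<cdot> u) \<cdot> e = (m \<cdot> v) \<cdot> e"
    "\<And>e. e \<in> Arr C \<Longrightarrow> Cod C e = c \<Longrightarrow> zero_arrow C ((m \<cdot> v) \<cdot> e) \<Longrightarrow> d \<cdot> e = (p \<cdot> u) \<cdot> e"
    by auto
  have di: "d \<cdot> i = p"
  proof -
    have "zero_arrow C ((m \<cdot> v) \<cdot> i)" using i n uv assms by simp
    then have "d \<cdot> i = (p \<cdot> u) \<cdot> i" using d(6)[of i] i by simp
    then show ?thesis using i uv assms by simp
  qed
  have "is_epi C d" by (rule epi_cancel[of d i]) (use di i d assms in auto)
  obtain k where k: "is_kernel C d k" using kernel_exists d(1) by auto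
  note kD = kernelD[OF k]
  have kc: "is_cokernel C k d" by (rule epi_cokernel_of_kernel) fact+
  have "(p \<cdot> u) \<cdot> k = (m \<cdot> v) \<cdot> k" using d(5)[of k] kD d(1-3) by simp
  then have eq: "p \<cdot> u \<cdot> k = m \<cdot> v \<cdot> k" using uv kD d(1-3) assms by simp
  have "is_epi C (v \<cdot> k)"
  proof (rule epi0I)
    fix g assume g: "g \<in> Arr C" "Dom C g = Cod C (v \<cdot> k)" "zero_arrow C (g \<cdot> v \<cdot> k)"
    have gv: "Dom C g = Dom C m" using g(2) uv kD d(1-3) by simp
    have "zero_arrow C ((g \<cdot> v) \<cdot> k)" using g gv uv kD d(1-3) by simp
    then obtain w where w: "w \<in> Arr C" "Cod C w = Cod C g" "Dom C w = Cod C d" "w \<cdot> d = g \<cdot> v"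
      using cokernel_desc[OF kc, of "g \<cdot> v"] g(1) gv uv kD d(1-3) by auto
    have "w \<cdot> d \<cdot> i = (g \<cdot> v) \<cdot> i" by (rule cmp_extend[OF w(4)]) (use w d i in auto)
    then have "w \<cdot> p = g \<cdot> n" using di i g(1) gv uv by simp
    moreover have "zero_arrow C (g \<cdot> n)" by (rule zero_cmpL) (use n g(1) gv in auto)
    ultimately have wp: "zero_arrow C (w \<cdot> p)" by simp
    have "zero_arrow C w" by (rule epi_zero[OF assms(1) w(1) _ wp]) (use w d in simp)
    then have "zero_arrow C ((w \<cdot> d) \<cdot> j)" using w(1-3) d(1-3) j by simp
    then have "zero_arrow C (g \<cdot> v \<cdot> j)" unfolding w(4) using g(1) gv uv j by simp
    then show "zero_arrow C g" using j g(1) gv by simp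
  qed (use uv kD d in auto)
  then show ?thesis using eq uv kD d(1-3) by (intro exI[of _ "u \<cdot> k"] exI[of _ "v \<cdot> k"]) auto
qed

text \<open>\<open>k\<close> is the kernel of \<open>p\<close> followed by the cokernel of
  \<open>m\<close>. The last clause is the universal property of the pullback; through it the epi
  provided by \<open>pullback_epi\<close> factors over \<open>t\<close>, so \<open>t\<close> is epi
  when \<open>p\<close> is.\<close>

lemma preimage:
  assumes "p \<in> Arr C" "is_mono C m" "Cod C m = Cod C p"
  shows "\<exists>k t. is_mono C k \<and> t \<in> Arr C \<and> Cod C k = Dom C p \<and> Dom C t = Dom C k \<and> Cod C t = Dom C m \<and> p \<cdot> k = m \<cdot> t
    \<and> (is_epi C p \<longrightarrow> is_epi C t) \<and> (is_mono C p \<longrightarrow> is_mono C t)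
    \<and> (\<forall>x \<in> Arr C. \<forall>y \<in> Arr C. Cod C x = Dom C p \<and> Cod C y = Dom C m \<and> Dom C x = Dom C y \<and> p \<cdot> x = m \<cdot> y \<longrightarrow>
         (\<exists>w \<in> Arr C. Dom C w = Dom C x \<and> Cod C w = Dom C k \<and> k \<cdot> w = x))"
proof -
  obtain q where q: "is_cokernel C m q" using cokernel_exists[of m] assms(2) by auto
  note qD = cokernelD[OF q] and mk = mono_kernel_of_cokernel[OF assms(2) q]
  have qp: "q \<cdot> p \<in> Arr C" "Dom C (q \<cdot> p) = Dom C p" using qD assms by auto
  obtain k where k: "is_kernel C (q \<cdot> p) k" using kernel_exists qp by auto
  note kD = kernelD[OF k]
  have "zero_arrow C (q \<cdot> p \<cdot> k)" using kD qD assms qp by simp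
  then obtain t where t: "t \<in> Arr C" "Dom C t = Dom C k" "Cod C t = Dom C m" "m \<cdot> t = p \<cdot> k"
    using kernel_lift[OF mk, of "p \<cdot> k"] kD qD assms qp by auto
  have univ: "\<exists>w \<in> Arr C. Dom C w = Dom C x \<and> Cod C w = Dom C k \<and> k \<cdot> w = x"
    if x: "x \<in> Arr C" "y \<in> Arr C" "Cod C x = Dom C p" "Cod C y = Dom C m" "Dom C x = Dom C y" "p \<cdot> x = m \<cdot> y" for x y
  proof -
    have "zero_arrow C ((q \<cdot> m) \<cdot> y)" by (rule zero_cmpR) (use qD x in auto)
    then have "zero_arrow C (q \<cdot> p \<cdot> x)" using qD x assms by simp
    then have "zero_arrow C ((q \<cdot> p) \<cdot> x)" using qD x assms by simp
    then show ?thesis using kernel_lift[OF k, of x] x qp by simp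
  qed
  have "is_epi C t" if p: "is_epi C p"
  proof -
    obtain a b where ab: "a \<in> Arr C" "is_epi C b" "Dom C a = Dom C b" "Cod C a = Dom C p" "Cod C b = Dom C m" "p \<cdot> a = m \<cdot> b"
      using pullback_epi[OF p, of m] assms by auto
    then obtain w where w: "w \<in> Arr C" "Dom C w = Dom C a" "Cod C w = Dom C k" "k \<cdot> w = a"
      using univ[of a b] by auto
    have "m \<cdot> t \<cdot> w = (p \<cdot> k) \<cdot> w" by (rule cmp_extend[OF t(4)]) (use t w assms in auto)
    then have "m \<cdot> (t \<cdot> w) = m \<cdot> b" using w kD assms qp ab by simp
    then have "t \<cdot> w = b" by (rule monoD[OF assms(2)]) (use t w ab in auto)
    then show ?thesis using epi_cancel[of t w] t w ab by auto
  qed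
  moreover have "is_mono C t" if p: "is_mono C p"
  proof -
    have "is_mono C (m \<cdot> t)" unfolding t(4) by (rule mono_cmp) (use p kernel_mono[OF k] kD qp in auto)
    then show ?thesis by (rule mono_cancel) (use t assms in auto)
  qed
  moreover have "\<forall>x \<in> Arr C. \<forall>y \<in> Arr C. Cod C x = Dom C p \<and> Cod C y = Dom C m \<and> Dom C x = Dom C y \<and> p \<cdot> x = m \<cdot> y \<longrightarrow>
         (\<exists>w \<in> Arr C. Dom C w = Dom C x \<and> Cod C w = Dom C k \<and> k \<cdot> w = x)"
    by (intro ballI impI, elim conjE) (rule univ; assumption)
  moreover have "Cod C k = Dom C p" using kD qp by simp
  ultimately show ?thesis using t(1-3) t(4)[symmetric] kernel_mono[OF k] by blast
qed

lemma preimageE: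
  assumes "p \<in> Arr C" "is_mono C m" "Cod C m = Cod C p"
  obtains k t where "is_mono C k" "t \<in> Arr C" "Cod C k = Dom C p" "Dom C t = Dom C k" "Cod C t = Dom C m" "p \<cdot> k = m \<cdot> t"
    "is_epi C p \<Longrightarrow> is_epi C t" "is_mono C p \<Longrightarrow> is_mono C t"
    "\<And>x y. x \<in> Arr C \<Longrightarrow> y \<in> Arr C \<Longrightarrow> Cod C x = Dom C p \<Longrightarrow> Cod C y = Dom C m \<Longrightarrow> Dom C x = Dom C y \<Longrightarrow> p \<cdot> x = m \<cdot> y \<Longrightarrow>
         \<exists>w \<in> Arr C. Dom C w = Dom C x \<and> Cod C w = Dom C k \<and> k \<cdot> w = x"
  using preimage[OF assms]
proof (elim exE conjE, goal_cases)
  case (1 k t)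
  show ?case by (rule that[OF 1(2-7)]) (use 1(8-10) in simp_all)
qed

lemma zero_of_mono_zero_arrow:
  assumes "is_mono C m" "zero_arrow C m" shows "is_zero C (Dom C m)"
proof -
  have "zero_arrow C (Idn C (Dom C m))" by (rule mono_zero[OF assms(1)]) (use assms in auto)
  then show ?thesis using zero_iff_idn assms by simp
qed

lemma mono_from_zero:
  assumes "is_zero C z" "a \<in> Obj C"
  shows "\<exists>m. is_mono C m \<and> Dom C m = z \<and> Cod C m = a"
proof -
  obtain m where m: "m \<in> Arr C" "Dom C m = z" "Cod C m = a" using zero_obj_ex(2)[OF assms] by blast
  have "is_mono C m"
  proof (rule mono0I[OF m(1)])
    fix g assume "g \<in> Arr C" "Cod C g = Dom C m"
    then show "zero_arrow C g" using zero_arrowI[OF assms(1), of g] m by simp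
  qed
  then show ?thesis using m by blast
qed

text \<open>A vanishing cokernel kills the identity, which therefore lifts through \<open>m\<close>,
  the kernel of \<open>q\<close>.\<close>

lemma mono_zero_cokernel_iso:
  assumes "is_mono C m" "is_cokernel C m q" "zero_arrow C q"
  shows "is_iso C m"
proof (rule mono_epi_iso[OF assms(1)])
  note qD = cokernelD[OF assms(2)]
  have o: "Cod C m \<in> Obj C" using qD(1) by simp
  have "zero_arrow C (q \<cdot> Idn C (Cod C m))" using assms(3) qD by simp
  then obtain u where u: "u \<in> Arr C" "Cod C u = Dom C m" "m \<cdot> u = Idn C (Cod C m)"
    using kernel_lift[OF mono_kernel_of_cokernel[OF assms(1,2)], of "Idn C (Cod C m)"] qD(3) o by auto
  show "is_epi C m" by (rule epi_cancel[of m u]) (use u qD(1) iso_epi[OF idn_iso[OF o]] in auto)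
qed

end

section \<open>Noetherian objects\<close>

context abelian_category
begin

lemma subobject_leI:
  "n \<cdot> h = m \<Longrightarrow> h \<in> Arr C \<Longrightarrow> Dom C h = Dom C m \<Longrightarrow> Cod C h = Dom C n \<Longrightarrow> subobject_le C m n"
  unfolding subobject_le_def by (intro bexI[of _ h]) auto

lemma subobject_leE:
  assumes "subobject_le C m n"
  obtains h where "h \<in> Arr C" "Dom C h = Dom C m" "Cod C h = Dom C n" "n \<cdot> h = m"
  using assms unfolding subobject_le_def by (metis in_Hom)

lemma subobject_le_refl: "m \<in> Arr C \<Longrightarrow> subobject_le C m m"
  by (rule subobject_leI[of _ "Idn C (Dom C m)"]) auto

lemma subobject_le_trans:
  assumes "subobject_le C k m" "subobject_le C m n" "n \<in> Arr C"
  shows "subobject_le C k n"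
proof -
  obtain h where h: "h \<in> Arr C" "Dom C h = Dom C k" "Cod C h = Dom C m" "m \<cdot> h = k"
    using subobject_leE[OF assms(1)] by metis
  obtain h' where h': "h' \<in> Arr C" "Dom C h' = Dom C m" "Cod C h' = Dom C n" "n \<cdot> h' = m"
    using subobject_leE[OF assms(2)] by metis
  have "n \<cdot> h' \<cdot> h = m \<cdot> h" by (rule cmp_extend[OF h'(4)]) (use h(1-3) h'(1-3) assms(3) in auto)
  then show ?thesis by (intro subobject_leI[of n "h' \<cdot> h"]) (use h h'(1-3) in auto)
qed

lemma chain_le:
  fixes s :: "nat \<Rightarrow> 'm"
  assumes "\<And>n. is_mono C (s n)" "\<And>n. subobject_le C (s n) (s (Suc n))" "i \<le> j"
  shows "subobject_le C (s i) (s j)"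
  using assms(3)
proof (induction j rule: dec_induct)
  case base
  show ?case using subobject_le_refl assms(1) by simp
next
  case (step n)
  show ?case by (rule subobject_le_trans[OF step(3) assms(2)]) (use assms(1) in simp)
qed

lemma noetherianD:
  fixes s :: "nat \<Rightarrow> 'm"
  assumes "noetherian_object C M" "\<And>n. is_mono C (s n)" "\<And>n. Cod C (s n) = M" "\<And>n. subobject_le C (s n) (s (Suc n))"
  shows "\<exists>N. \<forall>n \<ge> N. subobject_le C (s n) (s N)"
  using assms unfolding noetherian_object_def by blast

lemma noetherianI:
  assumes "M \<in> Obj C" "\<And>s :: nat \<Rightarrow> 'm. (\<And>n. is_mono C (s n)) \<Longrightarrow> (\<And>n. Cod C (s n) = M) \<Longrightarrow>
    (\<And>n. subobject_le C (s n) (s (Suc n))) \<Longrightarrow> \<exists>N. \<forall>n \<ge> N. subobject_le C (s n) (s N)"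
  shows "noetherian_object C M"
  using assms unfolding noetherian_object_def by blast

lemma noetherian_obj: "noetherian_object C M \<Longrightarrow> M \<in> Obj C"
  unfolding noetherian_object_def by blast

text \<open>Dependent choice: otherwise a chain that never becomes stationary could be built inside
  \<open>P\<close>. Maximality means mutual factorization, as subobjects are only preordered
  here.\<close>

lemma noetherian_maximal:
  assumes M: "noetherian_object C M" and P: "P m0" "\<And>m. P m \<Longrightarrow> is_mono C m \<and> Cod C m = M"
  shows "\<exists>m. P m \<and> (\<forall>m'. P m' \<and> subobject_le C m m' \<longrightarrow> subobject_le C m' m)"
proof (rule ccontr)
  assume "\<not> ?thesis"
  then have step: "\<And>m. P m \<Longrightarrow> \<exists>m'. P m' \<and> subobject_le C m m' \<and> \<not> subobject_le C m' m" by blast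
  obtain s where s: "\<And>n. P (s n)" "\<And>n. subobject_le C (s n) (s (Suc n)) \<and> \<not> subobject_le C (s (Suc n)) (s n)"
    using dependent_nat_choice[of "\<lambda>n m. P m" "\<lambda>n m m'. subobject_le C m m' \<and> \<not> subobject_le C m' m"] P(1) step
    by metis
  have "\<exists>N. \<forall>n \<ge> N. subobject_le C (s n) (s N)"
    by (rule noetherianD[OF M]) (use s P(2) in blast)+
  then show False using s(2) by (metis le_SucI order_refl)
qed

lemma noetherian_sub:
  assumes "is_mono C m" "noetherian_object C (Cod C m)"
  shows "noetherian_object C (Dom C m)"
proof (rule noetherianI)
  fix s :: "nat \<Rightarrow> 'm"
  assume s: "\<And>n. is_mono C (s n)" "\<And>n. Cod C (s n) = Dom C m" "\<And>n. subobject_le C (s n) (s (Suc n))"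
  have sa: "s n \<in> Arr C" for n using s(1) by simp
  have down: "subobject_le C (m \<cdot> s i) (m \<cdot> s j) \<longleftrightarrow> subobject_le C (s i) (s j)" for i j
  proof
    assume "subobject_le C (m \<cdot> s i) (m \<cdot> s j)"
    then obtain h where h: "h \<in> Arr C" "Dom C h = Dom C (m \<cdot> s i)" "Cod C h = Dom C (m \<cdot> s j)" "(m \<cdot> s j) \<cdot> h = m \<cdot> s i"
      using subobject_leE by metis
    have h': "Dom C h = Dom C (s i)" "Cod C h = Dom C (s j)" using h(2,3) sa s(2) assms by auto
    have "m \<cdot> (s j \<cdot> h) = m \<cdot> s i" using h(1,4) h' sa s(2) assms by simp
    then have "s j \<cdot> h = s i" by (rule monoD[OF assms(1)]) (use h(1) h' sa s(2) in simp_all)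
    then show "subobject_le C (s i) (s j)" by (rule subobject_leI) (use h h' in auto)
  next
    assume "subobject_le C (s i) (s j)"
    then obtain h where h: "h \<in> Arr C" "Dom C h = Dom C (s i)" "Cod C h = Dom C (s j)" "s j \<cdot> h = s i"
      using subobject_leE by metis
    then show "subobject_le C (m \<cdot> s i) (m \<cdot> s j)" using sa s(2) assms
      by (intro subobject_leI[of _ h]) simp_all
  qed
  have "\<exists>N. \<forall>n \<ge> N. subobject_le C (m \<cdot> s n) (m \<cdot> s N)"
  proof (rule noetherianD[OF assms(2)])
    show "is_mono C (m \<cdot> s n)" for n by (rule mono_cmp) (use assms s in auto)
    show "Cod C (m \<cdot> s n) = Cod C m" for n using assms(1) sa s(2) by simp
    show "subobject_le C (m \<cdot> s n) (m \<cdot> s (Suc n))" for n using down s(3) by blast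
  qed
  then show "\<exists>N. \<forall>n \<ge> N. subobject_le C (s n) (s N)" unfolding down .
qed (use assms in auto)

lemma noetherian_isomorphic:
  assumes "noetherian_object C a" "isomorphic C a b" shows "noetherian_object C b"
proof -
  obtain f where "is_iso C f" "Dom C f = b" "Cod C f = a" using isomorphicD[OF isomorphic_sym[OF assms(2)]] by auto
  then show ?thesis using noetherian_sub[OF iso_mono] assms by metis
qed

text \<open>The cokernel of \<open>m\<close> kills \<open>f \<cdot> t\<close>, hence
  \<open>f\<close>, as \<open>t\<close> is epi. It serves to compare subobjects through epimorphisms
  onto them.\<close>

lemma epi_mono_diagonal:
  assumes "is_epi C t" "is_mono C m" "f \<in> Arr C" "y \<in> Arr C" "Dom C f = Cod C t" "Cod C f = Cod C m"
    "Cod C y = Dom C m" "f \<cdot> t = m \<cdot> y"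
  shows "\<exists>h \<in> Arr C. Dom C h = Dom C f \<and> Cod C h = Dom C m \<and> m \<cdot> h = f"
proof -
  obtain q where q: "is_cokernel C m q" using cokernel_exists[of m] assms(2) by auto
  note qD = cokernelD[OF q]
  have "zero_arrow C ((q \<cdot> m) \<cdot> y)" by (rule zero_cmpR) (use qD assms in auto)
  then have "zero_arrow C (q \<cdot> f \<cdot> t)" unfolding assms(8) using qD assms(2,4,7) by simp
  then have "zero_arrow C ((q \<cdot> f) \<cdot> t)" using qD assms(1,3,5,6) by simp
  then have "zero_arrow C (q \<cdot> f)" by (rule epi_zero[OF assms(1), rotated 2]) (use qD assms(3,5,6) in auto)
  then show ?thesis
    using kernel_lift[OF mono_kernel_of_cokernel[OF assms(2) q], of f] assms(3,6) qD by simp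
qed

text \<open>The chain is pulled back along \<open>e\<close>. Once the preimages \<open>k n\<close>
  are stationary so is the chain itself, because \<open>t n\<close> maps each preimage onto the
  domain of \<open>s n\<close>.\<close>

lemma noetherian_quot:
  assumes "is_epi C e" "noetherian_object C (Dom C e)"
  shows "noetherian_object C (Cod C e)"
proof (rule noetherianI)
  fix s :: "nat \<Rightarrow> 'm"
  assume s: "\<And>n. is_mono C (s n)" "\<And>n. Cod C (s n) = Cod C e" "\<And>n. subobject_le C (s n) (s (Suc n))"
  have sa: "s n \<in> Arr C" for n using s(1) by simp
  have "\<forall>n. \<exists>k t. is_mono C k \<and> is_epi C t \<and> Cod C k = Dom C e \<and> Dom C t = Dom C k \<and> Cod C t = Dom C (s n) \<and> e \<cdot> k = s n \<cdot> t
    \<and> (\<forall>x \<in> Arr C. \<forall>y \<in> Arr C. Cod C x = Dom C e \<and> Cod C y = Dom C (s n) \<and> Dom C x = Dom C y \<and> e \<cdot> x = s n \<cdot> y \<longrightarrow>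
         (\<exists>w \<in> Arr C. Dom C w = Dom C x \<and> Cod C w = Dom C k \<and> k \<cdot> w = x))"
    using preimage[OF epi_arr[OF assms(1)] s(1) s(2)] assms(1) by blast
  then obtain k t where kt: "\<And>n. is_mono C (k n)" "\<And>n. is_epi C (t n)" "\<And>n. Cod C (k n) = Dom C e"
    "\<And>n. Dom C (t n) = Dom C (k n)" "\<And>n. Cod C (t n) = Dom C (s n)" "\<And>n. e \<cdot> k n = s n \<cdot> t n"
    and univ: "\<And>n x y. x \<in> Arr C \<Longrightarrow> y \<in> Arr C \<Longrightarrow> Cod C x = Dom C e \<Longrightarrow> Cod C y = Dom C (s n) \<Longrightarrow> Dom C x = Dom C y \<Longrightarrow> e \<cdot> x = s n \<cdot> y \<Longrightarrow>
         \<exists>w \<in> Arr C. Dom C w = Dom C x \<and> Cod C w = Dom C (k n) \<and> k n \<cdot> w = x" by metis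
  have ka: "k n \<in> Arr C" "t n \<in> Arr C" for n using kt(1,2) by auto
  have "\<exists>N. \<forall>n \<ge> N. subobject_le C (k n) (k N)"
  proof (rule noetherianD[OF assms(2)])
    show "subobject_le C (k n) (k (Suc n))" for n
    proof -
      obtain h where h: "h \<in> Arr C" "Dom C h = Dom C (s n)" "Cod C h = Dom C (s (Suc n))" "s (Suc n) \<cdot> h = s n"
        using subobject_leE[OF s(3)] by metis
      have "s (Suc n) \<cdot> h \<cdot> t n = s n \<cdot> t n" by (rule cmp_extend[OF h(4)]) (use h(1-3) ka sa kt in auto)
      then have "e \<cdot> k n = s (Suc n) \<cdot> (h \<cdot> t n)" using kt(6) by simp
      from univ[OF ka(1) _ kt(3) _ _ this] obtain w where "w \<in> Arr C" "Dom C w = Dom C (k n)" "Cod C w = Dom C (k (Suc n))" "k (Suc n) \<cdot> w = k n"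
        using h(1-3) ka kt(4,5) by auto
      then show ?thesis by (intro subobject_leI)
    qed
  qed (use kt in auto)
  then obtain N where N: "\<And>n. n \<ge> N \<Longrightarrow> subobject_le C (k n) (k N)" by blast
  have "subobject_le C (s n) (s N)" if n: "n \<ge> N" for n
  proof -
    obtain w where w: "w \<in> Arr C" "Dom C w = Dom C (k n)" "Cod C w = Dom C (k N)" "k N \<cdot> w = k n"
      using subobject_leE[OF N[OF n]] by metis
    have "(e \<cdot> k N) \<cdot> w = e \<cdot> k n" using w ka kt(3) epi_arr[OF assms(1)] by simp
    then have "s n \<cdot> t n = s N \<cdot> (t N \<cdot> w)" unfolding kt(6) using w(1-3) ka sa kt(4,5) by simp
    from epi_mono_diagonal[OF kt(2) s(1) sa _ _ _ _ this]
    obtain h where "h \<in> Arr C" "Dom C h = Dom C (s n)" "Cod C h = Dom C (s N)" "s N \<cdot> h = s n"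
      using w(1-3) ka sa kt(4,5) s(2) by auto
    then show ?thesis by (intro subobject_leI)
  qed
  then show "\<exists>N. \<forall>n \<ge> N. subobject_le C (s n) (s N)" by blast
qed (use assms in auto)

text \<open>The chain is traced by its intersections \<open>k n\<close> with the subobject
  \<open>f\<close> and its images \<open>i n\<close> under \<open>g\<close>. Where both are
  stationary, the inclusion \<open>h\<close> of \<open>s N\<close> in \<open>s n\<close> is an
  isomorphism by an argument of five-lemma type.\<close>

lemma noetherian_ext:
  assumes ker: "is_kernel C g f" and noeth: "noetherian_object C (Dom C f)" "noetherian_object C (Cod C g)"
  shows "noetherian_object C (Cod C f)"
proof (rule noetherianI)
  note fD = kernelD[OF ker]
  have fm: "is_mono C f" by (rule kernel_mono[OF ker])
  fix s :: "nat \<Rightarrow> 'm"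
  assume s: "\<And>n. is_mono C (s n)" "\<And>n. Cod C (s n) = Cod C f" "\<And>n. subobject_le C (s n) (s (Suc n))"
  have sa: "s n \<in> Arr C" for n using s(1) by simp
  have "\<forall>n. \<exists>k t. is_mono C k \<and> t \<in> Arr C \<and> Cod C k = Dom C f \<and> Dom C t = Dom C k \<and> Cod C t = Dom C (s n) \<and> f \<cdot> k = s n \<cdot> t
    \<and> (\<forall>x \<in> Arr C. \<forall>y \<in> Arr C. Cod C x = Dom C f \<and> Cod C y = Dom C (s n) \<and> Dom C x = Dom C y \<and> f \<cdot> x = s n \<cdot> y \<longrightarrow>
         (\<exists>w \<in> Arr C. Dom C w = Dom C x \<and> Cod C w = Dom C k \<and> k \<cdot> w = x))"
    using preimage[OF fD(2) s(1) s(2)] by blast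
  then obtain k t where kt: "\<And>n. is_mono C (k n)" "\<And>n. t n \<in> Arr C" "\<And>n. Cod C (k n) = Dom C f"
    "\<And>n. Dom C (t n) = Dom C (k n)" "\<And>n. Cod C (t n) = Dom C (s n)" "\<And>n. f \<cdot> k n = s n \<cdot> t n"
    and univ: "\<And>n x y. x \<in> Arr C \<Longrightarrow> y \<in> Arr C \<Longrightarrow> Cod C x = Dom C f \<Longrightarrow> Cod C y = Dom C (s n) \<Longrightarrow> Dom C x = Dom C y \<Longrightarrow> f \<cdot> x = s n \<cdot> y \<Longrightarrow>
         \<exists>w \<in> Arr C. Dom C w = Dom C x \<and> Cod C w = Dom C (k n) \<and> k n \<cdot> w = x" by metis
  have ka: "k n \<in> Arr C" for n using kt(1) by auto
  have "\<forall>n. \<exists>e i. is_epi C e \<and> is_mono C i \<and> Dom C i = Cod C e \<and> Dom C e = Dom C (s n) \<and> Cod C i = Cod C g \<and> i \<cdot> e = g \<cdot> s n"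
  proof
    fix n
    have "g \<cdot> s n \<in> Arr C" "Dom C (g \<cdot> s n) = Dom C (s n)" "Cod C (g \<cdot> s n) = Cod C g" using fD sa s(2) by auto
    then show "\<exists>e i. is_epi C e \<and> is_mono C i \<and> Dom C i = Cod C e \<and> Dom C e = Dom C (s n) \<and> Cod C i = Cod C g \<and> i \<cdot> e = g \<cdot> s n"
      using image[of "g \<cdot> s n"] by metis
  qed
  then obtain e i where ei: "\<And>n. is_epi C (e n)" "\<And>n. is_mono C (i n)" "\<And>n. Dom C (i n) = Cod C (e n)"
    "\<And>n. Dom C (e n) = Dom C (s n)" "\<And>n. Cod C (i n) = Cod C g" "\<And>n. i n \<cdot> e n = g \<cdot> s n" by metis
  have ea: "e n \<in> Arr C" "i n \<in> Arr C" for n using ei by auto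
  have up: "subobject_le C (k a) (k b) \<and> subobject_le C (i a) (i b)" if ab: "subobject_le C (s a) (s b)" for a b
  proof -
    obtain h where h: "h \<in> Arr C" "Dom C h = Dom C (s a)" "Cod C h = Dom C (s b)" "s b \<cdot> h = s a"
      using subobject_leE[OF ab] by metis
    have "s b \<cdot> h \<cdot> t a = s a \<cdot> t a" by (rule cmp_extend[OF h(4)]) (use h(1-3) ka sa kt in auto)
    then have "f \<cdot> k a = s b \<cdot> (h \<cdot> t a)" using kt(6) by simp
    from univ[OF ka _ kt(3) _ _ this] obtain w where w: "w \<in> Arr C" "Dom C w = Dom C (k a)" "Cod C w = Dom C (k b)" "k b \<cdot> w = k a"
      using h(1-3) kt(2,4,5) by auto
    have "i b \<cdot> e b \<cdot> h = (g \<cdot> s b) \<cdot> h" by (rule cmp_extend[OF ei(6)]) (use h(1-3) ea ei(3,4) in auto)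
    then have "i a \<cdot> e a = i b \<cdot> (e b \<cdot> h)" unfolding ei(6) using h(1,3,4) sa s(2) fD by simp
    from epi_mono_diagonal[OF ei(1) ei(2) ea(2) _ _ _ _ this]
    obtain v where "v \<in> Arr C" "Dom C v = Dom C (i a)" "Cod C v = Dom C (i b)" "i b \<cdot> v = i a"
      using h(1-3) ea ei(3,4,5) by auto
    then show ?thesis using w subobject_leI by blast
  qed
  have "\<exists>N. \<forall>n \<ge> N. subobject_le C (k n) (k N)"
    by (rule noetherianD[OF noeth(1)]) (use kt up s(3) in auto)
  then obtain N1 where N1: "\<And>n. n \<ge> N1 \<Longrightarrow> subobject_le C (k n) (k N1)" by blast
  have "\<exists>N. \<forall>n \<ge> N. subobject_le C (i n) (i N)"
    by (rule noetherianD[OF noeth(2)]) (use ei up s(3) in auto)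
  then obtain N2 where N2: "\<And>n. n \<ge> N2 \<Longrightarrow> subobject_le C (i n) (i N2)" by blast
  have chain: "subobject_le C (s a) (s b)" if ab: "a \<le> b" for a b using chain_le[of s a b] s(1,3) ab by blast
  define N where "N = max N1 N2"
  have "subobject_le C (s n) (s N)" if n: "n \<ge> N" for n
  proof -
    obtain h where h: "h \<in> Arr C" "Dom C h = Dom C (s N)" "Cod C h = Dom C (s n)" "s n \<cdot> h = s N"
      using subobject_leE[OF chain[OF n]] by metis
    have "subobject_le C (k n) (k N)" "subobject_le C (i n) (i N)"
      using subobject_le_trans[OF N1 conjunct1[OF up[OF chain]] ka] subobject_le_trans[OF N2 conjunct2[OF up[OF chain]] ea(2)] n N_def
      by (meson le_trans max.cobounded1 max.cobounded2)+
    then obtain v y where v: "v \<in> Arr C" "Dom C v = Dom C (k n)" "Cod C v = Dom C (k N)" "k N \<cdot> v = k n"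
      and y: "y \<in> Arr C" "Dom C y = Dom C (i n)" "Cod C y = Dom C (i N)" "i N \<cdot> y = i n"
      using subobject_leE by metis
    obtain y' where y': "y' \<in> Arr C" "Dom C y' = Dom C (i N)" "Cod C y' = Dom C (i n)" "i n \<cdot> y' = i N"
      using subobject_leE[OF conjunct2[OF up[OF chain[OF n]]]] by metis
    \<comment> \<open>\<open>y'\<close> has the right inverse \<open>y\<close>, so
      \<open>e n \<cdot> h\<close>, being \<open>y' \<cdot> e N\<close>, is epi: \<open>s N\<close>
      already has the same image under \<open>g\<close> as \<open>s n\<close>.\<close>
    have "is_epi C (e n \<cdot> h)"
    proof -
      have "i n \<cdot> y' \<cdot> y = i N \<cdot> y" by (rule cmp_extend[OF y'(4)]) (use y y' ea in auto)
      then have "i n \<cdot> (y' \<cdot> y) = i n \<cdot> Idn C (Dom C (i n))" using y(4) ea by simp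
      then have "y' \<cdot> y = Idn C (Dom C (i n))" by (rule monoD[OF ei(2)]) (use y(1-3) y'(1-3) ea in auto)
      moreover have "is_epi C (Idn C (Dom C (i n)))"
        using iso_epi[OF isoI[of "Idn C (Dom C (i n))" "Idn C (Dom C (i n))"]] ea by simp
      ultimately have "is_epi C y'" using epi_cancel[of y' y] y(1-3) y'(1-3) by simp
      then have ep: "is_epi C (y' \<cdot> e N)" by (intro epi_cmp) (use ei(1,3) y'(2) in auto)
      have "i n \<cdot> e n \<cdot> h = (g \<cdot> s n) \<cdot> h" by (rule cmp_extend[OF ei(6)]) (use h(1-3) ea ei(3,4) in auto)
      also have "\<dots> = i N \<cdot> e N" unfolding ei(6) using h(1,3,4) sa s(2) fD by simp
      also have "\<dots> = i n \<cdot> y' \<cdot> e N" by (rule cmp_extend[OF y'(4), symmetric]) (use y' ea ei(3) in auto)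
      finally have "e n \<cdot> h = y' \<cdot> e N" by (rule monoD[OF ei(2)]) (use h(1-3) y'(1-3) ea ei(3,4) in auto)
      then show ?thesis using ep by simp
    qed
    \<comment> \<open>The part of \<open>s n\<close> that lies in the kernel already comes from
      \<open>s N\<close>.\<close>
    have tn: "h \<cdot> t N \<cdot> v = t n"
    proof -
      have "s n \<cdot> h \<cdot> t N \<cdot> v = s N \<cdot> t N \<cdot> v" by (rule cmp_extend[OF h(4)]) (use h(1-3) sa kt(2,4,5) v in auto)
      also have "\<dots> = (f \<cdot> k N) \<cdot> v" unfolding kt(6) using sa kt(2,4,5) v by simp
      also have "\<dots> = f \<cdot> k n" using v ka kt(3) fD by simp
      finally have "s n \<cdot> (h \<cdot> t N \<cdot> v) = s n \<cdot> t n" unfolding kt(6) .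
      then show ?thesis by (rule monoD[OF s(1)]) (use h(1-3) sa kt(2,4,5) v in auto)
    qed
    \<comment> \<open>An \<open>r\<close> that kills \<open>h\<close> kills the kernel
      \<open>c\<close> of \<open>e n\<close>, since \<open>c\<close> factors through
      \<open>t n\<close> and thus through \<open>h\<close>. So \<open>r = x \<cdot> e n\<close>, and
      \<open>x\<close> kills the epi \<open>e n \<cdot> h\<close>.\<close>
    have "is_epi C h"
    proof (rule epi0I)
      fix r assume r: "r \<in> Arr C" "Dom C r = Cod C h" "zero_arrow C (r \<cdot> h)"
      have rs: "Dom C r = Dom C (s n)" using r h by simp
      obtain c where c: "is_kernel C (e n) c" using kernel_exists[OF ea(1)] by blast
      note cD = kernelD[OF c]
      have cs: "Cod C c = Dom C (s n)" using cD ei(4) by simp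
      have "zero_arrow C (i n \<cdot> e n \<cdot> c)" by (rule zero_cmpL) (use cD ea ei(3) in auto)
      moreover have "i n \<cdot> e n \<cdot> c = (g \<cdot> s n) \<cdot> c" by (rule cmp_extend[OF ei(6)]) (use cD ea ei(3) in auto)
      ultimately have "zero_arrow C (g \<cdot> s n \<cdot> c)" using cD(2) cs sa s(2) fD by simp
      then obtain z where z: "z \<in> Arr C" "Dom C z = Dom C c" "Cod C z = Dom C f" "f \<cdot> z = s n \<cdot> c"
        using kernel_lift[OF ker, of "s n \<cdot> c"] cD(2) cs sa s(2) fD by auto
      then obtain w where w: "w \<in> Arr C" "Dom C w = Dom C c" "Cod C w = Dom C (k n)" "k n \<cdot> w = z"
        using univ[of z c n] cD(2) cs by auto
      have "s n \<cdot> t n \<cdot> w = (f \<cdot> k n) \<cdot> w" by (rule cmp_extend) (use kt sa w in auto)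
      also have "\<dots> = s n \<cdot> c" using z(4) w ka kt(3) fD by simp
      finally have tw: "t n \<cdot> w = c" by (rule monoD[OF s(1)]) (use w(1-3) kt(2,4,5) cD(2) cs in auto)
      have "zero_arrow C ((r \<cdot> h) \<cdot> (t N \<cdot> v \<cdot> w))"
        by (rule zero_cmpR[OF r(3)]) (use r(1) rs h(1-3) kt(2,4,5) v(1-3) w(1-3) in auto)
      also have "(r \<cdot> h) \<cdot> (t N \<cdot> v \<cdot> w) = r \<cdot> (h \<cdot> t N \<cdot> v) \<cdot> w"
        using r(1) rs h(1-3) kt(2,4,5) v(1-3) w(1-3) by simp
      finally have "zero_arrow C (r \<cdot> c)" unfolding tn tw .
      then obtain x where x: "x \<in> Arr C" "Cod C x = Cod C r" "Dom C x = Cod C (e n)" "x \<cdot> e n = r"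
        using cokernel_desc[OF epi_cokernel_of_kernel[OF ei(1) c], of r] r(1) rs cs by auto
      have "zero_arrow C (x \<cdot> e n \<cdot> h)" using r(3) cmp_extend[OF x(4), of h] x(1-3) ea h(1-3) ei(4) by simp
      then have "zero_arrow C x" 
        by (rule epi_zero[OF \<open>is_epi C (e n \<cdot> h)\<close>, rotated 2]) (use x(1-3) ea h(1-3) ei(4) in auto)
      then have "zero_arrow C (x \<cdot> e n)" by (rule zero_cmpR) (use x(1-3) ea in auto)
      then show "zero_arrow C r" unfolding x(4) .
    qed (rule h)
    moreover have "is_mono C h" by (rule mono_cancel[of "s n"]) (use h s sa in auto)
    ultimately obtain h' where h': "h' \<in> Arr C" "Dom C h' = Cod C h" "Cod C h' = Dom C h" "h \<cdot> h' = Idn C (Cod C h)"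
      using isoE[OF mono_epi_iso] by metis
    have "s n \<cdot> h \<cdot> h' = s N \<cdot> h'" by (rule cmp_extend[OF h(4)]) (use h h' sa in auto)
    then have "s N \<cdot> h' = s n" unfolding h'(4) h(3) using sa by simp
    then show ?thesis by (rule subobject_leI) (use h h' in auto)
  qed
  then show "\<exists>N. \<forall>n \<ge> N. subobject_le C (s n) (s N)" by blast
qed (use kernelD[OF ker] in auto)

text \<open>Enlarges \<open>m\<close> by a subobject \<open>c\<close> of the quotient by
  \<open>m\<close>: the preimage \<open>k\<close> is an extension of \<open>Dom C c\<close> by
  \<open>Dom C m\<close>. The closing clause makes \<open>k\<close> strictly larger, which is what
  contradicts the maximality of \<open>m\<close> in later arguments.\<close>

lemma preimage_kernel:
  assumes "is_mono C m" "is_cokernel C m q" "is_mono C c" "Cod C c = Cod C q"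
  shows "\<exists>k t w. is_mono C k \<and> Cod C k = Cod C m \<and> is_epi C t \<and> Dom C t = Dom C k \<and> Cod C t = Dom C c \<and> q \<cdot> k = c \<cdot> t \<and>
    is_kernel C t w \<and> k \<cdot> w = m \<and> Dom C w = Dom C m \<and> Cod C w = Dom C k \<and>
    subobject_le C m k \<and> (\<not> is_zero C (Dom C c) \<longrightarrow> \<not> subobject_le C k m)"
proof -
  note qD = cokernelD[OF assms(2)]
  have ma: "m \<in> Arr C" and ca: "c \<in> Arr C" using assms by auto
  obtain k t where k: "is_mono C k" "t \<in> Arr C" "Cod C k = Dom C q" "Dom C t = Dom C k" "Cod C t = Dom C c" "q \<cdot> k = c \<cdot> t"
    "is_epi C q \<Longrightarrow> is_epi C t" "is_mono C q \<Longrightarrow> is_mono C t"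
    "\<And>x y. x \<in> Arr C \<Longrightarrow> y \<in> Arr C \<Longrightarrow> Cod C x = Dom C q \<Longrightarrow> Cod C y = Dom C c \<Longrightarrow> Dom C x = Dom C y \<Longrightarrow> q \<cdot> x = c \<cdot> y \<Longrightarrow>
         \<exists>w \<in> Arr C. Dom C w = Dom C x \<and> Cod C w = Dom C k \<and> k \<cdot> w = x"
    by (rule preimageE[OF qD(2) assms(3,4)]) (rule that)
  have te: "is_epi C t" using k(7) cokernel_epi[OF assms(2)] by blast
  have ka: "k \<in> Arr C" using k by simp
  obtain n where n: "zero_arrow C n" "Dom C n = Dom C m" "Cod C n = Dom C c"
    using zero_arrow_exists[of "Dom C m" "Dom C c"] ma ca by auto
  have cn: "zero_arrow C (c \<cdot> n)" by (rule zero_cmpL[OF n(1)]) (use n ca in auto)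
  have "q \<cdot> m = c \<cdot> n" by (rule zero_arrow_unique[OF qD(4) cn]) (use n ma ca qD assms(4) in auto)
  then obtain w where w: "w \<in> Arr C" "Dom C w = Dom C m" "Cod C w = Dom C k" "k \<cdot> w = m"
    using k(9)[OF ma zero_arr[OF n(1)] qD(3)[symmetric] n(3) n(2)[symmetric]] by blast
  have "is_mono C (k \<cdot> w)" using w assms by simp
  then have wm: "is_mono C w" by (rule mono_cancel) (use w ka in auto)
  have "is_kernel C t w"
  proof (rule kernelI[OF k(2) wm])
    show "Cod C w = Dom C t" using w k(4) by simp
    have "q \<cdot> m = (q \<cdot> k) \<cdot> w" using w(1,3) w(4)[symmetric] ka k(3) qD(2) by simp
    also have "\<dots> = c \<cdot> (t \<cdot> w)" unfolding k(6) using w(1,3) k(2,4,5) ca by simp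
    finally have "zero_arrow C (c \<cdot> (t \<cdot> w))" using qD(4) by simp
    then show "zero_arrow C (t \<cdot> w)" by (rule mono_zero[OF assms(3), rotated 2]) (use w(1,3) k(2,4,5) in auto)
    fix g assume g: "g \<in> Arr C" "Cod C g = Dom C t" "zero_arrow C (t \<cdot> g)"
    have gk: "Cod C g = Dom C k" using g k(4) by simp
    have "zero_arrow C (c \<cdot> (t \<cdot> g))" by (rule zero_cmpL[OF g(3)]) (use g(1,2) k(2,5) ca in auto)
    also have "c \<cdot> (t \<cdot> g) = (q \<cdot> k) \<cdot> g" unfolding k(6) using g(1) gk k(2,4,5) ca by simp
    finally have "zero_arrow C (q \<cdot> (k \<cdot> g))" using g(1) gk ka k(3) qD(2) by simp
    then obtain u where u: "u \<in> Arr C" "Dom C u = Dom C (k \<cdot> g)" "Cod C u = Dom C m" "m \<cdot> u = k \<cdot> g"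
      using kernel_lift[OF mono_kernel_of_cokernel[OF assms(1,2)], of "k \<cdot> g"] g(1) gk ka k(3) by auto
    have "k \<cdot> w \<cdot> u = m \<cdot> u" by (rule cmp_extend[OF w(4)]) (use w(1-3) u(1,3) ka in auto)
    then have "k \<cdot> (w \<cdot> u) = k \<cdot> g" using u(4) by simp
    then have "w \<cdot> u = g" by (rule monoD[OF k(1)]) (use w(1-3) u(1-3) ka g(1) gk in auto)
    then show "\<exists>u\<in>Arr C. Dom C u = Dom C g \<and> Cod C u = Dom C w \<and> w \<cdot> u = g"
      using u(1-3) w(2) g(1) gk ka by (intro bexI[of _ u]) auto
  qed
  moreover have "subobject_le C m k" by (rule subobject_leI[OF w(4,1-3)])
  moreover have "is_zero C (Dom C c)" if km: "subobject_le C k m"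
  proof -
    obtain h where h: "h \<in> Arr C" "Dom C h = Dom C k" "Cod C h = Dom C m" "m \<cdot> h = k" by (rule subobject_leE[OF km])
    have "zero_arrow C ((q \<cdot> m) \<cdot> h)" by (rule zero_cmpR[OF qD(4)]) (use h qD ma in auto)
    also have "(q \<cdot> m) \<cdot> h = q \<cdot> k" using h qD ma by simp
    finally have "zero_arrow C (c \<cdot> t)" unfolding k(6) .
    then have "zero_arrow C c" by (rule epi_zero[OF te, rotated 2]) (use ca k(5) in auto)
    then show ?thesis using zero_of_mono_zero_arrow[OF assms(3)] by blast
  qed
  ultimately show ?thesis using k(1,3-6) te w(2-4) qD(3) by (intro exI[of _ k] exI[of _ t] exI[of _ w]) auto
qed

end

section \<open>Tensor products with invertible objects\<close>

locale closed_monoidal_abelian = symmetric_monoidal A + abelian_category A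
  for A :: "('o, 'm) smcat" (structure) +
  assumes closed: "monoidal_closed A"
begin

text \<open>The fixed factor stands on the right because closedness provides a right adjoint of
  \<open>- \<otimes> y\<close>.\<close>

abbreviation rt :: "'m \<Rightarrow> 'o \<Rightarrow> 'm" (infixl "\<odot>" 72) where
  "f \<odot> y \<equiv> f \<star> Idn A y"

lemma unit_obj' [simp]: "Unit A \<in> Obj A" by (rule unit_obj)

lemma tensor_obj' [simp]: "x \<in> Obj A \<Longrightarrow> y \<in> Obj A \<Longrightarrow> x \<boxtimes> y \<in> Obj A" by (rule tensor_obj)

lemma tensor_simps [simp]:
  assumes "f \<in> Arr A" "g \<in> Arr A"
  shows "f \<star> g \<in> Arr A" "Dom A (f \<star> g) = Dom A f \<boxtimes> Dom A g" "Cod A (f \<star> g) = Cod A f \<boxtimes> Cod A g"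
  using tensor_arr[of f "Dom A f" "Cod A f" g "Dom A g" "Cod A g"] assms by auto

lemma tensor_cmp':
  assumes "f \<in> Arr A" "f' \<in> Arr A" "Dom A f' = Cod A f" "g \<in> Arr A" "g' \<in> Arr A" "Dom A g' = Cod A g"
  shows "(f' \<star> g') \<cdot> (f \<star> g) = (f' \<cdot> f) \<star> (g' \<cdot> g)"
  using tensor_cmp[of f "Dom A f" "Cod A f" f' "Cod A f'" g "Dom A g" "Cod A g" g' "Cod A g'"] assms by auto

lemma rt_cmp:
  assumes "f \<in> Arr A" "g \<in> Arr A" "Dom A g = Cod A f" "y \<in> Obj A"
  shows "(g \<cdot> f) \<odot> y = (g \<odot> y) \<cdot> (f \<odot> y)"
  using tensor_cmp'[of f g "Idn A y" "Idn A y"] assms by simp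

lemma lt_cmp:
  assumes "f \<in> Arr A" "g \<in> Arr A" "Dom A g = Cod A f" "y \<in> Obj A"
  shows "Idn A y \<star> (g \<cdot> f) = (Idn A y \<star> g) \<cdot> (Idn A y \<star> f)"
  using tensor_cmp'[of "Idn A y" "Idn A y" f g] assms by simp

lemma rt_idn: "x \<in> Obj A \<Longrightarrow> y \<in> Obj A \<Longrightarrow> Idn A x \<odot> y = Idn A (x \<boxtimes> y)"
  by (rule tensor_idn)

text \<open>Both sides equal \<open>f \<star> g\<close>. With \<open>f\<close> an arrow into the
  unit, this says that arrows commute with the action of ideals.\<close>

lemma interchange:
  assumes "f \<in> Arr A" "g \<in> Arr A"
  shows "(f \<odot> Cod A g) \<cdot> (Idn A (Dom A f) \<star> g) = (Idn A (Cod A f) \<star> g) \<cdot> (f \<odot> Dom A g)"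
  using tensor_cmp'[of "Idn A (Dom A f)" f g "Idn A (Cod A g)"] tensor_cmp'[of f "Idn A (Cod A f)" "Idn A (Dom A g)" g] assms
  by simp

lemma rt_iso:
  assumes "is_iso A f" "y \<in> Obj A" shows "is_iso A (f \<odot> y)"
proof -
  obtain g where g: "g \<in> Arr A" "Dom A g = Cod A f" "Cod A g = Dom A f" "g \<cdot> f = Idn A (Dom A f)" "f \<cdot> g = Idn A (Cod A f)"
    using isoE[OF assms(1)] by metis
  have f: "f \<in> Arr A" using assms by simp
  show ?thesis
    by (rule isoI[of _ "g \<odot> y"]) (use f g(1-3) assms(2) rt_cmp[of f g y] rt_cmp[of g f y] in \<open>simp_all add: g(4,5) rt_idn\<close>)
qed

lemma sym_iso:
  assumes "x \<in> Obj A" "y \<in> Obj A"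
  shows "is_iso A (Sym A x y)" "Dom A (Sym A x y) = x \<boxtimes> y" "Cod A (Sym A x y) = y \<boxtimes> x"
  using sym_hom[OF assms] sym_hom[OF assms(2,1)] sym_sym[OF assms] sym_sym[OF assms(2,1)]
    isoI[of "Sym A x y" "Sym A y x"] by auto

lemma lt_sym:
  assumes "f \<in> Arr A" "y \<in> Obj A"
  shows "(Idn A y \<star> f) \<cdot> Sym A (Dom A f) y = Sym A (Cod A f) y \<cdot> (f \<odot> y)"
  using sym_nat[of f "Dom A f" "Cod A f" "Idn A y" y y] assms by auto

text \<open>\<open>h\<close> is the internal hom from \<open>y\<close> to \<open>z\<close>, with
  evaluation \<open>ev\<close>. Existence and uniqueness of transposes are stated apart, so that
  each can be used on its own.\<close>

lemma transposeE:
  assumes "y \<in> Obj A" "z \<in> Obj A"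
  obtains h ev where "h \<in> Obj A" "ev \<in> Arr A" "Dom A ev = h \<boxtimes> y" "Cod A ev = z"
    "\<And>x f. x \<in> Obj A \<Longrightarrow> f \<in> Arr A \<Longrightarrow> Dom A f = x \<boxtimes> y \<Longrightarrow> Cod A f = z \<Longrightarrow>
       \<exists>g \<in> Arr A. Dom A g = x \<and> Cod A g = h \<and> ev \<cdot> (g \<odot> y) = f"
    "\<And>g g'. g \<in> Arr A \<Longrightarrow> g' \<in> Arr A \<Longrightarrow> Dom A g = Dom A g' \<Longrightarrow> Cod A g = h \<Longrightarrow> Cod A g' = h \<Longrightarrow>
       ev \<cdot> (g \<odot> y) = ev \<cdot> (g' \<odot> y) \<Longrightarrow> g = g'"
proof -
  have "\<exists>h \<in> Obj A. \<exists>ev \<in> Hom A (h \<boxtimes> y) z. \<forall>x \<in> Obj A. \<forall>f \<in> Hom A (x \<boxtimes> y) z. \<exists>!g. g \<in> Hom A x h \<and> ev \<cdot> (g \<odot> y) = f"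
    using closed[unfolded monoidal_closed_def, THEN bspec, OF assms(1), THEN bspec, OF assms(2)] .
  then obtain h ev where h: "h \<in> Obj A" "ev \<in> Hom A (h \<boxtimes> y) z"
    and u: "\<forall>x \<in> Obj A. \<forall>f \<in> Hom A (x \<boxtimes> y) z. \<exists>!g. g \<in> Hom A x h \<and> ev \<cdot> (g \<odot> y) = f"
    by (elim bexE) (rule that)
  show ?thesis
  proof (rule that[of h ev])
    fix x f assume "x \<in> Obj A" "f \<in> Arr A" "Dom A f = x \<boxtimes> y" "Cod A f = z"
    then have "\<exists>!g. g \<in> Hom A x h \<and> ev \<cdot> (g \<odot> y) = f" using u by simp
    then show "\<exists>g \<in> Arr A. Dom A g = x \<and> Cod A g = h \<and> ev \<cdot> (g \<odot> y) = f" by auto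
  next
    fix g g' assume g: "g \<in> Arr A" "g' \<in> Arr A" "Dom A g = Dom A g'" "Cod A g = h" "Cod A g' = h" 
    "ev \<cdot> (g \<odot> y) = ev \<cdot> (g' \<odot> y)"
    have "ev \<cdot> (g' \<odot> y) \<in> Hom A (Dom A g \<boxtimes> y) z" using g h assms by simp
    moreover have "Dom A g \<in> Obj A" using g by simp
    ultimately have "\<exists>!k. k \<in> Hom A (Dom A g) h \<and> ev \<cdot> (k \<odot> y) = ev \<cdot> (g' \<odot> y)" using u by blast
    moreover have "g \<in> Hom A (Dom A g) h" "g' \<in> Hom A (Dom A g) h" using g by auto
    ultimately show "g = g'" using g(6) by blast
  qed (use h in auto)
qed

text \<open>Left adjoints preserve epimorphisms: arrows out of \<open>Cod A e \<boxtimes> y\<close>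
  are compared through their transposes, which start at \<open>Cod A e\<close>.\<close>

lemma rt_epi:
  assumes "is_epi A e" "y \<in> Obj A" shows "is_epi A (e \<odot> y)"
proof (rule epiI)
  have e: "e \<in> Arr A" using assms by simp
  fix g k assume g: "g \<in> Arr A" "k \<in> Arr A" "Cod A g = Cod A k" "Dom A g = Cod A (e \<odot> y)" "Dom A k = Cod A (e \<odot> y)"
    "g \<cdot> (e \<odot> y) = k \<cdot> (e \<odot> y)"
  obtain h ev where ev: "h \<in> Obj A" "ev \<in> Arr A" "Dom A ev = h \<boxtimes> y" "Cod A ev = Cod A k" and
    tr: "\<And>x f. x \<in> Obj A \<Longrightarrow> f \<in> Arr A \<Longrightarrow> Dom A f = x \<boxtimes> y \<Longrightarrow> Cod A f = Cod A k \<Longrightarrow>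
       \<exists>g \<in> Arr A. Dom A g = x \<and> Cod A g = h \<and> ev \<cdot> (g \<odot> y) = f" and
    un: "\<And>g g'. g \<in> Arr A \<Longrightarrow> g' \<in> Arr A \<Longrightarrow> Dom A g = Dom A g' \<Longrightarrow> Cod A g = h \<Longrightarrow> Cod A g' = h \<Longrightarrow>
       ev \<cdot> (g \<odot> y) = ev \<cdot> (g' \<odot> y) \<Longrightarrow> g = g'"
    by (rule transposeE[OF assms(2) obj_of_arr(2)[OF g(2)]]) (rule that)
  obtain g' where g': "g' \<in> Arr A" "Dom A g' = Cod A e" "Cod A g' = h" "ev \<cdot> (g' \<odot> y) = g"
    using tr[of "Cod A e" g] g(1-5) e assms(2) by auto
  obtain k' where k': "k' \<in> Arr A" "Dom A k' = Cod A e" "Cod A k' = h" "ev \<cdot> (k' \<odot> y) = k"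
    using tr[of "Cod A e" k] g(1-5) e assms(2) by auto
  have 1: "ev \<cdot> ((g' \<cdot> e) \<odot> y) = g \<cdot> (e \<odot> y)"
    unfolding rt_cmp[OF e g'(1,2) assms(2)] by (rule cmp_extend[OF g'(4)]) (use g' e ev assms(2) in auto)
  have 2: "ev \<cdot> ((k' \<cdot> e) \<odot> y) = k \<cdot> (e \<odot> y)"
    unfolding rt_cmp[OF e k'(1,2) assms(2)] by (rule cmp_extend[OF k'(4)]) (use k' e ev assms(2) in auto)
  have "g' \<cdot> e = k' \<cdot> e" by (rule un) (use g' k' e 1 2 g(6) in simp_all)
  then have "g' = k'" by (rule epiD[OF assms(1)]) (use g' k' in auto)
  then show "g = k" using g'(4) k'(4) by simp
qed (use assms in auto)

text \<open>The identity and the zero arrow of \<open>z \<boxtimes> y\<close> have transposes with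
  source \<open>z\<close>, and these coincide.\<close>

lemma zero_tensor:
  assumes "is_zero A z" "y \<in> Obj A" shows "is_zero A (z \<boxtimes> y)"
proof -
  have z: "z \<in> Obj A" using assms zero_objD by auto
  obtain n where n: "zero_arrow A n" "Dom A n = z \<boxtimes> y" "Cod A n = z \<boxtimes> y"
    using zero_arrow_exists[of "z \<boxtimes> y" "z \<boxtimes> y"] z assms(2) by auto
  obtain h ev where ev: "h \<in> Obj A" "ev \<in> Arr A" "Dom A ev = h \<boxtimes> y" "Cod A ev = z \<boxtimes> y" and
    tr: "\<And>x f. x \<in> Obj A \<Longrightarrow> f \<in> Arr A \<Longrightarrow> Dom A f = x \<boxtimes> y \<Longrightarrow> Cod A f = z \<boxtimes> y \<Longrightarrow>
       \<exists>g \<in> Arr A. Dom A g = x \<and> Cod A g = h \<and> ev \<cdot> (g \<odot> y) = f"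
    by (rule transposeE[OF assms(2) tensor_obj'[OF z assms(2)]]) (rule that)
  obtain g where g: "g \<in> Arr A" "Dom A g = z" "Cod A g = h" "ev \<cdot> (g \<odot> y) = n"
    using tr[of z n] z n by auto
  obtain k where k: "k \<in> Arr A" "Dom A k = z" "Cod A k = h" "ev \<cdot> (k \<odot> y) = Idn A (z \<boxtimes> y)"
    using tr[of z "Idn A (z \<boxtimes> y)"] z assms(2) by auto
  have "g = k" by (rule zero_obj_unique[OF assms(1)]) (use g k in auto)
  then have "Idn A (z \<boxtimes> y) = n" using g k by simp
  then show ?thesis using zero_iff_idn n z assms(2) by simp
qed

lemma rt_zero:
  assumes "zero_arrow A f" "y \<in> Obj A" shows "zero_arrow A (f \<odot> y)"
proof -
  obtain z g h where h: "is_zero A z" "g \<in> Arr A" "Dom A g = Dom A f" "Cod A g = z" "h \<in> Arr A"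
    "Dom A h = z" "Cod A h = Cod A f" "h \<cdot> g = f" using zero_arrowE[OF assms(1)] by metis
  have "zero_arrow A (h \<odot> y)" by (rule zero_arrowI[OF zero_tensor[OF h(1) assms(2)]]) (use h assms(2) in auto)
  then have "zero_arrow A ((h \<odot> y) \<cdot> (g \<odot> y))" by (rule zero_cmpR) (use h assms(2) in auto)
  then show ?thesis using rt_cmp[of g h y] h assms(2) by simp
qed

text \<open>Right exactness of a left adjoint: an arrow killing \<open>i \<odot> y\<close>
  transposes to one killing \<open>i\<close>, which descends along \<open>q\<close> and is
  transposed back.\<close>

lemma rt_cokernel:
  assumes "is_cokernel A i q" "y \<in> Obj A" shows "is_cokernel A (i \<odot> y) (q \<odot> y)"
proof (rule cokernelI)
  note q = cokernelD[OF assms(1)]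
  show "is_epi A (q \<odot> y)" using rt_epi cokernel_epi assms by blast
  show "zero_arrow A ((q \<odot> y) \<cdot> (i \<odot> y))" using rt_zero[OF q(4) assms(2)] rt_cmp[of i q y] q assms(2) by simp
  fix f assume f: "f \<in> Arr A" "Dom A f = Cod A (i \<odot> y)" "zero_arrow A (f \<cdot> (i \<odot> y))"
  obtain h ev where ev: "h \<in> Obj A" "ev \<in> Arr A" "Dom A ev = h \<boxtimes> y" "Cod A ev = Cod A f" and
    tr: "\<And>x k. x \<in> Obj A \<Longrightarrow> k \<in> Arr A \<Longrightarrow> Dom A k = x \<boxtimes> y \<Longrightarrow> Cod A k = Cod A f \<Longrightarrow>
       \<exists>g \<in> Arr A. Dom A g = x \<and> Cod A g = h \<and> ev \<cdot> (g \<odot> y) = k" and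
    un: "\<And>g g'. g \<in> Arr A \<Longrightarrow> g' \<in> Arr A \<Longrightarrow> Dom A g = Dom A g' \<Longrightarrow> Cod A g = h \<Longrightarrow> Cod A g' = h \<Longrightarrow>
       ev \<cdot> (g \<odot> y) = ev \<cdot> (g' \<odot> y) \<Longrightarrow> g = g'"
    by (rule transposeE[OF assms(2) obj_of_arr(2)[OF f(1)]]) (rule that)
  obtain g where g: "g \<in> Arr A" "Dom A g = Cod A i" "Cod A g = h" "ev \<cdot> (g \<odot> y) = f"
    using tr[of "Cod A i" f] f(1,2) q assms(2) by auto
  obtain n where n: "zero_arrow A n" "Dom A n = Dom A i" "Cod A n = h" using zero_arrow_exists[of "Dom A i" h] q ev by auto
  have "ev \<cdot> (g \<odot> y) \<cdot> (i \<odot> y) = f \<cdot> (i \<odot> y)" by (rule cmp_extend[OF g(4)]) (use g q ev assms(2) in auto)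
  then have 1: "zero_arrow A (ev \<cdot> ((g \<cdot> i) \<odot> y))" using f(3) rt_cmp[of i g y] g(1-3) q assms(2) by simp
  have 2: "zero_arrow A (ev \<cdot> (n \<odot> y))" by (rule zero_cmpL[OF rt_zero[OF n(1) assms(2)]]) (use n ev assms(2) in auto)
  have "ev \<cdot> ((g \<cdot> i) \<odot> y) = ev \<cdot> (n \<odot> y)" by (rule zero_arrow_unique[OF 1 2]) (use n ev g(1-3) q assms(2) in simp_all)
  then have "g \<cdot> i = n" by (rule un[rotated 5]) (use n ev g(1-3) q assms(2) in simp_all)
  then have "zero_arrow A (g \<cdot> i)" using n by simp
  then obtain u where u: "u \<in> Arr A" "Cod A u = Cod A g" "Dom A u = Cod A q" "u \<cdot> q = g"
    using cokernel_desc[OF assms(1), of g] g by auto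
  have "(ev \<cdot> (u \<odot> y)) \<cdot> (q \<odot> y) = ev \<cdot> (g \<odot> y)"
    using u ev g(3) q assms(2) rt_cmp[of q u y] by simp
  then show "\<exists>u\<in>Arr A. Cod A u = Cod A f \<and> Dom A u = Cod A (q \<odot> y) \<and> u \<cdot> (q \<odot> y) = f"
    unfolding g(4) by (intro bexI[of _ "ev \<cdot> (u \<odot> y)"]) (use u(1-3) ev g(3) q assms(2) in simp_all)
qed (use cokernelD[OF assms(1)] assms(2) in auto)

lemma lt_epi:
  assumes "is_epi A e" "y \<in> Obj A" shows "is_epi A (Idn A y \<star> e)"
proof -
  have e: "e \<in> Arr A" using assms by simp
  have "is_epi A (Sym A (Cod A e) y \<cdot> (e \<odot> y))"
    by (rule epi_cmp[OF rt_epi[OF assms] iso_epi]) (use sym_iso[of "Cod A e" y] e assms(2) in auto)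
  then have "is_epi A ((Idn A y \<star> e) \<cdot> Sym A (Dom A e) y)" using lt_sym[OF e assms(2)] by simp
  then show ?thesis by (rule epi_cancel) (use sym_iso[of "Dom A e" y] e assms(2) in auto)
qed

lemma lt_iso:
  assumes "is_iso A f" "y \<in> Obj A" shows "is_iso A (Idn A y \<star> f)"
proof -
  obtain g where g: "g \<in> Arr A" "Dom A g = Cod A f" "Cod A g = Dom A f" "g \<cdot> f = Idn A (Dom A f)" "f \<cdot> g = Idn A (Cod A f)"
    using isoE[OF assms(1)] by metis
  have f: "f \<in> Arr A" using assms by simp
  show ?thesis
    by (rule isoI[of _ "Idn A y \<star> g"]) (use f g(1-3) assms(2) lt_cmp[of f g y] lt_cmp[of g f y] in \<open>simp_all add: g(4,5) rt_idn\<close>)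
qed

lemma tensor_isomorphic:
  assumes "isomorphic A a b" "isomorphic A c d"
  shows "isomorphic A (a \<boxtimes> c) (b \<boxtimes> d)"
proof -
  obtain f where f: "is_iso A f" "Dom A f = a" "Cod A f = b" using isomorphicD[OF assms(1)] by auto
  obtain g where g: "is_iso A g" "Dom A g = c" "Cod A g = d" using isomorphicD[OF assms(2)] by auto
  have fg: "f \<in> Arr A" "g \<in> Arr A" using f g by auto
  have "a \<in> Obj A" "b \<in> Obj A" "c \<in> Obj A" "d \<in> Obj A" using f g fg obj_of_arr[of f] obj_of_arr[of g] by auto
  then have "isomorphic A (a \<boxtimes> c) (b \<boxtimes> c)" "isomorphic A (b \<boxtimes> c) (b \<boxtimes> d)"
    using isomorphicI[OF rt_iso[OF f(1), of c]] isomorphicI[OF lt_iso[OF g(1), of b]] f g fg by simp_all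
  then show ?thesis by (rule isomorphic_trans)
qed

section \<open>Twists by invertible objects and their inverses\<close>

lemma assoc_isomorphic:
  assumes "x \<in> Obj A" "y \<in> Obj A" "z \<in> Obj A"
  shows "isomorphic A ((x \<boxtimes> y) \<boxtimes> z) (x \<boxtimes> y \<boxtimes> z)"
  using isomorphicI[of "Assoc A x y z"] assoc_iso[OF assms] by auto

lemma sym_isomorphic:
  assumes "x \<in> Obj A" "y \<in> Obj A"
  shows "isomorphic A (x \<boxtimes> y) (y \<boxtimes> x)"
  using isomorphicI[of "Sym A x y"] sym_iso[OF assms] by auto

lemma unit_isomorphic:
  assumes "x \<in> Obj A" shows "isomorphic A (x \<boxtimes> Unit A) x"
  using isomorphicI[of "RUnit A x"] runit_iso[OF assms] by auto

text \<open>The inverse is named rather than hidden in an existential, since undoing a twist by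
  \<open>L\<close> means twisting by this very \<open>M\<close>.\<close>

definition inverses :: "'o \<Rightarrow> 'o \<Rightarrow> bool" where
  "inverses L M \<longleftrightarrow> L \<in> Obj A \<and> M \<in> Obj A \<and> isomorphic A (L \<boxtimes> M) (Unit A)"

lemma invertible_iff: "invertible_object A L \<longleftrightarrow> (\<exists>M. inverses L M)"
  unfolding invertible_object_def inverses_def by blast

lemma inverses_obj: "inverses L M \<Longrightarrow> L \<in> Obj A" "inverses L M \<Longrightarrow> M \<in> Obj A"
  unfolding inverses_def by auto

lemma inverses_sym: "inverses L M \<Longrightarrow> inverses M L"
  unfolding inverses_def using sym_isomorphic isomorphic_trans by blast

lemma inverses_cancel:
  assumes "inverses L M" "x \<in> Obj A" shows "isomorphic A ((x \<boxtimes> L) \<boxtimes> M) x"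
proof -
  have "isomorphic A (x \<boxtimes> L \<boxtimes> M) (x \<boxtimes> Unit A)"
    by (rule tensor_isomorphic) (use assms isomorphic_refl in \<open>auto simp: inverses_def\<close>)
  then show ?thesis using isomorphic_trans assoc_isomorphic[of x L M] unit_isomorphic[of x] assms inverses_obj by blast
qed

lemma inverses_tensor:
  assumes "inverses L M" "inverses L' M'" shows "inverses (L \<boxtimes> L') (M' \<boxtimes> M)"
proof -
  note o = inverses_obj[OF assms(1)] inverses_obj[OF assms(2)]
  have "isomorphic A (((L \<boxtimes> L') \<boxtimes> M') \<boxtimes> M) (L \<boxtimes> M)"
    by (rule tensor_isomorphic[OF inverses_cancel[OF assms(2)] isomorphic_refl]) (use o in auto)
  then have "isomorphic A ((L \<boxtimes> L') \<boxtimes> M' \<boxtimes> M) (L \<boxtimes> M)"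
    using isomorphic_trans isomorphic_sym assoc_isomorphic[of "L \<boxtimes> L'" M' M] o by (meson tensor_obj')
  then show ?thesis using assms isomorphic_trans unfolding inverses_def by auto
qed

lemma inverses_unit: "inverses (Unit A) (Unit A)"
  unfolding inverses_def using unit_isomorphic[of "Unit A"] by simp

text \<open>\<open>n a\<close> is the associator, followed by \<open>\<phi>\<close> tensored with
  \<open>a\<close> on the left and by the right unitor. Naturality of this one isomorphism makes
  twisting by \<open>L\<close> faithful and full, and lets it preserve monomorphisms.\<close>

lemma inverses_natural_iso:
  assumes "inverses L M"
  shows "\<exists>n. (\<forall>a \<in> Obj A. is_iso A (n a) \<and> Dom A (n a) = (a \<boxtimes> L) \<boxtimes> M \<and> Cod A (n a) = a) \<and>
    (\<forall>f \<in> Arr A. f \<cdot> n (Dom A f) = n (Cod A f) \<cdot> (f \<odot> L \<odot> M))"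
proof -
  note o = inverses_obj[OF assms]
  obtain \<phi> where \<phi>: "is_iso A \<phi>" "Dom A \<phi> = L \<boxtimes> M" "Cod A \<phi> = Unit A"
    using assms isomorphicD unfolding inverses_def by blast
  have \<phi>a: "\<phi> \<in> Arr A" using \<phi> by simp
  define n where "n a = RUnit A a \<cdot> (Idn A a \<star> \<phi>) \<cdot> Assoc A a L M" for a
  have ru: "is_iso A (RUnit A a)" "RUnit A a \<in> Arr A" "Dom A (RUnit A a) = a \<boxtimes> Unit A" "Cod A (RUnit A a) = a" if "a \<in> Obj A" for a
    using runit_iso[OF that] by auto
  have as: "is_iso A (Assoc A a L M)" "Assoc A a L M \<in> Arr A" "Dom A (Assoc A a L M) = (a \<boxtimes> L) \<boxtimes> M"
    "Cod A (Assoc A a L M) = a \<boxtimes> L \<boxtimes> M" if "a \<in> Obj A" for a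
    using assoc_iso[OF that o] by auto
  have 1: "is_iso A (n a) \<and> Dom A (n a) = (a \<boxtimes> L) \<boxtimes> M \<and> Cod A (n a) = a" if a: "a \<in> Obj A" for a
  proof -
    have "is_iso A ((Idn A a \<star> \<phi>) \<cdot> Assoc A a L M)"
      by (rule iso_cmp[OF as(1) lt_iso[OF \<phi>(1)]]) (use a as(4) \<phi> \<phi>a in auto)
    then have "is_iso A (n a)" unfolding n_def
      by (rule iso_cmp[OF _ ru(1)]) (use a as ru(3) \<phi> \<phi>a in auto)
    then show ?thesis unfolding n_def using a as(2-4)[OF a] ru(2-4)[OF a] \<phi> \<phi>a by simp
  qed
  have 2: "f \<cdot> n (Dom A f) = n (Cod A f) \<cdot> (f \<odot> L \<odot> M)" if f: "f \<in> Arr A" for f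
  proof -
    let ?a = "Dom A f" and ?b = "Cod A f"
    have ab: "?a \<in> Obj A" "?b \<in> Obj A" using f by auto
    have e1: "f \<cdot> RUnit A ?a = RUnit A ?b \<cdot> (f \<odot> Unit A)" using runit_nat[of f ?a ?b] f by simp
    have e2: "(f \<odot> Unit A) \<cdot> (Idn A ?a \<star> \<phi>) = (Idn A ?b \<star> \<phi>) \<cdot> (f \<odot> (L \<boxtimes> M))"
      using interchange[OF f \<phi>a] \<phi> by simp
    have e3: "(f \<odot> (L \<boxtimes> M)) \<cdot> Assoc A ?a L M = Assoc A ?b L M \<cdot> (f \<odot> L \<odot> M)"
      using assoc_nat[of f ?a ?b "Idn A L" L L "Idn A M" M M] f o by (simp add: rt_idn)
    have "f \<cdot> n ?a = (RUnit A ?b \<cdot> (f \<odot> Unit A)) \<cdot> (Idn A ?a \<star> \<phi>) \<cdot> Assoc A ?a L M"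
      unfolding n_def by (rule cmp_extend[OF e1]) (use f as(2-4)[OF ab(1)] ru(2-4)[OF ab(1)] \<phi> \<phi>a in auto)
    also have "\<dots> = RUnit A ?b \<cdot> (f \<odot> Unit A) \<cdot> (Idn A ?a \<star> \<phi>) \<cdot> Assoc A ?a L M"
      using f as(2-4)[OF ab(1)] ru(2-4)[OF ab(2)] \<phi> \<phi>a by simp
    also have "(f \<odot> Unit A) \<cdot> (Idn A ?a \<star> \<phi>) \<cdot> Assoc A ?a L M = ((Idn A ?b \<star> \<phi>) \<cdot> (f \<odot> (L \<boxtimes> M))) \<cdot> Assoc A ?a L M"
      by (rule cmp_extend[OF e2]) (use f as(2-4)[OF ab(1)] \<phi> \<phi>a in auto)
    also have "\<dots> = (Idn A ?b \<star> \<phi>) \<cdot> Assoc A ?b L M \<cdot> (f \<odot> L \<odot> M)"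
      using f as(2-4)[OF ab(1)] \<phi> \<phi>a o e3 by simp
    also have "RUnit A ?b \<cdot> (Idn A ?b \<star> \<phi>) \<cdot> Assoc A ?b L M \<cdot> (f \<odot> L \<odot> M) = n ?b \<cdot> (f \<odot> L \<odot> M)"
      unfolding n_def using f as(2-4)[OF ab(2)] ru(2-4)[OF ab(2)] \<phi> \<phi>a o by simp
    finally show ?thesis .
  qed
  show ?thesis using 1 2 by blast
qed

lemma rt_faithful:
  assumes "inverses L M" "f \<in> Arr A" "g \<in> Arr A" "Dom A f = Dom A g" "Cod A f = Cod A g" "f \<odot> L = g \<odot> L"
  shows "f = g"
proof -
  obtain n where n: "\<And>a. a \<in> Obj A \<Longrightarrow> is_iso A (n a) \<and> Dom A (n a) = (a \<boxtimes> L) \<boxtimes> M \<and> Cod A (n a) = a"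
    "\<And>f. f \<in> Arr A \<Longrightarrow> f \<cdot> n (Dom A f) = n (Cod A f) \<cdot> (f \<odot> L \<odot> M)"
    using inverses_natural_iso[OF assms(1)] by blast
  have d: "Dom A g \<in> Obj A" using assms by simp
  have "f \<cdot> n (Dom A g) = g \<cdot> n (Dom A g)" using n(2)[OF assms(2)] n(2)[OF assms(3)] assms(4-6) by simp
  then show ?thesis by (rule epiD[OF iso_epi[OF conjunct1[OF n(1)[OF d]]]]) (use n(1)[OF d] assms in auto)
qed

lemma rt_zero_iff:
  assumes "inverses L M" "f \<in> Arr A"
  shows "zero_arrow A (f \<odot> L) \<longleftrightarrow> zero_arrow A f"
proof
  note o = inverses_obj[OF assms(1)]
  assume z: "zero_arrow A (f \<odot> L)"
  obtain k where k: "zero_arrow A k" "Dom A k = Dom A f" "Cod A k = Cod A f"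
    using zero_arrow_exists[of "Dom A f" "Cod A f"] assms(2) by auto
  have "k \<odot> L = f \<odot> L" by (rule zero_arrow_unique[OF rt_zero[OF k(1) o(1)] z]) (use k o assms(2) in auto)
  then have "k = f" by (rule rt_faithful[OF assms(1), rotated -1]) (use k assms(2) in auto)
  then show "zero_arrow A f" using k by simp
qed (use rt_zero inverses_obj assms in auto)

text \<open>If \<open>f \<odot> L\<close> kills \<open>g\<close>, twist by \<open>M\<close>: read
  through \<open>n\<close>, this says that \<open>f\<close> kills
  \<open>n (Dom A f) \<cdot> (g \<odot> M)\<close>, so \<open>g \<odot> M\<close> and hence
  \<open>g\<close> is zero.\<close>

lemma rt_mono:
  assumes "inverses L M" "is_mono A f" shows "is_mono A (f \<odot> L)"
proof (rule mono0I)
  note o = inverses_obj[OF assms(1)]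
  have f: "f \<in> Arr A" using assms by simp
  fix g assume g: "g \<in> Arr A" "Cod A g = Dom A (f \<odot> L)" "zero_arrow A ((f \<odot> L) \<cdot> g)"
  obtain n where n: "\<And>a. a \<in> Obj A \<Longrightarrow> is_iso A (n a) \<and> Dom A (n a) = (a \<boxtimes> L) \<boxtimes> M \<and> Cod A (n a) = a"
    "\<And>f. f \<in> Arr A \<Longrightarrow> f \<cdot> n (Dom A f) = n (Cod A f) \<cdot> (f \<odot> L \<odot> M)"
    using inverses_natural_iso[OF assms(1)] by blast
  have nD: "is_iso A (n a)" "n a \<in> Arr A" "Dom A (n a) = (a \<boxtimes> L) \<boxtimes> M" "Cod A (n a) = a" if "a \<in> Obj A" for a
    using n(1)[OF that] by auto
  have d: "Dom A f \<in> Obj A" "Cod A f \<in> Obj A" using f by auto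
  have "zero_arrow A ((f \<odot> L \<odot> M) \<cdot> (g \<odot> M))"
    using rt_zero[OF g(3) o(2)] rt_cmp[of g "f \<odot> L" M] g(1,2) f o by simp
  then have "zero_arrow A (n (Cod A f) \<cdot> (f \<odot> L \<odot> M) \<cdot> (g \<odot> M))"
    by (rule zero_cmpL) (use nD[OF d(2)] g(1,2) f o in auto)
  moreover have "f \<cdot> n (Dom A f) \<cdot> (g \<odot> M) = (n (Cod A f) \<cdot> (f \<odot> L \<odot> M)) \<cdot> (g \<odot> M)"
    by (rule cmp_extend[OF n(2)[OF f]]) (use nD[OF d(1)] g(1,2) f o in auto)
  ultimately have "zero_arrow A (f \<cdot> n (Dom A f) \<cdot> (g \<odot> M))" using nD[OF d(2)] g(1,2) f o by simp
  then have "zero_arrow A (n (Dom A f) \<cdot> (g \<odot> M))"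
    by (rule mono_zero[OF assms(2), rotated 2]) (use nD[OF d(1)] g(1,2) f o in auto)
  then have "zero_arrow A (g \<odot> M)"
    by (rule mono_zero[OF iso_mono[OF nD(1)[OF d(1)]], rotated 2]) (use nD[OF d(1)] g(1,2) f o in auto)
  then show "zero_arrow A g" using rt_zero_iff[OF inverses_sym[OF assms(1)]] g(1) by blast
qed (use assms inverses_obj in auto)

text \<open>The preimage of \<open>g\<close> is \<open>g \<odot> M\<close> conjugated by
  \<open>n\<close>. Naturality gives \<open>f \<odot> L \<odot> M = g \<odot> M\<close>, and
  twisting by \<open>M\<close> is faithful.\<close>

lemma rt_full:
  assumes "inverses L M" "a \<in> Obj A" "b \<in> Obj A" "g \<in> Arr A" "Dom A g = a \<boxtimes> L" "Cod A g = b \<boxtimes> L"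
  shows "\<exists>f \<in> Arr A. Dom A f = a \<and> Cod A f = b \<and> f \<odot> L = g"
proof -
  note o = inverses_obj[OF assms(1)]
  obtain n where n: "\<And>a. a \<in> Obj A \<Longrightarrow> is_iso A (n a) \<and> Dom A (n a) = (a \<boxtimes> L) \<boxtimes> M \<and> Cod A (n a) = a"
    "\<And>f. f \<in> Arr A \<Longrightarrow> f \<cdot> n (Dom A f) = n (Cod A f) \<cdot> (f \<odot> L \<odot> M)"
    using inverses_natural_iso[OF assms(1)] by blast
  have nD: "is_iso A (n a)" "n a \<in> Arr A" "Dom A (n a) = (a \<boxtimes> L) \<boxtimes> M" "Cod A (n a) = a" if "a \<in> Obj A" for a
    using n(1)[OF that] by auto
  obtain k where k: "k \<in> Arr A" "Dom A k = a" "Cod A k = (a \<boxtimes> L) \<boxtimes> M" "k \<cdot> n a = Idn A ((a \<boxtimes> L) \<boxtimes> M)"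
    using isoE[OF nD(1)[OF assms(2)]] nD[OF assms(2)] by metis
  define f where "f = n b \<cdot> (g \<odot> M) \<cdot> k"
  have f: "f \<in> Arr A" "Dom A f = a" "Cod A f = b"
    unfolding f_def using nD[OF assms(3)] k(1-3) assms(2-6) o by simp_all
  have "n b \<cdot> (f \<odot> L \<odot> M) = f \<cdot> n a" using n(2)[OF f(1)] f by simp
  also have "\<dots> = n b \<cdot> (g \<odot> M)" unfolding f_def using nD[OF assms(3)] nD[OF assms(2)] k assms(2-6) o by simp
  finally have "f \<odot> L \<odot> M = g \<odot> M"
    by (rule monoD[OF iso_mono[OF nD(1)[OF assms(3)]]]) (use nD[OF assms(3)] f assms(2-6) o in auto)
  then have "f \<odot> L = g"
    by (rule rt_faithful[OF inverses_sym[OF assms(1)], rotated -1]) (use f assms(2-6) o in auto)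
  then show ?thesis using f by blast
qed

text \<open>Twisting by \<open>M\<close> embeds the preorder of subobjects of
  \<open>x \<boxtimes> L\<close> into that of \<open>(x \<boxtimes> L) \<boxtimes> M\<close>, which
  is isomorphic to \<open>x\<close>; factorizations descend by fullness.\<close>

lemma noetherian_tensor:
  assumes "inverses L M" "noetherian_object A x" shows "noetherian_object A (x \<boxtimes> L)"
proof (rule noetherianI)
  note o = inverses_obj[OF assms(1)]
  have x: "x \<in> Obj A" using noetherian_obj assms by blast
  then show "x \<boxtimes> L \<in> Obj A" using o by simp
  fix s :: "nat \<Rightarrow> 'm"
  assume s: "\<And>n. is_mono A (s n)" "\<And>n. Cod A (s n) = x \<boxtimes> L" "\<And>n. subobject_le A (s n) (s (Suc n))"
  have sa: "s n \<in> Arr A" for n using s(1) by simp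
  have down: "subobject_le A (s i \<odot> M) (s j \<odot> M) \<longleftrightarrow> subobject_le A (s i) (s j)" for i j
  proof
    assume "subobject_le A (s i \<odot> M) (s j \<odot> M)"
    then obtain h where h: "h \<in> Arr A" "Dom A h = Dom A (s i \<odot> M)" "Cod A h = Dom A (s j \<odot> M)" "(s j \<odot> M) \<cdot> h = s i \<odot> M"
      using subobject_leE by metis
    obtain h' where h': "h' \<in> Arr A" "Dom A h' = Dom A (s i)" "Cod A h' = Dom A (s j)" "h' \<odot> M = h"
      using rt_full[OF inverses_sym[OF assms(1)], of "Dom A (s i)" "Dom A (s j)" h] h(1-3) sa o by auto
    have "(s j \<cdot> h') \<odot> M = s i \<odot> M" using rt_cmp[of h' "s j" M] h h' sa o by simp
    then have "s j \<cdot> h' = s i"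
      by (rule rt_faithful[OF inverses_sym[OF assms(1)], rotated -1]) (use h'(1-3) sa s(2) in simp_all)
    then show "subobject_le A (s i) (s j)" by (rule subobject_leI) (use h' in auto)
  next
    assume "subobject_le A (s i) (s j)"
    then obtain h where h: "h \<in> Arr A" "Dom A h = Dom A (s i)" "Cod A h = Dom A (s j)" "s j \<cdot> h = s i"
      using subobject_leE by metis
    have "(s j \<odot> M) \<cdot> (h \<odot> M) = s i \<odot> M" using rt_cmp[of h "s j" M] h sa o by simp
    then show "subobject_le A (s i \<odot> M) (s j \<odot> M)" by (rule subobject_leI) (use h sa o in auto)
  qed
  have "noetherian_object A ((x \<boxtimes> L) \<boxtimes> M)"
    using noetherian_isomorphic[OF assms(2)] isomorphic_sym[OF inverses_cancel[OF assms(1) x]] by blast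
  then have "\<exists>N. \<forall>n \<ge> N. subobject_le A (s n \<odot> M) (s N \<odot> M)"
  proof (rule noetherianD)
    show "is_mono A (s n \<odot> M)" for n using rt_mono[OF inverses_sym[OF assms(1)] s(1)] .
    show "Cod A (s n \<odot> M) = (x \<boxtimes> L) \<boxtimes> M" for n using sa s(2) o by simp
    show "subobject_le A (s n \<odot> M) (s (Suc n) \<odot> M)" for n using down s(3) by blast
  qed
  then show "\<exists>N. \<forall>n \<ge> N. subobject_le A (s n) (s N)" unfolding down .
qed

end

section \<open>Annihilators and prime objects\<close>

context closed_monoidal_abelian
begin

text \<open>For the inclusion \<open>j\<close> of an ideal J in I this is the condition J X = 0.
  Arrows that are not monic are allowed, which spares passing to images.\<close>

definition kills :: "'m \<Rightarrow> 'o \<Rightarrow> bool" where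
  "kills j X \<longleftrightarrow> zero_arrow A (j \<odot> X)"

lemma lunit_simps:
  assumes "x \<in> Obj A"
  shows "is_iso A (LUnit A x)" "LUnit A x \<in> Arr A" "Dom A (LUnit A x) = Unit A \<boxtimes> x" "Cod A (LUnit A x) = x"
  using lunit_iso[OF assms] by auto

lemma lunit_nat':
  "f \<in> Arr A \<Longrightarrow> LUnit A (Cod A f) \<cdot> (Idn A (Unit A) \<star> f) = f \<cdot> LUnit A (Dom A f)"
  using lunit_nat[of f "Dom A f" "Cod A f"] by simp

lemma kills_cmp:
  assumes "kills j X" "j \<in> Arr A" "k \<in> Arr A" "Cod A k = Dom A j" "X \<in> Obj A"
  shows "kills (j \<cdot> k) X"
  using zero_cmpR[of "j \<odot> X" "k \<odot> X"] rt_cmp[of k j X] assms unfolding kills_def by simp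

text \<open>J \<otimes> m need not be monic, but I \<otimes> m is, the left unitor identifying it
  with \<open>m\<close>; \<open>interchange\<close> moves the vanishing to that side.\<close>

lemma kills_sub:
  assumes "kills j (Cod A m)" "is_mono A m" "j \<in> Arr A" "Cod A j = Unit A"
  shows "kills j (Dom A m)"
proof -
  have m: "m \<in> Arr A" using assms by simp
  have o: "Dom A m \<in> Obj A" "Cod A m \<in> Obj A" "Dom A j \<in> Obj A" using m assms(3) by auto
  have "is_mono A (m \<cdot> LUnit A (Dom A m))"
    by (rule mono_cmp[OF iso_mono[OF lunit_simps(1)[OF o(1)]] assms(2)]) (use lunit_simps[OF o(1)] in auto)
  then have "is_mono A (LUnit A (Cod A m) \<cdot> (Idn A (Unit A) \<star> m))" unfolding lunit_nat'[OF m] .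
  then have mono: "is_mono A (Idn A (Unit A) \<star> m)"
    by (rule mono_cancel) (use lunit_simps[OF o(2)] m in auto)
  have "zero_arrow A ((j \<odot> Cod A m) \<cdot> (Idn A (Dom A j) \<star> m))"
    by (rule zero_cmpR) (use assms m o in \<open>auto simp: kills_def\<close>)
  then have "zero_arrow A ((Idn A (Unit A) \<star> m) \<cdot> (j \<odot> Dom A m))"
    using interchange[OF assms(3) m] assms(4) by simp
  then show ?thesis unfolding kills_def
    by (rule mono_zero[OF mono, rotated 2]) (use assms(3,4) m o in auto)
qed

text \<open>Here right exactness suffices: J \<otimes> e is epi and can be cancelled.\<close>

lemma kills_quot:
  assumes "kills j (Dom A e)" "is_epi A e" "j \<in> Arr A"
  shows "kills j (Cod A e)"
proof -
  have e: "e \<in> Arr A" using assms by simp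
  have o: "Dom A e \<in> Obj A" "Cod A e \<in> Obj A" "Dom A j \<in> Obj A" "Cod A j \<in> Obj A" using e assms(3) by auto
  have "zero_arrow A ((Idn A (Cod A j) \<star> e) \<cdot> (j \<odot> Dom A e))"
    by (rule zero_cmpL) (use assms e o in \<open>auto simp: kills_def\<close>)
  then have "zero_arrow A ((j \<odot> Cod A e) \<cdot> (Idn A (Dom A j) \<star> e))"
    using interchange[OF assms(3) e] by simp
  then show ?thesis unfolding kills_def
    by (rule epi_zero[OF lt_epi[OF assms(2) o(3)], rotated 2]) (use assms(3) e o in auto)
qed

text \<open>The associator turns \<open>j \<odot> (X \<boxtimes> L)\<close> into
  \<open>j \<odot> X \<odot> L\<close>, and twisting by \<open>L\<close> reflects zero
  arrows.\<close>

lemma kills_tensor: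
  assumes "inverses L M" "X \<in> Obj A" "j \<in> Arr A"
  shows "kills j (X \<boxtimes> L) \<longleftrightarrow> kills j X"
proof -
  note o = inverses_obj[OF assms(1)]
  let ?a = "\<lambda>J. Assoc A J X L"
  have as: "is_iso A (?a J)" "?a J \<in> Arr A" "Dom A (?a J) = (J \<boxtimes> X) \<boxtimes> L" "Cod A (?a J) = J \<boxtimes> X \<boxtimes> L" if "J \<in> Obj A" for J
    using assoc_iso[OF that assms(2) o(1)] by auto
  have d: "Dom A j \<in> Obj A" "Cod A j \<in> Obj A" using assms(3) by auto
  have eq: "?a (Cod A j) \<cdot> (j \<odot> X \<odot> L) = (j \<odot> (X \<boxtimes> L)) \<cdot> ?a (Dom A j)"
    using assoc_nat[of j "Dom A j" "Cod A j" "Idn A X" X X "Idn A L" L L] assms o by (simp add: rt_idn)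
  have "zero_arrow A (j \<odot> X \<odot> L) \<longleftrightarrow> zero_arrow A (j \<odot> (X \<boxtimes> L))"
  proof
    assume "zero_arrow A (j \<odot> X \<odot> L)"
    then have "zero_arrow A (?a (Cod A j) \<cdot> (j \<odot> X \<odot> L))" by (rule zero_cmpL) (use as[OF d(2)] assms o in auto)
    then show "zero_arrow A (j \<odot> (X \<boxtimes> L))" unfolding eq
      by (rule epi_zero[OF iso_epi[OF as(1)[OF d(1)]], rotated 2]) (use as[OF d(1)] assms o in auto)
  next
    assume "zero_arrow A (j \<odot> (X \<boxtimes> L))"
    then have "zero_arrow A ((j \<odot> (X \<boxtimes> L)) \<cdot> ?a (Dom A j))" by (rule zero_cmpR) (use as[OF d(1)] assms o in auto)
    then show "zero_arrow A (j \<odot> X \<odot> L)" unfolding eq[symmetric]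
      by (rule mono_zero[OF iso_mono[OF as(1)[OF d(2)]], rotated 2]) (use as[OF d(2)] assms o in auto)
  qed
  moreover have "zero_arrow A (j \<odot> X \<odot> L) \<longleftrightarrow> zero_arrow A (j \<odot> X)"
    by (rule rt_zero_iff[OF assms(1)]) (use assms in auto)
  ultimately show ?thesis unfolding kills_def by simp
qed

text \<open>A relation, as the largest ideal killing \<open>X\<close> is represented by many
  monomorphisms.\<close>

definition annihilator :: "'o \<Rightarrow> 'm \<Rightarrow> bool" where
  "annihilator X a \<longleftrightarrow> is_mono A a \<and> Cod A a = Unit A \<and> kills a X \<and>
    (\<forall>j \<in> Arr A. Cod A j = Unit A \<and> kills j X \<longrightarrow> subobject_le A j a)"

text \<open>It is the kernel of the arrow I -> [X, X] adjoint to the left unitor of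
  \<open>X\<close>: an ideal acts as zero exactly when the composite with this arrow is
  zero.\<close>

lemma annihilator_exists:
  assumes "X \<in> Obj A" shows "\<exists>a. annihilator X a"
proof -
  note lu = lunit_simps[OF assms]
  obtain h ev where ev: "h \<in> Obj A" "ev \<in> Arr A" "Dom A ev = h \<boxtimes> X" "Cod A ev = X" and
    tr: "\<And>x f. x \<in> Obj A \<Longrightarrow> f \<in> Arr A \<Longrightarrow> Dom A f = x \<boxtimes> X \<Longrightarrow> Cod A f = X \<Longrightarrow>
       \<exists>g \<in> Arr A. Dom A g = x \<and> Cod A g = h \<and> ev \<cdot> (g \<odot> X) = f" and
    un: "\<And>g g'. g \<in> Arr A \<Longrightarrow> g' \<in> Arr A \<Longrightarrow> Dom A g = Dom A g' \<Longrightarrow> Cod A g = h \<Longrightarrow> Cod A g' = h \<Longrightarrow>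
       ev \<cdot> (g \<odot> X) = ev \<cdot> (g' \<odot> X) \<Longrightarrow> g = g'"
    by (rule transposeE[OF assms assms]) (rule that)
  obtain g where g: "g \<in> Arr A" "Dom A g = Unit A" "Cod A g = h" "ev \<cdot> (g \<odot> X) = LUnit A X"
    using tr[of "Unit A" "LUnit A X"] lu by auto
  have iff: "zero_arrow A (g \<cdot> j) \<longleftrightarrow> kills j X" if j: "j \<in> Arr A" "Cod A j = Unit A" for j
  proof -
    have eq: "ev \<cdot> ((g \<cdot> j) \<odot> X) = LUnit A X \<cdot> (j \<odot> X)"
      using rt_cmp[of j g X] cmp_extend[OF g(4), of "j \<odot> X"] g(1-3) ev j assms by simp
    show ?thesis
    proof
      assume "zero_arrow A (g \<cdot> j)"
      then have "zero_arrow A ((g \<cdot> j) \<odot> X)" using rt_zero assms by blast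
      then have "zero_arrow A (ev \<cdot> ((g \<cdot> j) \<odot> X))" by (rule zero_cmpL) (use ev g(1-3) j assms in auto)
      then show "kills j X" unfolding eq kills_def
        by (rule mono_zero[OF iso_mono[OF lu(1)], rotated 2]) (use lu j assms in auto)
    next
      assume "kills j X"
      then have 1: "zero_arrow A (ev \<cdot> ((g \<cdot> j) \<odot> X))" unfolding eq kills_def
        by (rule zero_cmpL) (use lu j assms in auto)
      obtain n where n: "zero_arrow A n" "Dom A n = Dom A j" "Cod A n = h"
        using zero_arrow_exists[of "Dom A j" h] ev j by auto
      have 2: "zero_arrow A (ev \<cdot> (n \<odot> X))"
        by (rule zero_cmpL[OF rt_zero[OF n(1) assms]]) (use ev n assms in auto)
      have "ev \<cdot> ((g \<cdot> j) \<odot> X) = ev \<cdot> (n \<odot> X)"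
        by (rule zero_arrow_unique[OF 1 2]) (use ev n g(1-3) j assms in auto)
      then have "g \<cdot> j = n" by (rule un[rotated 5]) (use n g(1-3) j in auto)
      then show "zero_arrow A (g \<cdot> j)" using n by simp
    qed
  qed
  obtain a where a: "is_kernel A g a" using kernel_exists g by blast
  note aD = kernelD[OF a]
  have "subobject_le A j a" if j: "j \<in> Arr A" "Cod A j = Unit A" "kills j X" for j
    using kernel_lift[OF a, of j] iff[of j] j g(2) subobject_leI by metis
  then show ?thesis unfolding annihilator_def
    using kernel_mono[OF a] aD g(2) iff[of a] by (intro exI[of _ a]) auto
qed

lemma annihilator_le_kills:
  assumes "annihilator X a" "j \<in> Arr A" "Cod A j = Unit A" "subobject_le A j a" "X \<in> Obj A"
  shows "kills j X"
proof -
  obtain h where h: "h \<in> Arr A" "Dom A h = Dom A j" "Cod A h = Dom A a" "a \<cdot> h = j"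
    using subobject_leE[OF assms(4)] by metis
  have "kills (a \<cdot> h) X" by (rule kills_cmp) (use assms h in \<open>auto simp: annihilator_def\<close>)
  then show ?thesis using h by simp
qed

text \<open>For a quotient E of L, J E = 0 means that the image of J \<otimes> L in L lies in the
  kernel of \<open>p\<close>. By naturality of the left unitor, the composite is
  \<open>j \<odot> E\<close> preceded by the epi J \<otimes> p and followed by an
  isomorphism.\<close>

lemma kills_quotient_iff:
  assumes "is_epi A p" "j \<in> Arr A" "Cod A j = Unit A"
  shows "kills j (Cod A p) \<longleftrightarrow> zero_arrow A (p \<cdot> LUnit A (Dom A p) \<cdot> (j \<odot> Dom A p))"
proof -
  let ?L = "Dom A p" and ?E = "Cod A p"
  have p: "p \<in> Arr A" using assms by simp
  have o: "?L \<in> Obj A" "?E \<in> Obj A" "Dom A j \<in> Obj A" using p assms(2) by auto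
  note lL = lunit_simps[OF o(1)] and lE = lunit_simps[OF o(2)]
  have "(p \<cdot> LUnit A ?L) \<cdot> (j \<odot> ?L) = (LUnit A ?E \<cdot> (Idn A (Unit A) \<star> p)) \<cdot> (j \<odot> ?L)"
    using lunit_nat'[OF p] by simp
  also have "\<dots> = LUnit A ?E \<cdot> ((Idn A (Unit A) \<star> p) \<cdot> (j \<odot> ?L))" using lE p o assms(2,3) by simp
  also have "(Idn A (Unit A) \<star> p) \<cdot> (j \<odot> ?L) = (j \<odot> ?E) \<cdot> (Idn A (Dom A j) \<star> p)"
    using interchange[OF assms(2) p] assms(3) by simp
  finally have eq: "p \<cdot> LUnit A ?L \<cdot> (j \<odot> ?L) = LUnit A ?E \<cdot> (j \<odot> ?E) \<cdot> (Idn A (Dom A j) \<star> p)"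
    using lL p o assms(2,3) by simp
  show ?thesis
  proof
    assume "kills j ?E"
    then have "zero_arrow A ((j \<odot> ?E) \<cdot> (Idn A (Dom A j) \<star> p))" unfolding kills_def
      by (rule zero_cmpR) (use p o assms(2,3) in auto)
    then show "zero_arrow A (p \<cdot> LUnit A ?L \<cdot> (j \<odot> ?L))" unfolding eq
      by (rule zero_cmpL) (use lE p o assms(2,3) in auto)
  next
    assume "zero_arrow A (p \<cdot> LUnit A ?L \<cdot> (j \<odot> ?L))"
    then have "zero_arrow A ((j \<odot> ?E) \<cdot> (Idn A (Dom A j) \<star> p))" unfolding eq
      by (rule mono_zero[OF iso_mono[OF lE(1)], rotated 2]) (use lE p o assms(2,3) in auto)
    then show "kills j ?E" unfolding kills_def
      by (rule epi_zero[OF lt_epi[OF assms(1) o(3)], rotated 2]) (use p o assms(2,3) in auto)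
  qed
qed

text \<open>The source of \<open>l\<close> is untwisted by \<open>M\<close>, and fullness provides
  \<open>j\<close>. Subobjects of an invertible object thus have the form J L, which makes them
  accessible to \<open>kills\<close>.\<close>

lemma sub_invertible_from_unit:
  assumes "inverses L M" "l \<in> Arr A" "Cod A l = L"
  shows "\<exists>j u. j \<in> Arr A \<and> Cod A j = Unit A \<and> is_iso A u \<and> Dom A u = Dom A j \<boxtimes> L \<and> Cod A u = Dom A l \<and>
    LUnit A L \<cdot> (j \<odot> L) = l \<cdot> u"
proof -
  note o = inverses_obj[OF assms(1)]
  note lL = lunit_simps[OF o(1)]
  let ?J = "Dom A l \<boxtimes> M"
  have d: "Dom A l \<in> Obj A" using assms by simp
  obtain u where u: "is_iso A u" "Dom A u = ?J \<boxtimes> L" "Cod A u = Dom A l"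
    using isomorphicD[OF inverses_cancel[OF inverses_sym[OF assms(1)] d]] by blast
  have ua: "u \<in> Arr A" using u by simp
  obtain k where k: "k \<in> Arr A" "Dom A k = L" "Cod A k = Unit A \<boxtimes> L" "LUnit A L \<cdot> k = Idn A L"
    using isoE[OF lL(1)] lL by metis
  have "k \<cdot> l \<cdot> u \<in> Arr A" "Dom A (k \<cdot> l \<cdot> u) = ?J \<boxtimes> L" "Cod A (k \<cdot> l \<cdot> u) = Unit A \<boxtimes> L"
    using k u ua assms by simp_all
  then obtain j where j: "j \<in> Arr A" "Dom A j = ?J" "Cod A j = Unit A" "j \<odot> L = k \<cdot> l \<cdot> u"
    using rt_full[OF assms(1), of ?J "Unit A" "k \<cdot> l \<cdot> u"] d o by auto
  have "LUnit A L \<cdot> (j \<odot> L) = Idn A L \<cdot> (l \<cdot> u)"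
    unfolding j(4) by (rule cmp_extend[OF k(4)]) (use lL k u ua assms in auto)
  then show ?thesis using j(1-3) u ua assms by (intro exI[of _ j] exI[of _ u]) simp
qed

text \<open>The counterpart of R/p for a prime ideal p of a commutative ring R, with an invertible
  object in place of the free module of rank one. The converse of the last implication is
  \<open>kills_sub\<close>.\<close>

definition prime_object :: "'o \<Rightarrow> bool" where
  "prime_object D \<longleftrightarrow> D \<in> Obj A \<and> \<not> is_zero A D \<and>
    (\<exists>e. is_epi A e \<and> invertible_object A (Dom A e) \<and> Cod A e = D) \<and>
    (\<forall>m j. is_mono A m \<and> Cod A m = D \<and> \<not> is_zero A (Dom A m) \<and> j \<in> Arr A \<and> Cod A j = Unit A \<and> kills j (Dom A m)
      \<longrightarrow> kills j D)"

lemma prime_objectD: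
  assumes "prime_object D"
  shows "D \<in> Obj A" "\<not> is_zero A D" "\<exists>e. is_epi A e \<and> invertible_object A (Dom A e) \<and> Cod A e = D"
    "\<And>m j. is_mono A m \<Longrightarrow> Cod A m = D \<Longrightarrow> \<not> is_zero A (Dom A m) \<Longrightarrow> j \<in> Arr A \<Longrightarrow> Cod A j = Unit A \<Longrightarrow> 
       kills j (Dom A m) \<longleftrightarrow> kills j D"
  using assms kills_sub unfolding prime_object_def by blast+

text \<open>The preimage in \<open>L\<close> of a nonzero subobject \<open>m\<close> of
  \<open>D\<close> has the form J L, so J kills the quotient by \<open>m\<close>. A nonzero
  subobject of \<open>D\<close> that embeds in this quotient is killed by J as well, hence J kills
  \<open>D\<close> by primality; then \<open>e \<cdot> l\<close> vanishes, although it maps onto the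
  nonzero \<open>m\<close>.\<close>

lemma prime_monoform:
  assumes "prime_object D" shows "monoform A D"
  unfolding monoform_def
proof (intro conjI allI impI notI)
  fix m q assume h: "is_mono A m \<and> Cod A m = D \<and> \<not> is_zero A (Dom A m) \<and> is_cokernel A m q"
    and "common_nonzero_subobject A D (Cod A q)"
  then obtain s t where st: "is_mono A s" "is_mono A t" "Dom A s = Dom A t" "\<not> is_zero A (Dom A s)" "Cod A s = D" "Cod A t = Cod A q"
    unfolding common_nonzero_subobject_def by blast
  have m: "is_mono A m" "Cod A m = D" "\<not> is_zero A (Dom A m)" and q: "is_cokernel A m q" using h by auto
  note qD = cokernelD[OF q]
  obtain e L M where e: "is_epi A e" "Dom A e = L" "Cod A e = D" and L: "inverses L M"
    using prime_objectD(3)[OF assms] invertible_iff by blast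
  have ea: "e \<in> Arr A" and ma: "m \<in> Arr A" using e m by auto
  obtain l t' where l: "is_mono A l" "Cod A l = Dom A e" "Dom A t' = Dom A l" "Cod A t' = Dom A m" "e \<cdot> l = m \<cdot> t'" "is_epi A t'"
    using preimage[OF ea m(1)] m e by metis
  have la: "l \<in> Arr A" "t' \<in> Arr A" using l by auto
  have "Cod A l = L" using l e by simp
  then obtain j u where j: "j \<in> Arr A" "Cod A j = Unit A" "is_iso A u" "Dom A u = Dom A j \<boxtimes> L" "Cod A u = Dom A l"
    "LUnit A L \<cdot> (j \<odot> L) = l \<cdot> u" using sub_invertible_from_unit[OF L la(1)] by blast
  have ua: "u \<in> Arr A" using j by simp
  have "is_epi A (q \<cdot> e)" by (rule epi_cmp[OF e(1) cokernel_epi[OF q]]) (use qD e m in auto)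
  moreover have "zero_arrow A ((q \<cdot> e) \<cdot> LUnit A L \<cdot> (j \<odot> L))"
  proof -
    have "zero_arrow A ((q \<cdot> m) \<cdot> (t' \<cdot> u))" by (rule zero_cmpR[OF qD(4)]) (use qD la l j ua in auto)
    also have "(q \<cdot> m) \<cdot> (t' \<cdot> u) = q \<cdot> (m \<cdot> t') \<cdot> u" using qD la l j ua by simp
    also have "\<dots> = (q \<cdot> e) \<cdot> LUnit A L \<cdot> (j \<odot> L)" unfolding l(5)[symmetric] j(6) using qD la l(2-4) j(3-5) ua ea e m by simp
    finally show ?thesis .
  qed
  ultimately have "kills j (Cod A q)" using kills_quotient_iff[of "q \<cdot> e" j] j(1,2) qD ea e m by simp
  then have "kills j (Dom A t)" using kills_sub[of j t] st j by simp
  then have "kills j D" using prime_objectD(4)[OF assms st(1), of j] st j(1,2) by simp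
  then have "zero_arrow A (e \<cdot> l \<cdot> u)" using kills_quotient_iff[OF e(1) j(1,2)] j(6) e by simp
  then have "zero_arrow A ((e \<cdot> l) \<cdot> u)" using ea la l(2) ua j(5) by simp
  then have "zero_arrow A (e \<cdot> l)" by (rule epi_zero[OF iso_epi[OF j(3)], rotated 2]) (use ea la l(2) ua j(5) in auto)
  then have "zero_arrow A (m \<cdot> t')" unfolding l(5) .
  then have "zero_arrow A m" by (rule epi_zero[OF l(6), rotated 2]) (use ma la l(4) in auto)
  then show False using zero_of_mono_zero_arrow m by blast
qed (use prime_objectD(1,2)[OF assms] in auto)

text \<open>The arrow \<open>c\<close> is \<open>p\<close> up to the automorphism of the unit given by the two unit isomorphisms; that
  this automorphism is the identity is not among the axioms.\<close>

lemma unit_quotient: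
  assumes "is_epi A p" "Dom A p = Unit A"
  shows "\<exists>c. is_epi A c \<and> Dom A c = Unit A \<and> Cod A c = Cod A p \<and>
    (\<forall>j \<in> Arr A. Cod A j = Unit A \<longrightarrow> (kills j (Cod A p) \<longleftrightarrow> zero_arrow A (c \<cdot> j)))"
proof -
  have p: "p \<in> Arr A" using assms by simp
  note lu = lunit_simps[OF unit_obj]
  have ru: "is_iso A (RUnit A a)" "RUnit A a \<in> Arr A" "Dom A (RUnit A a) = a \<boxtimes> Unit A" "Cod A (RUnit A a) = a" if "a \<in> Obj A" for a
    using runit_iso[OF that] by auto
  note rI = ru[OF unit_obj]
  obtain r where r: "r \<in> Arr A" "Dom A r = Unit A" "Cod A r = Unit A \<boxtimes> Unit A" "r \<cdot> RUnit A (Unit A) = Idn A (Unit A \<boxtimes> Unit A)" "is_iso A r"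
    using isoE[OF rI(1)] rI by metis
  let ?c = "p \<cdot> LUnit A (Unit A) \<cdot> r"
  have "is_epi A (LUnit A (Unit A) \<cdot> r)" by (rule epi_cmp[OF iso_epi[OF r(5)] iso_epi[OF lu(1)]]) (use lu r in auto)
  then have c: "is_epi A ?c" by (rule epi_cmp[OF _ assms(1)]) (use assms lu r in auto)
  have "kills j (Cod A p) \<longleftrightarrow> zero_arrow A (?c \<cdot> j)" if j: "j \<in> Arr A" "Cod A j = Unit A" for j
  proof -
    have d: "Dom A j \<in> Obj A" using j by simp
    note rj = ru[OF d]
    have e1: "RUnit A (Unit A) \<cdot> (j \<odot> Unit A) = j \<cdot> RUnit A (Dom A j)" using runit_nat[of j "Dom A j" "Unit A"] j by simp
    have "r \<cdot> (j \<cdot> RUnit A (Dom A j)) = Idn A (Unit A \<boxtimes> Unit A) \<cdot> (j \<odot> Unit A)"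
      unfolding e1[symmetric] by (rule cmp_extend[OF r(4)]) (use r rI j in auto)
    then have e2: "r \<cdot> (j \<cdot> RUnit A (Dom A j)) = j \<odot> Unit A" using j d by simp
    have "(?c \<cdot> j) \<cdot> RUnit A (Dom A j) = p \<cdot> LUnit A (Unit A) \<cdot> (r \<cdot> (j \<cdot> RUnit A (Dom A j)))"
      using p assms(2) lu r(1-3) rj j by simp
    then have eq: "(?c \<cdot> j) \<cdot> RUnit A (Dom A j) = p \<cdot> LUnit A (Unit A) \<cdot> (j \<odot> Unit A)" unfolding e2 .
    have ca: "?c \<in> Arr A" "Dom A ?c = Unit A" using c p assms(2) lu r(1-3) by auto
    have "zero_arrow A (?c \<cdot> j) \<longleftrightarrow> zero_arrow A ((?c \<cdot> j) \<cdot> RUnit A (Dom A j))"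
    proof
      assume "zero_arrow A (?c \<cdot> j)"
      then show "zero_arrow A ((?c \<cdot> j) \<cdot> RUnit A (Dom A j))" by (rule zero_cmpR) (use ca rj j in auto)
    next
      assume "zero_arrow A ((?c \<cdot> j) \<cdot> RUnit A (Dom A j))"
      then show "zero_arrow A (?c \<cdot> j)" by (rule epi_zero[OF iso_epi[OF rj(1)], rotated 2]) (use ca rj j in auto)
    qed
    then show ?thesis unfolding eq using kills_quotient_iff[OF assms(1) j] assms(2) by simp
  qed
  moreover have "Dom A ?c = Unit A" "Cod A ?c = Cod A p" using p assms(2) lu r(1-3) by simp_all
  ultimately show ?thesis using c by (intro exI[of _ ?c]) simp
qed

text \<open>Twisting an epi from \<open>L\<close> to \<open>D\<close> by the inverse
  \<open>M\<close> turns its source into the unit. As \<open>D\<close> and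
  \<open>D \<boxtimes> M\<close> are killed by the same arrows, the annihilator of \<open>D\<close>
  becomes the kernel of \<open>c\<close>.\<close>

lemma prime_twist:
  assumes "prime_object D"
  shows "\<exists>M c. invertible_object A M \<and> is_epi A c \<and> Dom A c = Unit A \<and> Cod A c = D \<boxtimes> M \<and>
    (\<forall>j \<in> Arr A. Cod A j = Unit A \<longrightarrow> (kills j D \<longleftrightarrow> zero_arrow A (c \<cdot> j)))"
proof -
  obtain e L M where e: "is_epi A e" "Dom A e = L" "Cod A e = D" and L: "inverses L M"
    using prime_objectD(3)[OF assms] invertible_iff by blast
  note o = inverses_obj[OF L]
  have ea: "e \<in> Arr A" using e by simp
  obtain \<phi> where \<phi>: "is_iso A \<phi>" "Dom A \<phi> = Unit A" "Cod A \<phi> = L \<boxtimes> M"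
    using isomorphicD[OF isomorphic_sym] L unfolding inverses_def by blast
  have \<phi>a: "\<phi> \<in> Arr A" using \<phi> by simp
  have "is_epi A ((e \<odot> M) \<cdot> \<phi>)" by (rule epi_cmp[OF iso_epi[OF \<phi>(1)] rt_epi[OF e(1) o(2)]]) (use ea e \<phi> o in auto)
  moreover have "Dom A ((e \<odot> M) \<cdot> \<phi>) = Unit A" "Cod A ((e \<odot> M) \<cdot> \<phi>) = D \<boxtimes> M" using ea e \<phi> \<phi>a o by simp_all
  ultimately obtain c where c: "is_epi A c" "Dom A c = Unit A" "Cod A c = D \<boxtimes> M"
    "\<forall>j \<in> Arr A. Cod A j = Unit A \<longrightarrow> (kills j (D \<boxtimes> M) \<longleftrightarrow> zero_arrow A (c \<cdot> j))"
    using unit_quotient by metis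
  have D: "D \<in> Obj A" using ea e by auto
  show ?thesis
    by (rule exI[of _ M], rule exI[of _ c])
       (use c kills_tensor[OF inverses_sym[OF L] D] inverses_sym[OF L] invertible_iff in blast)
qed

text \<open>Each of \<open>c\<close> and \<open>d\<close> kills the kernel of the other, both
  conditions amounting to \<open>kills\<close> by \<open>prime_twist\<close>; so each factors
  through the other, and the factors are inverse to each other.\<close>

lemma prime_determined_by_annihilator:
  assumes "prime_object D" "prime_object E" "\<And>j. j \<in> Arr A \<Longrightarrow> Cod A j = Unit A \<Longrightarrow> kills j D \<longleftrightarrow> kills j E"
  shows "\<exists>M N. invertible_object A M \<and> invertible_object A N \<and> isomorphic A (D \<boxtimes> M) (E \<boxtimes> N)"
proof -
  obtain M c where M: "invertible_object A M" and c: "is_epi A c" "Dom A c = Unit A" "Cod A c = D \<boxtimes> M"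
    "\<And>j. j \<in> Arr A \<Longrightarrow> Cod A j = Unit A \<Longrightarrow> kills j D \<longleftrightarrow> zero_arrow A (c \<cdot> j)"
    using prime_twist[OF assms(1)] by blast
  obtain N d where N: "invertible_object A N" and d: "is_epi A d" "Dom A d = Unit A" "Cod A d = E \<boxtimes> N"
    "\<And>j. j \<in> Arr A \<Longrightarrow> Cod A j = Unit A \<Longrightarrow> kills j E \<longleftrightarrow> zero_arrow A (d \<cdot> j)"
    using prime_twist[OF assms(2)] by blast
  have ca: "c \<in> Arr A" "d \<in> Arr A" using c d by auto
  obtain k where k: "is_kernel A c k" using kernel_exists[OF ca(1)] by blast
  obtain k' where k': "is_kernel A d k'" using kernel_exists[OF ca(2)] by blast
  note kD = kernelD[OF k] and kD' = kernelD[OF k']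
  have 1: "zero_arrow A (d \<cdot> k)" using c(4)[of k] d(4)[of k] assms(3)[of k] kD c(2) by simp
  have 2: "zero_arrow A (c \<cdot> k')" using c(4)[of k'] d(4)[of k'] assms(3)[of k'] kD' d(2) by simp
  obtain v where v: "v \<in> Arr A" "Cod A v = Cod A d" "Dom A v = Cod A c" "v \<cdot> c = d"
    using cokernel_desc[OF epi_cokernel_of_kernel[OF c(1) k], of d] 1 kD c(2) d(2) ca by auto
  obtain w where w: "w \<in> Arr A" "Cod A w = Cod A c" "Dom A w = Cod A d" "w \<cdot> d = c"
    using cokernel_desc[OF epi_cokernel_of_kernel[OF d(1) k'], of c] 2 kD' c(2) d(2) ca by auto
  have "(w \<cdot> v) \<cdot> c = Idn A (Cod A c) \<cdot> c" using v w ca c(2) d(2) by simp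
  then have i1: "w \<cdot> v = Idn A (Cod A c)" by (rule epiD[OF c(1)]) (use v w ca in auto)
  have "(v \<cdot> w) \<cdot> d = Idn A (Cod A d) \<cdot> d" using v w ca c(2) d(2) by simp
  then have i2: "v \<cdot> w = Idn A (Cod A d)" by (rule epiD[OF d(1)]) (use v w ca in auto)
  have "is_iso A v" by (rule isoI[of v w]) (use v w i1 i2 in auto)
  then have "isomorphic A (D \<boxtimes> M) (E \<boxtimes> N)" using isomorphicI[of v] v c d by simp
  then show ?thesis using M N by blast
qed

end

text \<open>\<open>unit_noetherian\<close> stands in for finite presentation of the unit; the
  universe is used in deriving it, in the last section.\<close>

locale invertibly_generated = closed_monoidal_abelian A
  for A :: "('o, 'm) smcat" (structure) +
  fixes G :: "'o set"
  assumes generating: "generating A G"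
    and filtered: "\<And>M. M \<in> G \<Longrightarrow> invertible_filtered A M"
    and unit_noetherian: "noetherian_object A (Unit A)"
begin

text \<open>Some generator has a nonzero arrow \<open>h\<close> to \<open>X\<close>. Along its
  filtration there is a step at which the restriction of \<open>h\<close> changes from zero to
  nonzero; there it factors through the invertible quotient.\<close>

lemma nonzero_from_invertible:
  assumes "X \<in> Obj A" "\<not> is_zero A X"
  shows "\<exists>f \<in> Arr A. Cod A f = X \<and> invertible_object A (Dom A f) \<and> \<not> zero_arrow A f"
proof -
  obtain n where n: "zero_arrow A n" "Dom A n = X" "Cod A n = X" using zero_arrow_exists[OF assms(1,1)] by blast
  have "Idn A X \<noteq> n" using n(1) assms zero_iff_idn by auto
  moreover have "Idn A X \<in> Hom A X X" "n \<in> Hom A X X" using n assms by auto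
  ultimately obtain S h where h: "S \<in> G" "h \<in> Arr A" "Dom A h = S" "Cod A h = X" "Idn A X \<cdot> h \<noteq> n \<cdot> h"
    using generating unfolding generating_def by (metis in_Hom)
  have hz: "\<not> zero_arrow A h"
  proof
    assume z: "zero_arrow A h"
    have "Idn A X \<cdot> h = n \<cdot> h" by (rule zero_arrow_unique) (use z n h(2-4) assms(1) in auto)
    then show False using h by simp
  qed
  obtain N :: nat and s where s: "\<And>i. i \<le> N \<Longrightarrow> is_mono A (s i) \<and> Cod A (s i) = S" "is_zero A (Dom A (s 0))" "is_iso A (s N)"
    "\<And>i. i < N \<Longrightarrow> \<exists>h \<in> Hom A (Dom A (s i)) (Dom A (s (Suc i))). s i = s (Suc i) \<cdot> h \<and>
        (\<exists>q. is_cokernel A h q \<and> invertible_object A (Cod A q))"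
    using filtered[OF h(1)] unfolding invertible_filtered_def by (metis (no_types, lifting))
  have sa: "s i \<in> Arr A" "Cod A (s i) = S" if "i \<le> N" for i using s(1)[OF that] by auto
  have "zero_arrow A (s 0)" by (rule zero_arrowI[OF s(2)]) (use sa in auto)
  then have z0: "zero_arrow A (h \<cdot> s 0)" by (rule zero_cmpL) (use sa h in auto)
  have zN: "\<not> zero_arrow A (h \<cdot> s N)"
  proof
    assume "zero_arrow A (h \<cdot> s N)"
    then have "zero_arrow A h" by (rule epi_zero[OF iso_epi[OF s(3)], rotated 2]) (use sa h in auto)
    then show False using hz by simp
  qed
  have "\<exists>i < N. zero_arrow A (h \<cdot> s i) \<and> \<not> zero_arrow A (h \<cdot> s (Suc i))"
  proof (rule ccontr)
    assume a: "\<not> ?thesis"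
    have "i \<le> N \<longrightarrow> zero_arrow A (h \<cdot> s i)" for i
    proof (induction i)
      case (Suc i)
      then show ?case using a by (metis Suc_le_lessD less_imp_le)
    qed (use z0 in auto)
    then show False using zN by blast
  qed
  then obtain i where i: "i < N" "zero_arrow A (h \<cdot> s i)" "\<not> zero_arrow A (h \<cdot> s (Suc i))" by blast
  obtain k q where k: "k \<in> Arr A" "Dom A k = Dom A (s i)" "Cod A k = Dom A (s (Suc i))" "s (Suc i) \<cdot> k = s i"
    "is_cokernel A k q" "invertible_object A (Cod A q)" using s(4)[OF i(1)] by (metis in_Hom)
  have si: "s (Suc i) \<in> Arr A" "Cod A (s (Suc i)) = S" using sa[of "Suc i"] i by auto
  have "zero_arrow A ((h \<cdot> s (Suc i)) \<cdot> k)" using i(2) si k(1-4) h by simp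
  then obtain v where v: "v \<in> Arr A" "Cod A v = X" "Dom A v = Cod A q" "v \<cdot> q = h \<cdot> s (Suc i)"
    using cokernel_desc[OF k(5), of "h \<cdot> s (Suc i)"] si k(1-3) h by auto
  have "\<not> zero_arrow A v"
  proof
    assume "zero_arrow A v"
    then have "zero_arrow A (v \<cdot> q)" by (rule zero_cmpR) (use v cokernelD[OF k(5)] in auto)
    then show False using v i by simp
  qed
  then show ?thesis using v k by (intro bexI[of _ v]) auto
qed

lemma invertible_quotient_sub:
  assumes "X \<in> Obj A" "\<not> is_zero A X"
  shows "\<exists>m e. is_mono A m \<and> Cod A m = X \<and> \<not> is_zero A (Dom A m) \<and> is_epi A e \<and> invertible_object A (Dom A e) \<and> Cod A e = Dom A m"
proof -
  obtain f where f: "f \<in> Arr A" "Cod A f = X" "invertible_object A (Dom A f)" "\<not> zero_arrow A f"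
    using nonzero_from_invertible[OF assms] by blast
  obtain e m where em: "is_epi A e" "is_mono A m" "Dom A m = Cod A e" "Dom A e = Dom A f" "Cod A m = Cod A f" "m \<cdot> e = f"
    using image[OF f(1)] by metis
  have "\<not> is_zero A (Dom A m)"
  proof
    assume z: "is_zero A (Dom A m)"
    have "zero_arrow A m" by (rule zero_arrowI[OF z]) (use em in auto)
    then have "zero_arrow A (m \<cdot> e)" by (rule zero_cmpR) (use em in auto)
    then show False using em f by simp
  qed
  then show ?thesis using em f by metis
qed

text \<open>As for associated primes of modules: an ideal maximal among the annihilators of nonzero
  subobjects of \<open>X\<close> is shared by all nonzero subobjects of the one realizing it.
  Passing to the smaller \<open>i\<close> secures a quotient of an invertible object.\<close>

lemma prime_sub_exists:
  assumes "X \<in> Obj A" "\<not> is_zero A X"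
  shows "\<exists>m. is_mono A m \<and> Cod A m = X \<and> prime_object (Dom A m)"
proof -
  define P where "P a \<longleftrightarrow> (\<exists>m. is_mono A m \<and> Cod A m = X \<and> \<not> is_zero A (Dom A m) \<and> annihilator (Dom A m) a)" for a
  have PI: "P a \<Longrightarrow> is_mono A a \<and> Cod A a = Unit A" for a unfolding P_def annihilator_def by blast
  obtain a0 where "annihilator X a0" using annihilator_exists[OF assms(1)] by blast
  then have "P a0" unfolding P_def
    by (intro exI[of _ "Idn A X"]) (use assms iso_mono[OF isoI[of "Idn A X" "Idn A X"]] in auto)
  then obtain a where a: "P a" "\<And>b. P b \<Longrightarrow> subobject_le A a b \<Longrightarrow> subobject_le A b a"
    using noetherian_maximal[OF unit_noetherian, of P a0] PI by blast
  obtain m where m: "is_mono A m" "Cod A m = X" "\<not> is_zero A (Dom A m)" "annihilator (Dom A m) a" using a(1) unfolding P_def by blast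
  have ma: "m \<in> Arr A" using m by simp
  then have mo: "Dom A m \<in> Obj A" by simp
  obtain i e where i: "is_mono A i" "Cod A i = Dom A m" "\<not> is_zero A (Dom A i)" "is_epi A e" "invertible_object A (Dom A e)" "Cod A e = Dom A i"
    using invertible_quotient_sub[OF mo m(3)] by blast
  have ia: "i \<in> Arr A" using i by simp
  let ?D = "Dom A i"
  have aD: "is_mono A a" "Cod A a = Unit A" "kills a (Dom A m)" using m(4) unfolding annihilator_def by auto
  have aa: "a \<in> Arr A" using aD by simp
  \<comment> \<open>\<open>a\<close> kills the smaller object, so it is contained in
    \<open>b\<close>; maximality of \<open>a\<close> in \<open>P\<close> gives the reverse.\<close>
  have small: "subobject_le A b a" if n: "is_mono A n" "Cod A n = ?D" "\<not> is_zero A (Dom A n)" and b: "annihilator (Dom A n) b" for n b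
  proof (rule a(2))
    have na: "n \<in> Arr A" using n by simp
    have m1: "is_mono A (i \<cdot> n)" by (rule mono_cmp) (use n i in auto)
    have d1: "Dom A (i \<cdot> n) = Dom A n" "Cod A (i \<cdot> n) = Dom A m" using n na ia i by auto
    have m2: "is_mono A (m \<cdot> (i \<cdot> n))" by (rule mono_cmp[OF m1 m(1)]) (use d1 in auto)
    have d2: "Dom A (m \<cdot> (i \<cdot> n)) = Dom A n" "Cod A (m \<cdot> (i \<cdot> n)) = X" using d1 m ma mono_arr[OF m1] by auto
    show "P b" unfolding P_def by (rule exI[of _ "m \<cdot> (i \<cdot> n)"]) (use m2 d2 n b in auto)
    have "kills a (Dom A n)" using kills_sub[OF _ m1 aa aD(2)] aD(3) d1 by simp
    then show "subobject_le A a b" using b aa aD(2) unfolding annihilator_def by blast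
  qed
  have "prime_object ?D" unfolding prime_object_def
  proof (intro conjI allI impI)
    show "\<exists>e. is_epi A e \<and> invertible_object A (Dom A e) \<and> Cod A e = ?D" using i by blast
    fix n j
    assume "is_mono A n \<and> Cod A n = ?D \<and> \<not> is_zero A (Dom A n) \<and> j \<in> Arr A \<and> Cod A j = Unit A \<and> kills j (Dom A n)"
    then have n: "is_mono A n" "Cod A n = ?D" "\<not> is_zero A (Dom A n)" and j: "j \<in> Arr A" "Cod A j = Unit A" "kills j (Dom A n)" by auto
    obtain b where b: "annihilator (Dom A n) b" using annihilator_exists[of "Dom A n"] n(1) by auto
    have "subobject_le A j b" using b j unfolding annihilator_def by blast
    then have "subobject_le A j a" using subobject_le_trans small[OF n b] aa by blast
    then have "kills j (Dom A m)" using annihilator_le_kills[OF m(4) j(1,2)] mo by blast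
    then show "kills j ?D" using kills_sub[OF _ i(1) j(1,2)] i(2) by simp
  qed (use i ia in auto)
  moreover have "is_mono A (m \<cdot> i)" by (rule mono_cmp) (use m i in auto)
  moreover have "Dom A (m \<cdot> i) = ?D" "Cod A (m \<cdot> i) = X" using m i ma ia by auto
  ultimately show ?thesis by metis
qed

lemma noetherian_invertible:
  assumes "invertible_object A L" shows "noetherian_object A L"
proof -
  obtain M where M: "inverses L M" using assms invertible_iff by blast
  have "isomorphic A (Unit A \<boxtimes> L) L" using isomorphicI[OF lunit_simps(1)] lunit_simps inverses_obj[OF M] by metis
  then show ?thesis using noetherian_isomorphic[OF noetherian_tensor[OF M unit_noetherian]] by blast
qed

lemma noetherian_prime: "prime_object D \<Longrightarrow> noetherian_object A D"
  using prime_objectD(3) noetherian_quot noetherian_invertible by metis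

end

section \<open>Atoms and their Picard orbits\<close>

context abelian_category
begin

lemma common_nonzero_subobjectI:
  "is_mono C m \<Longrightarrow> is_mono C n \<Longrightarrow> Dom C m = Dom C n \<Longrightarrow> \<not> is_zero C (Dom C m) \<Longrightarrow>
    common_nonzero_subobject C (Cod C m) (Cod C n)"
  unfolding common_nonzero_subobject_def by blast

lemma common_nonzero_subobjectE:
  assumes "common_nonzero_subobject C a b"
  obtains m n where "is_mono C m" "is_mono C n" "Dom C m = Dom C n" "\<not> is_zero C (Dom C m)" "Cod C m = a" "Cod C n = b"
  using assms unfolding common_nonzero_subobject_def by blast

lemma common_nonzero_subobject_sym: "common_nonzero_subobject C a b \<Longrightarrow> common_nonzero_subobject C b a"
  unfolding common_nonzero_subobject_def by metis

lemma common_of_mono: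
  assumes "is_mono C m" "\<not> is_zero C (Dom C m)"
  shows "common_nonzero_subobject C (Dom C m) (Cod C m)"
proof -
  have "Dom C m \<in> Obj C" using assms by simp
  then show ?thesis
    using common_nonzero_subobjectI[of "Idn C (Dom C m)" m] iso_mono[OF idn_iso] assms by simp
qed

lemma common_nonzero_subobject_mono:
  assumes "common_nonzero_subobject C a (Dom C m)" "is_mono C m"
  shows "common_nonzero_subobject C a (Cod C m)"
proof -
  obtain s t where st: "is_mono C s" "is_mono C t" "Dom C s = Dom C t" "\<not> is_zero C (Dom C s)" "Cod C s = a" "Cod C t = Dom C m"
    using common_nonzero_subobjectE[OF assms(1)] by metis
  have "is_mono C (m \<cdot> t)" by (rule mono_cmp[OF st(2) assms(2)]) (use st in simp)
  then show ?thesis using common_nonzero_subobjectI[of s "m \<cdot> t"] st assms by simp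
qed

lemma monoformD:
  assumes "monoform C H"
  shows "H \<in> Obj C" "\<not> is_zero C H"
    "\<And>m q. is_mono C m \<Longrightarrow> Cod C m = H \<Longrightarrow> \<not> is_zero C (Dom C m) \<Longrightarrow> is_cokernel C m q \<Longrightarrow>
        \<not> common_nonzero_subobject C H (Cod C q)"
  using assms unfolding monoform_def by blast+

text \<open>The quotient of \<open>Dom C m\<close> by \<open>n\<close> embeds in the quotient of
  \<open>Cod C m\<close> by \<open>m \<cdot> n\<close>, so a forbidden common subobject would
  already be one for \<open>Cod C m\<close>.\<close>

lemma monoform_sub:
  assumes "monoform C (Cod C m)" "is_mono C m" "\<not> is_zero C (Dom C m)"
  shows "monoform C (Dom C m)"
  unfolding monoform_def
proof (intro conjI allI impI notI)
  have ma: "m \<in> Arr C" using assms by simp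
  fix n q assume h: "is_mono C n \<and> Cod C n = Dom C m \<and> \<not> is_zero C (Dom C n) \<and> is_cokernel C n q"
    and c: "common_nonzero_subobject C (Dom C m) (Cod C q)"
  have n: "is_mono C n" "Cod C n = Dom C m" "\<not> is_zero C (Dom C n)" and q: "is_cokernel C n q" using h by auto
  have na: "n \<in> Arr C" using n by simp
  have mn: "is_mono C (m \<cdot> n)" by (rule mono_cmp[OF n(1) assms(2)]) (use n in simp)
  have mnD: "m \<cdot> n \<in> Arr C" "Dom C (m \<cdot> n) = Dom C n" "Cod C (m \<cdot> n) = Cod C m" using ma na n by auto
  obtain r where r: "is_cokernel C (m \<cdot> n) r" using cokernel_exists[OF mnD(1)] by blast
  note rD = cokernelD[OF r]
  have rm: "r \<cdot> m \<in> Arr C" "Dom C (r \<cdot> m) = Dom C m" "Cod C (r \<cdot> m) = Cod C r" using rD mnD ma by auto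
  have "is_kernel C (r \<cdot> m) n"
  proof (rule kernelI[OF rm(1) n(1)])
    show "Cod C n = Dom C (r \<cdot> m)" using n rm by simp
    show "zero_arrow C ((r \<cdot> m) \<cdot> n)" using rD mnD ma na n by simp
    fix g assume g: "g \<in> Arr C" "Cod C g = Dom C (r \<cdot> m)" "zero_arrow C ((r \<cdot> m) \<cdot> g)"
    have "zero_arrow C (r \<cdot> (m \<cdot> g))" using g rD mnD ma rm by simp
    then obtain u where u: "u \<in> Arr C" "Dom C u = Dom C (m \<cdot> g)" "Cod C u = Dom C (m \<cdot> n)" "(m \<cdot> n) \<cdot> u = m \<cdot> g"
      using kernel_lift[OF mono_kernel_of_cokernel[OF mn r], of "m \<cdot> g"] g(1,2) rD mnD ma rm by auto
    have ud: "Dom C u = Dom C g" "Cod C u = Dom C n" using u g(1,2) mnD ma rm by auto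
    have "m \<cdot> n \<cdot> u = m \<cdot> g" using u(1,4) ud ma na n by simp
    then have "n \<cdot> u = g" by (rule monoD[OF assms(2)]) (use u(1) ud na n g(1,2) rm in auto)
    then show "\<exists>u\<in>Arr C. Dom C u = Dom C g \<and> Cod C u = Dom C n \<and> n \<cdot> u = g" using u(1) ud by blast
  qed
  then obtain v where v: "is_mono C v" "Dom C v = Cod C q" "Cod C v = Cod C (r \<cdot> m)"
    using first_isomorphism[OF _ q] by blast
  have "common_nonzero_subobject C (Dom C m) (Cod C v)" using common_nonzero_subobject_mono[of "Dom C m" v] c v by simp
  from common_nonzero_subobject_mono[OF common_nonzero_subobject_sym[OF this] assms(2)]
  have "common_nonzero_subobject C (Cod C m) (Cod C r)" using common_nonzero_subobject_sym v rm by metis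
  then show False using monoformD(3)[OF assms(1) mn mnD(3) _ r] mnD n by simp
qed (use assms in auto)

text \<open>If the intersection \<open>k\<close> were zero, \<open>n\<close> would embed in the
  quotient of \<open>H\<close> by \<open>m\<close>, giving a common nonzero subobject of
  \<open>H\<close> and that quotient.\<close>

lemma monoform_uniform:
  assumes "monoform C H" "is_mono C m" "Cod C m = H" "\<not> is_zero C (Dom C m)" "is_mono C n" "Cod C n = H" "\<not> is_zero C (Dom C n)"
  shows "common_nonzero_subobject C (Dom C m) (Dom C n)"
proof -
  have a: "m \<in> Arr C" "n \<in> Arr C" using assms by auto
  obtain k t where k: "is_mono C k" "t \<in> Arr C" "Cod C k = Dom C n" "Dom C t = Dom C k" "Cod C t = Dom C m" "n \<cdot> k = m \<cdot> t"
    "is_epi C n \<Longrightarrow> is_epi C t" "is_mono C n \<Longrightarrow> is_mono C t"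
    "\<And>x y. x \<in> Arr C \<Longrightarrow> y \<in> Arr C \<Longrightarrow> Cod C x = Dom C n \<Longrightarrow> Cod C y = Dom C m \<Longrightarrow> Dom C x = Dom C y \<Longrightarrow> n \<cdot> x = m \<cdot> y \<Longrightarrow>
         \<exists>w \<in> Arr C. Dom C w = Dom C x \<and> Cod C w = Dom C k \<and> k \<cdot> w = x"
    by (rule preimageE[OF a(2) assms(2)]) (use assms(3,6) in simp, rule that)
  have "\<not> is_zero C (Dom C k)"
  proof
    assume z: "is_zero C (Dom C k)"
    obtain q where q: "is_cokernel C m q" using cokernel_exists[OF a(1)] by blast
    note qD = cokernelD[OF q]
    have "is_mono C (q \<cdot> n)"
    proof (rule mono0I)
      fix g assume g: "g \<in> Arr C" "Cod C g = Dom C (q \<cdot> n)" "zero_arrow C ((q \<cdot> n) \<cdot> g)"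
      have gn: "Cod C g = Dom C n" using g a qD assms by simp
      have "zero_arrow C (q \<cdot> (n \<cdot> g))" using g(1,3) gn a qD assms by simp
      then obtain y where y: "y \<in> Arr C" "Dom C y = Dom C (n \<cdot> g)" "Cod C y = Dom C m" "m \<cdot> y = n \<cdot> g"
        using kernel_lift[OF mono_kernel_of_cokernel[OF assms(2) q], of "n \<cdot> g"] g(1) gn a qD assms by auto
      obtain w where w: "w \<in> Arr C" "Dom C w = Dom C g" "Cod C w = Dom C k" "k \<cdot> w = g"
        using k(9)[OF g(1) y(1) gn y(3) _ y(4)[symmetric]] y(2) g(1) gn a by auto
      have "zero_arrow C w" by (rule zero_arrowI[OF z]) (use w in auto)
      then have "zero_arrow C (k \<cdot> w)" by (rule zero_cmpL) (use w mono_arr[OF k(1)] in auto)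
      then show "zero_arrow C g" unfolding w(4) .
    qed (use a qD assms in auto)
    from common_nonzero_subobjectI[OF assms(5) this] have "common_nonzero_subobject C H (Cod C q)"
      using a qD assms by simp
    then show False using monoformD(3)[OF assms(1-4) q] by blast
  qed
  then show ?thesis using common_nonzero_subobjectI[OF k(8)[OF assms(5)] k(1)] k(3-5) by simp
qed

text \<open>The two given subobjects of \<open>b\<close> share a nonzero subobject because
  \<open>b\<close> is monoform, and it embeds in both \<open>a\<close> and \<open>c\<close>.\<close>

lemma common_nonzero_subobject_trans:
  assumes "common_nonzero_subobject C a b" "common_nonzero_subobject C b c" "monoform C b"
  shows "common_nonzero_subobject C a c"
proof -
  obtain s t where st: "is_mono C s" "is_mono C t" "Dom C s = Dom C t" "\<not> is_zero C (Dom C s)" "Cod C s = a" "Cod C t = b"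
    using common_nonzero_subobjectE[OF assms(1)] by metis
  obtain u v where uv: "is_mono C u" "is_mono C v" "Dom C u = Dom C v" "\<not> is_zero C (Dom C u)" "Cod C u = b" "Cod C v = c"
    using common_nonzero_subobjectE[OF assms(2)] by metis
  have "common_nonzero_subobject C (Dom C s) (Dom C v)"
    using monoform_uniform[OF assms(3) st(2,6) _ uv(1,5,4)] st uv by simp
  from common_nonzero_subobject_mono[OF this uv(2)] have "common_nonzero_subobject C (Cod C v) (Dom C s)"
    by (rule common_nonzero_subobject_sym)
  from common_nonzero_subobject_mono[OF this st(1)] show ?thesis using st uv common_nonzero_subobject_sym by metis
qed

lemma common_nonzero_subobject_refl: "H \<in> Obj C \<Longrightarrow> \<not> is_zero C H \<Longrightarrow> common_nonzero_subobject C H H"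
  using common_of_mono[of "Idn C H"] iso_mono[OF idn_iso] by simp

lemma atom_eq_iff:
  assumes "monoform C H" "monoform C H'"
  shows "atom C H = atom C H' \<longleftrightarrow> common_nonzero_subobject C H H'"
proof
  assume "atom C H = atom C H'"
  moreover have "H' \<in> atom C H'" unfolding atom_def atom_rel_def
    using assms common_nonzero_subobject_refl monoformD[OF assms(2)] by simp
  ultimately show "common_nonzero_subobject C H H'" unfolding atom_def atom_rel_def by auto
next
  assume c: "common_nonzero_subobject C H H'"
  have "common_nonzero_subobject C H K \<longleftrightarrow> common_nonzero_subobject C H' K" for K
    using c assms common_nonzero_subobject_trans common_nonzero_subobject_sym by metis
  then show "atom C H = atom C H'" unfolding atom_def atom_rel_def using assms by auto
qed

lemma mem_atom: "K \<in> atom C H \<longleftrightarrow> monoform C H \<and> monoform C K \<and> common_nonzero_subobject C H K"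
  unfolding atom_def atom_rel_def by auto

lemma atom_sub:
  assumes "monoform C (Cod C m)" "is_mono C m" "\<not> is_zero C (Dom C m)"
  shows "atom C (Dom C m) = atom C (Cod C m)"
  using atom_eq_iff[OF monoform_sub[OF assms] assms(1)] common_of_mono[OF assms(2,3)] by simp

lemma monoform_isomorphic:
  assumes "monoform C a" "isomorphic C a b"
  shows "monoform C b" "atom C a = atom C b"
proof -
  obtain f where f: "is_iso C f" "Dom C f = b" "Cod C f = a" using isomorphicD[OF isomorphic_sym[OF assms(2)]] by auto
  have z: "\<not> is_zero C b" using zero_isomorphic isomorphic_sym assms monoformD(2) by metis
  show "monoform C b" "atom C a = atom C b"
    using monoform_sub[OF _ iso_mono[OF f(1)]] atom_sub[OF _ iso_mono[OF f(1)]] f z assms by simp_all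
qed

section \<open>Associated atoms and supports\<close>

lemma Spec_iff: "x \<in> Spec C \<longleftrightarrow> (\<exists>H. monoform C H \<and> x = atom C H)"
  unfolding Spec_def quotient_def atom_def by auto

lemma AssI: "monoform C (Dom C m) \<Longrightarrow> is_mono C m \<Longrightarrow> atom C (Dom C m) \<in> Ass C (Cod C m)"
  unfolding Ass_def by blast

lemma AssE:
  assumes "x \<in> Ass C M"
  obtains m where "is_mono C m" "Cod C m = M" "monoform C (Dom C m)" "x = atom C (Dom C m)"
  using assms unfolding Ass_def by blast

lemma Ass_mono:
  assumes "is_mono C n" shows "Ass C (Dom C n) \<subseteq> Ass C (Cod C n)"
proof
  fix x assume "x \<in> Ass C (Dom C n)"
  then obtain m where m: "is_mono C m" "Cod C m = Dom C n" "monoform C (Dom C m)" "x = atom C (Dom C m)" by (rule AssE)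
  have "is_mono C (n \<cdot> m)" by (rule mono_cmp[OF m(1) assms]) (use m in simp)
  then show "x \<in> Ass C (Cod C n)" using AssI[of "n \<cdot> m"] m assms by simp
qed

lemma Ass_zero: "is_zero C z \<Longrightarrow> Ass C z = {}"
proof (rule equals0I)
  fix x assume z: "is_zero C z" and "x \<in> Ass C z"
  then obtain m where m: "is_mono C m" "Cod C m = z" "monoform C (Dom C m)" using AssE by metis
  have "zero_arrow C (m \<cdot> Idn C (Dom C m))" using zero_arrowI[OF z, of m] m by simp
  then have "zero_arrow C (Idn C (Dom C m))" by (rule mono_zero[OF m(1), rotated 2]) (use m in auto)
  then show False using zero_iff_idn monoformD[OF m(3)] by blast
qed

text \<open>A monoform subobject \<open>m\<close> of the middle term either meets \<open>f\<close>,
  and the intersection has the same atom, or meets it in zero, and then \<open>g\<close> is monic on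
  \<open>m\<close>.\<close>

lemma Ass_ext:
  assumes "is_kernel C g f"
  shows "Ass C (Cod C f) \<subseteq> Ass C (Dom C f) \<union> Ass C (Cod C g)"
proof
  note fD = kernelD[OF assms] and fm = kernel_mono[OF assms]
  fix x assume "x \<in> Ass C (Cod C f)"
  then obtain m where m: "is_mono C m" "Cod C m = Cod C f" "monoform C (Dom C m)" "x = atom C (Dom C m)" by (rule AssE)
  have ma: "m \<in> Arr C" using m by simp
  obtain k t where k: "is_mono C k" "t \<in> Arr C" "Cod C k = Dom C f" "Dom C t = Dom C k" "Cod C t = Dom C m" "f \<cdot> k = m \<cdot> t"
    "is_epi C f \<Longrightarrow> is_epi C t" "is_mono C f \<Longrightarrow> is_mono C t"
    "\<And>x y. x \<in> Arr C \<Longrightarrow> y \<in> Arr C \<Longrightarrow> Cod C x = Dom C f \<Longrightarrow> Cod C y = Dom C m \<Longrightarrow> Dom C x = Dom C y \<Longrightarrow> f \<cdot> x = m \<cdot> y \<Longrightarrow>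
         \<exists>w \<in> Arr C. Dom C w = Dom C x \<and> Cod C w = Dom C k \<and> k \<cdot> w = x"
    by (rule preimageE[OF fD(2) m(1,2)]) (rule that)
  show "x \<in> Ass C (Dom C f) \<union> Ass C (Cod C g)"
  proof (cases "is_zero C (Dom C k)")
    case False
    then have "monoform C (Dom C t)" "atom C (Dom C t) = x" using monoform_sub[of t] atom_sub[of t] k(4,5) k(8)[OF fm] m by simp_all
    then show ?thesis using AssI[of k] k(1,3,4) by simp
  next
    case True
    have "is_mono C (g \<cdot> m)"
    proof (rule mono0I)
      fix y assume y: "y \<in> Arr C" "Cod C y = Dom C (g \<cdot> m)" "zero_arrow C ((g \<cdot> m) \<cdot> y)"
      have ym: "Cod C y = Dom C m" using y ma fD m by simp
      have "zero_arrow C (g \<cdot> (m \<cdot> y))" using y(1,3) ym ma fD m by simp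
      then obtain v where v: "v \<in> Arr C" "Dom C v = Dom C (m \<cdot> y)" "Cod C v = Dom C f" "f \<cdot> v = m \<cdot> y"
        using kernel_lift[OF assms, of "m \<cdot> y"] y(1) ym ma fD m by auto
      obtain w where w: "w \<in> Arr C" "Cod C w = Dom C k" "k \<cdot> w = v"
        using k(9)[OF v(1) y(1) v(3) ym _ v(4)] v(2) y(1) ym ma by auto
      have "zero_arrow C w" by (rule zero_arrowI[OF True]) (use w in auto)
      then have "zero_arrow C (k \<cdot> w)" by (rule zero_cmpL) (use w mono_arr[OF k(1)] in auto)
      then have "zero_arrow C (f \<cdot> v)" unfolding w(3) by (rule zero_cmpL) (use v fD in auto)
      then show "zero_arrow C y" unfolding v(4) by (rule mono_zero[OF m(1), rotated 2]) (use y(1) ym in auto)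
    qed (use ma fD m in auto)
    then show ?thesis using AssI[of "g \<cdot> m"] m ma fD by simp
  qed
qed

lemma Ass_monoform:
  assumes "monoform C H" shows "Ass C H = {atom C H}"
proof
  show "Ass C H \<subseteq> {atom C H}"
  proof
    fix x assume "x \<in> Ass C H"
    then obtain m where m: "is_mono C m" "Cod C m = H" "monoform C (Dom C m)" "x = atom C (Dom C m)" by (rule AssE)
    then show "x \<in> {atom C H}" using atom_sub[of m] assms monoformD(2)[OF m(3)] by simp
  qed
  have "H \<in> Obj C" using monoformD assms by blast
  then show "{atom C H} \<subseteq> Ass C H" using AssI[of "Idn C H"] iso_mono[OF idn_iso] assms by simp
qed

lemma SuppI:
  "monoform C (Cod C e) \<Longrightarrow> is_mono C m \<Longrightarrow> is_epi C e \<Longrightarrow> Dom C e = Dom C m \<Longrightarrow> atom C (Cod C e) \<in> Supp C (Cod C m)"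
  unfolding Supp_def by blast

lemma SuppE:
  assumes "x \<in> Supp C M"
  obtains m e where "is_mono C m" "is_epi C e" "Cod C m = M" "Dom C e = Dom C m" "monoform C (Cod C e)" "x = atom C (Cod C e)"
  using assms unfolding Supp_def by blast

lemma openin_Supp: "M \<in> Obj C \<Longrightarrow> openin (Spec_top C) (Supp C M)"
  unfolding Spec_top_def by (rule topology_generated_by_Basis) blast

end

context closed_monoidal_abelian
begin

lemma nonzero_tensor:
  assumes "inverses L M" "x \<in> Obj A" "\<not> is_zero A x" shows "\<not> is_zero A (x \<boxtimes> L)"
  using zero_isomorphic[OF zero_tensor inverses_cancel[OF assms(1,2)]] assms inverses_obj by blast

lemma common_nonzero_subobject_tensor:
  assumes "inverses L M" "common_nonzero_subobject A a b"
  shows "common_nonzero_subobject A (a \<boxtimes> L) (b \<boxtimes> L)"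
proof -
  note o = inverses_obj[OF assms(1)]
  obtain s t where st: "is_mono A s" "is_mono A t" "Dom A s = Dom A t" "\<not> is_zero A (Dom A s)" "Cod A s = a" "Cod A t = b"
    using common_nonzero_subobjectE[OF assms(2)] by metis
  have a: "s \<in> Arr A" "t \<in> Arr A" using st by auto
  show ?thesis using common_nonzero_subobjectI[OF rt_mono[OF assms(1) st(1)] rt_mono[OF assms(1) st(2)]]
    nonzero_tensor[OF assms(1), of "Dom A s"] st a o by simp
qed

text \<open>Twisting back by \<open>M\<close> returns an isomorphic copy of \<open>H\<close> and,
  preserving monomorphisms and cokernels, carries a violation of monoformity of
  \<open>H \<boxtimes> L\<close> to one for this copy.\<close>

lemma monoform_tensor:
  assumes "inverses L M" "monoform A H" shows "monoform A (H \<boxtimes> L)"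
  unfolding monoform_def
proof (intro conjI allI impI notI)
  note o = inverses_obj[OF assms(1)] and H = monoformD[OF assms(2)]
  show "H \<boxtimes> L \<in> Obj A" using H o by simp
  assume "is_zero A (H \<boxtimes> L)"
  then show False using nonzero_tensor[OF assms(1) H(1,2)] by blast
next
  note o = inverses_obj[OF assms(1)] and H = monoformD[OF assms(2)] and i = inverses_sym[OF assms(1)]
  fix m q assume h: "is_mono A m \<and> Cod A m = H \<boxtimes> L \<and> \<not> is_zero A (Dom A m) \<and> is_cokernel A m q"
    and c: "common_nonzero_subobject A (H \<boxtimes> L) (Cod A q)"
  have K: "monoform A ((H \<boxtimes> L) \<boxtimes> M)" by (rule monoform_isomorphic(1)[OF assms(2) isomorphic_sym[OF inverses_cancel[OF assms(1) H(1)]]])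
  have m: "m \<in> Arr A" using h by simp
  have q: "q \<in> Arr A" using cokernelD(2) h by blast
  have "\<not> common_nonzero_subobject A ((H \<boxtimes> L) \<boxtimes> M) (Cod A (q \<odot> M))"
    by (rule monoformD(3)[OF K, of "m \<odot> M"]) (use rt_mono[OF i, of m] rt_cokernel[of m q M] nonzero_tensor[OF i, of "Dom A m"] h m o in auto)
  then show False using common_nonzero_subobject_tensor[OF i c] q o by simp
qed

lemma common_tensor_move:
  assumes "inverses L M" "monoform A H" "monoform A K" "common_nonzero_subobject A H (K \<boxtimes> L)"
  shows "common_nonzero_subobject A K (H \<boxtimes> M)"
proof -
  note i = inverses_sym[OF assms(1)] and K = monoformD[OF assms(3)]
  have iso: "isomorphic A ((K \<boxtimes> L) \<boxtimes> M) K" by (rule inverses_cancel[OF assms(1) K(1)])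
  have m: "monoform A ((K \<boxtimes> L) \<boxtimes> M)" by (intro monoform_tensor[OF i] monoform_tensor[OF assms(1)] assms(3))
  have "atom A (H \<boxtimes> M) = atom A ((K \<boxtimes> L) \<boxtimes> M)"
    using atom_eq_iff[OF monoform_tensor[OF i assms(2)] m] common_nonzero_subobject_tensor[OF i assms(4)] by blast
  also have "\<dots> = atom A K" using monoform_isomorphic[OF m iso] by blast
  finally show ?thesis using atom_eq_iff[OF assms(3) monoform_tensor[OF i assms(2)]] by simp
qed

lemma Pic_act_atom:
  assumes "inverses L M" "monoform A H"
  shows "Pic_act A (iso_class A L) (atom A H) = atom A (H \<boxtimes> L)"
proof -
  note o = inverses_obj[OF assms(1)]
  have "atom A (K \<boxtimes> L') = atom A (H \<boxtimes> L)" if K: "K \<in> atom A H" and L': "L' \<in> iso_class A L" for K L'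
  proof -
    have K: "monoform A K" "common_nonzero_subobject A H K" using K mem_atom by auto
    have m: "monoform A (H \<boxtimes> L)" "monoform A (K \<boxtimes> L)" using monoform_tensor[OF assms(1)] assms(2) K by auto
    have "isomorphic A (K \<boxtimes> L) (K \<boxtimes> L')" using L' isomorphic_refl[OF monoformD(1)[OF K(1)]]
      by (intro tensor_isomorphic) (auto simp: iso_class_def)
    then have "atom A (K \<boxtimes> L) = atom A (K \<boxtimes> L')" using monoform_isomorphic m by blast
    moreover have "atom A (H \<boxtimes> L) = atom A (K \<boxtimes> L)"
      using atom_eq_iff[OF m] common_nonzero_subobject_tensor[OF assms(1) K(2)] by blast
    ultimately show ?thesis by simp
  qed
  moreover have "H \<in> atom A H" using mem_atom assms common_nonzero_subobject_refl monoformD by blast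
  moreover have "L \<in> iso_class A L" using isomorphic_refl o unfolding iso_class_def by blast
  ultimately have "(\<Union>K \<in> atom A H. \<Union>L' \<in> iso_class A L. atom A (K \<boxtimes> L')) = atom A (H \<boxtimes> L)" by blast
  moreover have "atom A H \<in> Spec A" using Spec_iff assms by blast
  ultimately show ?thesis unfolding Pic_act_def by simp
qed

lemma LSpec_proj_atom:
  assumes "monoform A H"
  shows "LSpec_proj A (atom A H) = {atom A (H \<boxtimes> L) | L. invertible_object A L}"
proof -
  have "LSpec_proj A (atom A H) = {Pic_act A (iso_class A L) (atom A H) | L. invertible_object A L}"
    unfolding LSpec_proj_def orbit_def Pic_def by auto
  moreover have "Pic_act A (iso_class A L) (atom A H) = atom A (H \<boxtimes> L)" if "invertible_object A L" for L
    using Pic_act_atom[OF _ assms] that invertible_iff by blast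
  ultimately show ?thesis by (auto) metis+
qed

abbreviation orbit_class :: "'o \<Rightarrow> 'o set set" where
  "orbit_class H \<equiv> LSpec_proj A (atom A H)"

text \<open>Re-bracketing \<open>(K \<boxtimes> L) \<boxtimes> N\<close> puts the translate of
  \<open>H\<close> by \<open>N\<close> into the orbit of \<open>K\<close>. The other inclusion is
  the same argument with the twist moved across by \<open>common_tensor_move\<close>.\<close>

lemma orbit_class_eqI:
  assumes "monoform A H" "monoform A K" "inverses L M" "common_nonzero_subobject A H (K \<boxtimes> L)"
  shows "orbit_class H = orbit_class K"
proof -
  have sub: "orbit_class H \<subseteq> orbit_class K"
    if h: "monoform A H" "monoform A K" "inverses L M" "common_nonzero_subobject A H (K \<boxtimes> L)" for H K L M
  proof
    fix x assume "x \<in> orbit_class H"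
    then obtain N where N: "invertible_object A N" "x = atom A (H \<boxtimes> N)" using LSpec_proj_atom[OF h(1)] by blast
    obtain N' where N': "inverses N N'" using N invertible_iff by blast
    note o = inverses_obj[OF N'] inverses_obj[OF h(3)] monoformD(1)[OF h(2)]
    have m: "monoform A (H \<boxtimes> N)" "monoform A ((K \<boxtimes> L) \<boxtimes> N)" using monoform_tensor[OF N'] monoform_tensor[OF h(3)] h by auto
    have "x = atom A ((K \<boxtimes> L) \<boxtimes> N)" unfolding N(2) using atom_eq_iff[OF m] common_nonzero_subobject_tensor[OF N' h(4)] by blast
    also have "\<dots> = atom A (K \<boxtimes> L \<boxtimes> N)" by (rule monoform_isomorphic(2)[OF m(2)]) (use assoc_isomorphic o in blast)
    finally show "x \<in> orbit_class K"
      using LSpec_proj_atom[OF h(2)] inverses_tensor[OF h(3) N'] invertible_iff by blast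
  qed
  show ?thesis using sub[OF assms] sub[OF assms(2,1) inverses_sym[OF assms(3)]] common_tensor_move[OF assms(3,1,2,4)] by blast
qed

text \<open>An orbit consists of translates by definition; that the atom of \<open>H\<close> occurs
  in its own orbit comes from the twist by the unit.\<close>

lemma orbit_class_eqD:
  assumes "monoform A H" "monoform A K" "orbit_class H = orbit_class K"
  shows "\<exists>L M. inverses L M \<and> common_nonzero_subobject A H (K \<boxtimes> L)"
proof -
  have u: "monoform A (H \<boxtimes> Unit A)" "atom A H = atom A (H \<boxtimes> Unit A)"
    using monoform_isomorphic[OF assms(1) isomorphic_sym[OF unit_isomorphic]] monoformD(1)[OF assms(1)] by blast+
  have "invertible_object A (Unit A)" using inverses_unit invertible_iff by blast
  then have "atom A H \<in> orbit_class H" using LSpec_proj_atom[OF assms(1)] u(2) by blast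
  then have "atom A H \<in> orbit_class K" using assms(3) by simp
  then obtain L where L: "invertible_object A L" "atom A H = atom A (K \<boxtimes> L)" using LSpec_proj_atom[OF assms(2)] by blast
  then obtain M where "inverses L M" using invertible_iff by blast
  then show ?thesis using L atom_eq_iff[OF assms(1) monoform_tensor[OF _ assms(2)]] by blast
qed

lemma orbit_class_tensor:
  assumes "inverses L M" "monoform A H" shows "orbit_class (H \<boxtimes> L) = orbit_class H"
proof -
  have m: "monoform A (H \<boxtimes> L)" by (rule monoform_tensor[OF assms])
  show ?thesis by (rule orbit_class_eqI[OF m assms(2) assms(1)]) (use common_nonzero_subobject_refl monoformD[OF m] in blast)
qed

lemma LSpec_iff: "x \<in> LSpec A \<longleftrightarrow> (\<exists>H. monoform A H \<and> x = orbit_class H)"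
proof -
  have "LSpec A = LSpec_proj A ` Spec A" unfolding LSpec_def orbits_def LSpec_proj_def by blast
  then have "x \<in> LSpec A \<longleftrightarrow> (\<exists>s \<in> Spec A. x = LSpec_proj A s)" by blast
  then show ?thesis unfolding Bex_def Spec_iff by blast
qed

lemma LAssE:
  assumes "x \<in> LAss A X"
  obtains m where "is_mono A m" "Cod A m = X" "monoform A (Dom A m)" "x = orbit_class (Dom A m)"
  using assms unfolding LAss_def by (auto elim: AssE)

lemma LAssI: "is_mono A m \<Longrightarrow> monoform A (Dom A m) \<Longrightarrow> orbit_class (Dom A m) \<in> LAss A (Cod A m)"
  unfolding LAss_def using AssI by blast

lemma LAss_subset_LSpec: "LAss A X \<subseteq> LSpec A"
  using LAssE LSpec_iff by (metis subsetI)

lemma LAss_mono: "is_mono A m \<Longrightarrow> LAss A (Dom A m) \<subseteq> LAss A (Cod A m)"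
  unfolding LAss_def using Ass_mono by blast

lemma LAss_ext: "is_kernel A g f \<Longrightarrow> LAss A (Cod A f) \<subseteq> LAss A (Dom A f) \<union> LAss A (Cod A g)"
  unfolding LAss_def using Ass_ext by blast

lemma LAss_isomorphic: "isomorphic A a b \<Longrightarrow> LAss A a \<subseteq> LAss A b"
  using LAss_mono[OF iso_mono] isomorphicD by metis

lemma LAss_monoform: "monoform A H \<Longrightarrow> LAss A H = {orbit_class H}"
  unfolding LAss_def using Ass_monoform by simp

text \<open>A monoform subobject of \<open>X \<boxtimes> L\<close> is twisted back by
  \<open>M\<close> into \<open>X\<close> without changing its orbit.\<close>

lemma LAss_tensor:
  assumes "inverses L M" "X \<in> Obj A" shows "LAss A (X \<boxtimes> L) \<subseteq> LAss A X"
proof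
  fix x assume "x \<in> LAss A (X \<boxtimes> L)"
  then obtain m where m: "is_mono A m" "Cod A m = X \<boxtimes> L" "monoform A (Dom A m)" "x = orbit_class (Dom A m)" by (rule LAssE)
  note o = inverses_obj[OF assms(1)] and i = inverses_sym[OF assms(1)]
  have ma: "m \<in> Arr A" using m by simp
  have "orbit_class (Dom A m \<boxtimes> M) \<in> LAss A ((X \<boxtimes> L) \<boxtimes> M)"
    using LAssI[OF rt_mono[OF i m(1)]] monoform_tensor[OF i m(3)] m ma o by simp
  then have "x \<in> LAss A ((X \<boxtimes> L) \<boxtimes> M)" using orbit_class_tensor[OF i m(3)] m by simp
  then show "x \<in> LAss A X" using LAss_isomorphic[OF inverses_cancel[OF assms]] by blast
qed

section \<open>Orbit supports, their openness, and the annihilators of primes\<close>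

lemma LSuppI:
  "is_mono A m \<Longrightarrow> is_epi A e \<Longrightarrow> Dom A e = Dom A m \<Longrightarrow> monoform A (Cod A e) \<Longrightarrow> orbit_class (Cod A e) \<in> LSupp A (Cod A m)"
  unfolding LSupp_def using SuppI by blast

lemma LSuppE:
  assumes "x \<in> LSupp A X"
  obtains m e where "is_mono A m" "is_epi A e" "Cod A m = X" "Dom A e = Dom A m" "monoform A (Cod A e)" "x = orbit_class (Cod A e)"
  using assms unfolding LSupp_def by (auto elim: SuppE)

lemma LAss_subset_LSupp: "LAss A X \<subseteq> LSupp A X"
proof
  fix x assume "x \<in> LAss A X"
  then obtain m where m: "is_mono A m" "Cod A m = X" "monoform A (Dom A m)" "x = orbit_class (Dom A m)" by (rule LAssE)
  have "is_epi A (Idn A (Dom A m))" using iso_epi[OF idn_iso] m by simp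
  then show "x \<in> LSupp A X" using LSuppI[of m "Idn A (Dom A m)"] m by simp
qed

text \<open>The preimage in \<open>Spec A\<close> is the union of the open sets
  \<open>Supp A (X \<boxtimes> L)\<close> over all invertible \<open>L\<close>. This openness
  converts closure points into statements about subquotients.\<close>

lemma openin_LSupp:
  assumes "X \<in> Obj A" shows "openin (LSpec_top A) (LSupp A X)"
  unfolding openin_LSpec_top
proof
  show "LSupp A X \<subseteq> LSpec A" using LSuppE LSpec_iff by (metis subsetI)
  have "{x \<in> Spec A. LSpec_proj A x \<in> LSupp A X} = (\<Union>L \<in> {L. invertible_object A L}. Supp A (X \<boxtimes> L))"
  proof (intro equalityI subsetI)
    fix x assume "x \<in> {x \<in> Spec A. LSpec_proj A x \<in> LSupp A X}"
    then have x: "x \<in> Spec A" "LSpec_proj A x \<in> LSupp A X" by auto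
    obtain H where H0: "monoform A H" "x = atom A H" using iffD1[OF Spec_iff x(1)] by blast
    then have H: "monoform A H" "x = atom A H" "orbit_class H \<in> LSupp A X" using x(2) by simp_all
    obtain m e where m: "is_mono A m" "is_epi A e" "Cod A m = X" "Dom A e = Dom A m" "monoform A (Cod A e)" "orbit_class H = orbit_class (Cod A e)"
      using LSuppE[OF H(3)] by metis
    obtain L M where L: "inverses L M" "common_nonzero_subobject A H (Cod A e \<boxtimes> L)" using orbit_class_eqD[OF H(1) m(5,6)] by blast
    note o = inverses_obj[OF L(1)]
    have a: "m \<in> Arr A" "e \<in> Arr A" using m by auto
    have k: "monoform A (Cod A e \<boxtimes> L)" by (rule monoform_tensor[OF L(1) m(5)])
    have "atom A H = atom A (Cod A e \<boxtimes> L)" using atom_eq_iff[OF H(1) k] L by blast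
    moreover have "atom A (Cod A e \<boxtimes> L) \<in> Supp A (X \<boxtimes> L)"
      using SuppI[of "e \<odot> L" "m \<odot> L"] k rt_mono[OF L(1) m(1)] rt_epi[OF m(2) o(1)] m(3,4) a o by simp
    ultimately show "x \<in> (\<Union>L \<in> {L. invertible_object A L}. Supp A (X \<boxtimes> L))" using H L invertible_iff by auto
  next
    fix x assume "x \<in> (\<Union>L \<in> {L. invertible_object A L}. Supp A (X \<boxtimes> L))"
    then obtain L M where L: "inverses L M" and x: "x \<in> Supp A (X \<boxtimes> L)" using invertible_iff by blast
    obtain m e where m: "is_mono A m" "is_epi A e" "Cod A m = X \<boxtimes> L" "Dom A e = Dom A m" "monoform A (Cod A e)" "x = atom A (Cod A e)"
      using SuppE[OF x] by metis
    note o = inverses_obj[OF L] and i = inverses_sym[OF L]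
    have a: "m \<in> Arr A" "e \<in> Arr A" using m by auto
    obtain \<theta> where \<theta>: "is_iso A \<theta>" "Dom A \<theta> = (X \<boxtimes> L) \<boxtimes> M" "Cod A \<theta> = X" using isomorphicD[OF inverses_cancel[OF L assms]] by blast
    have \<theta>a: "\<theta> \<in> Arr A" using \<theta> by simp
    have mm: "is_mono A (\<theta> \<cdot> (m \<odot> M))" by (rule mono_cmp[OF rt_mono[OF i m(1)] iso_mono[OF \<theta>(1)]]) (use a m \<theta> o in auto)
    have "orbit_class (Cod A e \<boxtimes> M) \<in> LSupp A X"
      using LSuppI[OF mm rt_epi[OF m(2) o(2)]] monoform_tensor[OF i m(5)] a m(3,4) \<theta> \<theta>a o by simp
    then show "x \<in> {x \<in> Spec A. LSpec_proj A x \<in> LSupp A X}"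
      using orbit_class_tensor[OF i m(5)] m(5,6) Spec_iff by auto
  qed
  moreover have "openin (Spec_top A) (\<Union>L \<in> {L. invertible_object A L}. Supp A (X \<boxtimes> L))"
    by (rule openin_Union) (use openin_Supp assms invertible_iff inverses_obj in auto)
  ultimately show "openin (Spec_top A) {x \<in> Spec A. LSpec_proj A x \<in> LSupp A X}" by simp
qed

text \<open>A common nonzero subobject of \<open>D\<close> and a twist of \<open>E\<close> has the
  annihilator of both: primes share theirs with their nonzero subobjects, and twists preserve
  it.\<close>

lemma prime_kills_eq:
  assumes "prime_object D" "prime_object E" "orbit_class D = orbit_class E" "j \<in> Arr A" "Cod A j = Unit A"
  shows "kills j D \<longleftrightarrow> kills j E"
proof -
  obtain L M where L: "inverses L M" "common_nonzero_subobject A D (E \<boxtimes> L)"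
    using orbit_class_eqD[OF prime_monoform prime_monoform] assms by blast
  obtain s t where st: "is_mono A s" "is_mono A t" "Dom A s = Dom A t" "\<not> is_zero A (Dom A s)" "Cod A s = D" "Cod A t = E \<boxtimes> L"
    using common_nonzero_subobjectE[OF L(2)] by metis
  note o = inverses_obj[OF L(1)] and i = inverses_sym[OF L(1)]
  have ta: "t \<in> Arr A" "Dom A s \<in> Obj A" using st by auto
  have E: "E \<in> Obj A" using prime_objectD assms by blast
  obtain \<theta> where \<theta>: "is_iso A \<theta>" "Dom A \<theta> = (E \<boxtimes> L) \<boxtimes> M" "Cod A \<theta> = E" using isomorphicD[OF inverses_cancel[OF L(1) E]] by blast
  have \<theta>a: "\<theta> \<in> Arr A" using \<theta> by simp
  have mm: "is_mono A (\<theta> \<cdot> (t \<odot> M))" by (rule mono_cmp[OF rt_mono[OF i st(2)] iso_mono[OF \<theta>(1)]]) (use ta st \<theta> o in auto)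
  have d: "Dom A (\<theta> \<cdot> (t \<odot> M)) = Dom A s \<boxtimes> M" "Cod A (\<theta> \<cdot> (t \<odot> M)) = E" using ta st \<theta> \<theta>a o by simp_all
  have "kills j D \<longleftrightarrow> kills j (Dom A s)" using prime_objectD(4)[OF assms(1) st(1,5,4) assms(4,5)] by simp
  also have "\<dots> \<longleftrightarrow> kills j (Dom A s \<boxtimes> M)" using kills_tensor[OF i ta(2) assms(4)] by simp
  also have "\<dots> \<longleftrightarrow> kills j E" 
    using prime_objectD(4)[OF assms(2) mm d(2) _ assms(4,5)] d(1) nonzero_tensor[OF i ta(2) st(4)] by simp
  finally show ?thesis .
qed

text \<open>What kills \<open>Z\<close> kills its subquotients and their twists, hence some nonzero
  subobject of \<open>D\<close>; primality carries this up to \<open>D\<close>.\<close>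

lemma LSupp_kills_prime:
  assumes "prime_object D" "orbit_class D \<in> LSupp A Z" "j \<in> Arr A" "Cod A j = Unit A" "kills j Z"
  shows "kills j D"
proof -
  obtain m e where m: "is_mono A m" "is_epi A e" "Cod A m = Z" "Dom A e = Dom A m" "monoform A (Cod A e)" "orbit_class D = orbit_class (Cod A e)"
    using LSuppE[OF assms(2)] by metis
  obtain L M where L: "inverses L M" "common_nonzero_subobject A D (Cod A e \<boxtimes> L)"
    using orbit_class_eqD[OF prime_monoform[OF assms(1)] m(5,6)] by blast
  obtain s t where st: "is_mono A s" "is_mono A t" "Dom A s = Dom A t" "\<not> is_zero A (Dom A s)" "Cod A s = D" "Cod A t = Cod A e \<boxtimes> L"
    using common_nonzero_subobjectE[OF L(2)] by metis
  have "kills j (Dom A m)" using kills_sub[OF _ m(1) assms(3,4)] m assms(5) by simp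
  then have "kills j (Cod A e)" using kills_quot[OF _ m(2) assms(3)] m by simp
  then have "kills j (Cod A t)" using kills_tensor[OF L(1) _ assms(3)] m st by simp
  then have "kills j (Dom A t)" by (rule kills_sub[OF _ st(2) assms(3,4)])
  then show ?thesis using prime_objectD(4)[OF assms(1) st(1,5,4) assms(3,4)] st by simp
qed

end

section \<open>The subcategory of noetherian objects\<close>

context abelian_category
begin

text \<open>Torsion-free classes live in the full subcategory \<open>noeth C\<close>, where zero
  objects, monomorphisms and kernels are tested on fewer objects. The lemmas that follow compare
  these notions with those of \<open>C\<close>.\<close>

lemma noeth_simps [simp]:
  "Obj (noeth C) = {M. noetherian_object C M}"
  "Arr (noeth C) = {f \<in> Arr C. noetherian_object C (Dom C f) \<and> noetherian_object C (Cod C f)}"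
  "Dom (noeth C) = Dom C" "Cod (noeth C) = Cod C" "Idn (noeth C) = Idn C" "Cmp (noeth C) = Cmp C"
  unfolding noeth_def full_sub_def by auto

lemma Hom_noeth: "Hom (noeth C) a b = {f \<in> Hom C a b. noetherian_object C a \<and> noetherian_object C b}"
  by auto

lemma noetherian_zero:
  assumes "is_zero C z" shows "noetherian_object C z"
proof (rule noetherianI)
  show "z \<in> Obj C" using assms by (rule zero_objD)
  fix s :: "nat \<Rightarrow> 'm"
  assume s: "\<And>n. is_mono C (s n)" "\<And>n. Cod C (s n) = z"
  have "subobject_le C (s n) (s 0)" for n
  proof -
    have a: "s n \<in> Arr C" "s 0 \<in> Arr C" using s(1) by auto
    obtain h where h: "zero_arrow C h" "Dom C h = Dom C (s n)" "Cod C h = Dom C (s 0)"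
      using zero_arrow_exists[of "Dom C (s n)" "Dom C (s 0)"] a by auto
    have "s 0 \<cdot> h = s n" by (rule zero_obj_unique[OF assms]) (use h a s(2) in auto)
    then show ?thesis by (rule subobject_leI) (use h in auto)
  qed
  then show "\<exists>N. \<forall>n \<ge> N. subobject_le C (s n) (s N)" by blast
qed

lemma is_zero_noeth: "is_zero (noeth C) z \<longleftrightarrow> is_zero C z"
proof
  assume z: "is_zero (noeth C) z"
  then have zn: "noetherian_object C z" unfolding is_zero_def by simp
  then have zo: "z \<in> Obj C" by (rule noetherian_obj)
  obtain n where n: "zero_arrow C n" "Dom C n = z" "Cod C n = z" using zero_arrow_exists[OF zo zo] by blast
  have "\<exists>!f. f \<in> Hom (noeth C) z z" using z zn unfolding is_zero_def by simp
  moreover have "Idn C z \<in> Hom (noeth C) z z" "n \<in> Hom (noeth C) z z" using n zn zo by auto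
  ultimately have "Idn C z = n" by blast
  then show "is_zero C z" using zero_iff_idn n zo by simp
next
  assume z: "is_zero C z"
  show "is_zero (noeth C) z" unfolding is_zero_def Hom_noeth
  proof (intro conjI ballI)
    show "z \<in> Obj (noeth C)" using noetherian_zero[OF z] by simp
    fix a assume "a \<in> Obj (noeth C)"
    then have a: "noetherian_object C a" by simp
    have "(\<exists>!f. f \<in> Hom C a z) \<and> (\<exists>!f. f \<in> Hom C z a)" using z noetherian_obj[OF a] unfolding is_zero_def by blast
    then show "\<exists>!f. f \<in> {f \<in> Hom C a z. noetherian_object C a \<and> noetherian_object C z}"
      "\<exists>!f. f \<in> {f \<in> Hom C z a. noetherian_object C z \<and> noetherian_object C a}"
      using a noetherian_zero[OF z] by simp_all
  qed
qed

lemma zero_arrow_noeth: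
  assumes "noetherian_object C (Dom C f)" "noetherian_object C (Cod C f)"
  shows "zero_arrow (noeth C) f \<longleftrightarrow> zero_arrow C f"
  unfolding zero_arrow_def is_zero_noeth Hom_noeth using assms noetherian_zero by auto

text \<open>The kernel of \<open>m\<close> taken in \<open>C\<close> has noetherian domain, so it is
  already an admissible test arrow and must vanish.\<close>

lemma is_mono_noeth: "is_mono (noeth C) m \<longleftrightarrow> is_mono C m \<and> noetherian_object C (Cod C m)"
proof
  assume m: "is_mono (noeth C) m"
  then have a: "m \<in> Arr C" "noetherian_object C (Dom C m)" "noetherian_object C (Cod C m)" unfolding is_mono_def by auto
  obtain k where k: "is_kernel C m k" using kernel_exists[OF a(1)] by blast
  note kD = kernelD[OF k]
  have kn: "noetherian_object C (Dom C k)" using noetherian_sub[OF kernel_mono[OF k]] kD a by simp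
  obtain n where n: "zero_arrow C n" "Dom C n = Dom C k" "Cod C n = Dom C m"
    using zero_arrow_exists[of "Dom C k" "Dom C m"] kD by auto
  have "m \<cdot> k = m \<cdot> n" by (rule zero_arrow_unique) (use n kD in auto)
  moreover have "k \<in> Hom (noeth C) (Dom C k) (Dom C m)" "n \<in> Hom (noeth C) (Dom C k) (Dom C m)" using kn n kD a by auto
  ultimately have "k = n" using m unfolding is_mono_def by simp
  then have kz: "zero_arrow C k" using n by simp
  have "is_mono C m"
  proof (rule mono0I[OF a(1)])
    fix g assume g: "g \<in> Arr C" "Cod C g = Dom C m" "zero_arrow C (m \<cdot> g)"
    then obtain u where u: "u \<in> Arr C" "Cod C u = Dom C k" "k \<cdot> u = g" using kernel_lift[OF k g] by auto
    have "zero_arrow C (k \<cdot> u)" by (rule zero_cmpR[OF kz]) (use u in auto)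
    then show "zero_arrow C g" using u by simp
  qed
  then show "is_mono C m \<and> noetherian_object C (Cod C m)" using a by simp
next
  assume "is_mono C m \<and> noetherian_object C (Cod C m)"
  then have m: "is_mono C m" and n: "noetherian_object C (Dom C m)" "noetherian_object C (Cod C m)" using noetherian_sub by auto
  show "is_mono (noeth C) m" unfolding is_mono_def Hom_noeth
  proof (intro conjI allI ballI impI)
    show "m \<in> Arr (noeth C)" using m n by simp
    fix x g h assume "g \<in> {f \<in> Hom C x (Dom (noeth C) m). noetherian_object C x \<and> noetherian_object C (Dom (noeth C) m)}"
      "h \<in> {f \<in> Hom C x (Dom (noeth C) m). noetherian_object C x \<and> noetherian_object C (Dom (noeth C) m)}"
      "m \<cdot>\<^bsub>noeth C\<^esub> g = m \<cdot>\<^bsub>noeth C\<^esub> h"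
    then have "m \<cdot> g = m \<cdot> h" "g \<in> Arr C" "h \<in> Arr C" "Dom C g = Dom C h" "Cod C g = Dom C m" "Cod C h = Dom C m" by auto
    then show "g = h" by (rule monoD[OF m])
  qed
qed

lemma short_exact_noethI:
  assumes "is_kernel C g f" "is_epi C g" "noetherian_object C (Cod C f)"
  shows "short_exact (noeth C) f g"
proof -
  note fD = kernelD[OF assms(1)]
  have c: "is_cokernel C f g" by (rule epi_cokernel_of_kernel[OF assms(2,1)])
  have n: "noetherian_object C (Dom C f)" "noetherian_object C (Dom C g)" "noetherian_object C (Cod C g)"
    using noetherian_sub[OF kernel_mono[OF assms(1)]] noetherian_quot[OF assms(2)] fD assms(3) by auto
  have "is_kernel (noeth C) g f" unfolding is_kernel_def Hom_noeth
  proof (intro conjI allI ballI impI)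
    show "zero_arrow (noeth C) (g \<cdot>\<^bsub>noeth C\<^esub> f)" using zero_arrow_noeth[of "g \<cdot> f"] fD n by simp
    fix x h assume h: "h \<in> {f \<in> Hom C x (Dom (noeth C) g). noetherian_object C x \<and> noetherian_object C (Dom (noeth C) g)}"
      "zero_arrow (noeth C) (g \<cdot>\<^bsub>noeth C\<^esub> h)"
    then have h': "h \<in> Hom C x (Dom C g)" "noetherian_object C x" by auto
    then have "zero_arrow C (g \<cdot> h)" using h(2) zero_arrow_noeth[of "g \<cdot> h"] fD n by simp
    then have "\<exists>!u. u \<in> Hom C x (Dom C f) \<and> f \<cdot> u = h" using assms(1) h'(1) unfolding is_kernel_def by blast
    then show "\<exists>!u. u \<in> {fa \<in> Hom C x (Dom (noeth C) f). noetherian_object C x \<and> noetherian_object C (Dom (noeth C) f)} \<and> f \<cdot>\<^bsub>noeth C\<^esub> u = h"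
      using h'(2) n by simp
  qed (use fD n assms(3) in simp_all)
  moreover have "is_cokernel (noeth C) f g" unfolding is_cokernel_def Hom_noeth
  proof (intro conjI allI ballI impI)
    show "zero_arrow (noeth C) (g \<cdot>\<^bsub>noeth C\<^esub> f)" using zero_arrow_noeth[of "g \<cdot> f"] fD n by simp
    fix x h assume h: "h \<in> {fa \<in> Hom C (Cod (noeth C) f) x. noetherian_object C (Cod (noeth C) f) \<and> noetherian_object C x}"
      "zero_arrow (noeth C) (h \<cdot>\<^bsub>noeth C\<^esub> f)"
    then have h': "h \<in> Hom C (Cod C f) x" "noetherian_object C x" by auto
    then have "zero_arrow C (h \<cdot> f)" using h(2) zero_arrow_noeth[of "h \<cdot> f"] fD n by simp
    then have "\<exists>!u. u \<in> Hom C (Cod C g) x \<and> u \<cdot> g = h" using c h'(1) unfolding is_cokernel_def by blast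
    then show "\<exists>!u. u \<in> {f \<in> Hom C (Cod (noeth C) g) x. noetherian_object C (Cod (noeth C) g) \<and> noetherian_object C x} \<and> u \<cdot>\<^bsub>noeth C\<^esub> g = h"
      using h'(2) n by simp
  qed (use fD n assms(3) in simp_all)
  ultimately show ?thesis unfolding short_exact_def by blast
qed

text \<open>The kernel of \<open>g\<close> in \<open>C\<close> has noetherian domain, hence factors
  through \<open>f\<close>; arrows from arbitrary objects reach \<open>f\<close> by way of
  it.\<close>

lemma short_exact_noethD:
  assumes "short_exact (noeth C) f g" shows "is_kernel C g f"
proof -
  have k: "is_kernel (noeth C) g f" using assms unfolding short_exact_def by blast
  then have a: "g \<in> Arr C" "f \<in> Arr C" "Cod C f = Dom C g" "noetherian_object C (Dom C f)" "noetherian_object C (Dom C g)"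
      "noetherian_object C (Cod C g)" "zero_arrow (noeth C) (g \<cdot> f)" unfolding is_kernel_def by auto
  have z: "zero_arrow C (g \<cdot> f)" using a zero_arrow_noeth[of "g \<cdot> f"] by simp
  have lift: "\<exists>!u. u \<in> Hom C x (Dom C f) \<and> f \<cdot> u = h"
    if h: "h \<in> Hom C x (Dom C g)" "noetherian_object C x" "zero_arrow C (g \<cdot> h)" for x h
  proof -
    have "h \<in> Hom (noeth C) x (Dom (noeth C) g)" "zero_arrow (noeth C) (g \<cdot>\<^bsub>noeth C\<^esub> h)"
      using h a zero_arrow_noeth[of "g \<cdot> h"] by auto
    then have "\<exists>!u. u \<in> Hom (noeth C) x (Dom (noeth C) f) \<and> f \<cdot>\<^bsub>noeth C\<^esub> u = h" using k unfolding is_kernel_def by blast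
    then show ?thesis using h(2) a(4) unfolding Hom_noeth by simp
  qed
  have "is_mono (noeth C) f" unfolding is_mono_def
  proof (intro conjI allI ballI impI)
    show "f \<in> Arr (noeth C)" using a by simp
    fix x u v assume "u \<in> Hom (noeth C) x (Dom (noeth C) f)" "v \<in> Hom (noeth C) x (Dom (noeth C) f)"
      and e: "f \<cdot>\<^bsub>noeth C\<^esub> u = f \<cdot>\<^bsub>noeth C\<^esub> v"
    then have uv: "u \<in> Hom C x (Dom C f)" "v \<in> Hom C x (Dom C f)" "noetherian_object C x" by auto
    have "zero_arrow C ((g \<cdot> f) \<cdot> v)" by (rule zero_cmpR[OF z]) (use uv a in auto)
    then have "\<exists>!w. w \<in> Hom C x (Dom C f) \<and> f \<cdot> w = f \<cdot> v" by (intro lift) (use uv a in auto)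
    then show "u = v" using uv e by (metis noeth_simps(6))
  qed
  then have m: "is_mono C f" using is_mono_noeth by blast
  obtain k' where k': "is_kernel C g k'" using kernel_exists[OF a(1)] by blast
  note kD = kernelD[OF k']
  have "noetherian_object C (Dom C k')" using noetherian_sub[OF kernel_mono[OF k']] kD a by simp
  then obtain u where u: "u \<in> Arr C" "Dom C u = Dom C k'" "Cod C u = Dom C f" "f \<cdot> u = k'"
    using lift[of k' "Dom C k'"] kD by auto
  show ?thesis
  proof (rule kernelI[OF a(1) m a(3) z])
    fix h assume h: "h \<in> Arr C" "Cod C h = Dom C g" "zero_arrow C (g \<cdot> h)"
    obtain v where v: "v \<in> Arr C" "Dom C v = Dom C h" "Cod C v = Dom C k'" "k' \<cdot> v = h" using kernel_lift[OF k' h] by blast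
    have "f \<cdot> u \<cdot> v = k' \<cdot> v" by (rule cmp_extend[OF u(4)]) (use u v a in auto)
    then have "f \<cdot> (u \<cdot> v) = h" using v(4) by simp
    then show "\<exists>u\<in>Arr C. Dom C u = Dom C h \<and> Cod C u = Dom C f \<and> f \<cdot> u = h"
      using u(1-3) v(1-3) by (intro bexI[of _ "u \<cdot> v"]) auto
  qed
qed

lemma isomorphic_noeth:
  assumes "isomorphic (noeth C) a b" shows "isomorphic C a b"
proof -
  obtain f g where "f \<in> Arr C" "Dom C f = a" "Cod C f = b" "g \<in> Arr C" "Dom C g = b" "Cod C g = a"
    "g \<cdot> f = Idn C a" "f \<cdot> g = Idn C b"
    using assms unfolding isomorphic_def is_iso_def Hom_noeth by auto
  then show ?thesis using isomorphicI[OF isoI[of f g]] by simp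
qed

text \<open>Presents a binary coproduct as an extension, so that closure under sums reduces to
  closure under extensions. The projections come from the universal property with identity and zero
  components.\<close>

lemma coproduct_noeth_kernel:
  assumes "is_coproduct (noeth C) UNIV Y c i"
  shows "\<exists>p. is_kernel C p (i True) \<and> Cod C p = Y False"
proof -
  have c: "noetherian_object C c" using assms unfolding is_coproduct_def by simp
  have i': "\<And>j. i j \<in> Hom (noeth C) (Y j) c" using assms unfolding is_coproduct_def by blast
  have i: "i j \<in> Arr C" "Dom C (i j) = Y j" "Cod C (i j) = c" "noetherian_object C (Y j)" for j using i'[of j] by auto
  have univ: "\<exists>!u. u \<in> Hom C c d \<and> (\<forall>j. u \<cdot> i j = q j)" if d: "noetherian_object C d" "\<And>j. q j \<in> Hom C (Y j) d" for d q
  proof -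
    have "\<forall>d \<in> Obj (noeth C). \<forall>q. (\<forall>j \<in> UNIV. q j \<in> Hom (noeth C) (Y j) d) \<longrightarrow>
        (\<exists>!u. u \<in> Hom (noeth C) c d \<and> (\<forall>j \<in> UNIV. u \<cdot>\<^bsub>noeth C\<^esub> i j = q j))"
      using assms unfolding is_coproduct_def by (elim conjE)
    moreover have "d \<in> Obj (noeth C)" using d by simp
    ultimately have "\<forall>q. (\<forall>j \<in> UNIV. q j \<in> Hom (noeth C) (Y j) d) \<longrightarrow>
        (\<exists>!u. u \<in> Hom (noeth C) c d \<and> (\<forall>j \<in> UNIV. u \<cdot>\<^bsub>noeth C\<^esub> i j = q j))" by (rule bspec)
    then have "(\<forall>j \<in> UNIV. q j \<in> Hom (noeth C) (Y j) d) \<longrightarrow>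
        (\<exists>!u. u \<in> Hom (noeth C) c d \<and> (\<forall>j \<in> UNIV. u \<cdot>\<^bsub>noeth C\<^esub> i j = q j))" by (rule spec)
    then show ?thesis using d c i(4) unfolding Hom_noeth by simp
  qed
  have Yo: "Y j \<in> Obj C" for j using noetherian_obj i(4) by blast
  have proj: "\<exists>p. p \<in> Arr C \<and> Dom C p = c \<and> Cod C p = Y j \<and> p \<cdot> i j = Idn C (Y j) \<and> zero_arrow C (p \<cdot> i (\<not> j))" for j
  proof -
    obtain n where n: "zero_arrow C n" "Dom C n = Y (\<not> j)" "Cod C n = Y j" using zero_arrow_exists Yo by blast
    have "\<exists>!u. u \<in> Hom C c (Y j) \<and> (\<forall>l. u \<cdot> i l = (if l = j then Idn C (Y j) else n))"
      by (rule univ[OF i(4)]) (use n Yo in auto)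
    then obtain p where p: "p \<in> Hom C c (Y j)" "\<And>l. p \<cdot> i l = (if l = j then Idn C (Y j) else n)" by blast
    then show ?thesis using n by (intro exI[of _ p]) auto
  qed
  obtain p where p: "p \<in> Arr C" "Dom C p = c" "Cod C p = Y False" "p \<cdot> i False = Idn C (Y False)" "zero_arrow C (p \<cdot> i True)"
    using proj[of False] by auto
  obtain r where r: "r \<in> Arr C" "Dom C r = c" "Cod C r = Y True" "r \<cdot> i True = Idn C (Y True)" "zero_arrow C (r \<cdot> i False)"
    using proj[of True] by auto
  have co: "c \<in> Obj C" using noetherian_obj c by blast
  have "Idn C c \<in> Hom C c c" "i True \<cdot> r \<in> Hom C c c" using co i r by auto
  \<comment> \<open>\<open>d\<close> stands for the identity minus \<open>i True \<cdot> r\<close>.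
    It agrees with \<open>i False \<cdot> p\<close> on both injections, so an arrow killed by
    \<open>p\<close> is killed by \<open>d\<close> and hence factors through
    \<open>i True\<close>.\<close>
  from difference[OF this] obtain d where d: "d \<in> Arr C" "Dom C d = c" "Cod C d = c"
    "\<And>e. e \<in> Arr C \<Longrightarrow> Cod C e = c \<Longrightarrow> zero_arrow C (d \<cdot> e) \<longleftrightarrow> Idn C c \<cdot> e = (i True \<cdot> r) \<cdot> e"
    "\<And>e. e \<in> Arr C \<Longrightarrow> Cod C e = c \<Longrightarrow> zero_arrow C ((i True \<cdot> r) \<cdot> e) \<Longrightarrow> d \<cdot> e = Idn C c \<cdot> e"
    by auto
  have dT: "zero_arrow C (d \<cdot> i True)" using d(4)[of "i True"] i r by simp
  have "zero_arrow C (i True \<cdot> (r \<cdot> i False))" by (rule zero_cmpL[OF r(5)]) (use i r in auto)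
  then have dF: "d \<cdot> i False = i False" using d(5)[of "i False"] i r by simp
  have "\<exists>!u. u \<in> Hom C c c \<and> (\<forall>l. u \<cdot> i l = d \<cdot> i l)" by (rule univ[OF c]) (use d i in auto)
  moreover have "(i False \<cdot> p) \<cdot> i l = d \<cdot> i l" for l
  proof (cases l)
    case True
    have "zero_arrow C (i False \<cdot> (p \<cdot> i True))" by (rule zero_cmpL[OF p(5)]) (use i p in auto)
    then have "zero_arrow C ((i False \<cdot> p) \<cdot> i True)" using i p(1-3) by simp
    then have "(i False \<cdot> p) \<cdot> i True = d \<cdot> i True" by (rule zero_arrow_unique[OF _ dT]) (use i p d(1-3) in auto)
    then show ?thesis using True by simp
  next
    case False
    then show ?thesis using dF i p by simp
  qed
  moreover have "i False \<cdot> p \<in> Hom C c c" "d \<in> Hom C c c" using i p d(1-3) by auto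
  ultimately have dp: "i False \<cdot> p = d" by blast
  have im: "is_mono C (i True)"
    by (rule mono_cancel[of r]) (use r i iso_mono[OF idn_iso[OF Yo]] in auto)
  have "is_kernel C p (i True)"
  proof (rule kernelI[OF p(1) im _ p(5)])
    fix g assume g: "g \<in> Arr C" "Cod C g = Dom C p" "zero_arrow C (p \<cdot> g)"
    have "zero_arrow C (i False \<cdot> (p \<cdot> g))" by (rule zero_cmpL[OF g(3)]) (use i p(1-3) g in auto)
    then have "zero_arrow C ((i False \<cdot> p) \<cdot> g)" using i p(1-3) g by simp
    then have "Idn C c \<cdot> g = (i True \<cdot> r) \<cdot> g" unfolding dp using d(4)[of g] g p(2) by simp
    then have "i True \<cdot> (r \<cdot> g) = g" using i r(1-3) g p(2) by simp
    then show "\<exists>u\<in>Arr C. Dom C u = Dom C g \<and> Cod C u = Dom C (i True) \<and> i True \<cdot> u = g"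
      using i r(1-3) g p(2) by (intro bexI[of _ "r \<cdot> g"]) auto
  qed (use i p in auto)
  then show ?thesis using p by blast
qed

end

section \<open>L-closed torsion-free classes\<close>

locale L_closed_torsion_free = invertibly_generated A G
  for A :: "('o, 'm) smcat" (structure) and G :: "'o set" +
  fixes X :: "'o set"
  assumes torsion_free: "torsion_free_class (noeth A) X"
    and L_closed: "L_closed A X"
begin

section \<open>Closure properties of the class, restated in the ambient category\<close>

lemma X_noetherian: "x \<in> X \<Longrightarrow> noetherian_object A x"
  using torsion_free unfolding torsion_free_class_def additive_subcategory_def by auto

lemma X_sub:
  assumes "is_mono A m" "Cod A m \<in> X" shows "Dom A m \<in> X"
proof -
  have "is_mono (noeth A) m" using is_mono_noeth assms X_noetherian by blast
  moreover have "Cod (noeth A) m \<in> X" using assms by simp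
  ultimately have "Dom (noeth A) m \<in> X" using torsion_free unfolding torsion_free_class_def by blast
  then show ?thesis by simp
qed

lemma X_isomorphic: "isomorphic A a b \<Longrightarrow> a \<in> X \<Longrightarrow> b \<in> X"
  using X_sub[OF iso_mono] isomorphicD[OF isomorphic_sym] by metis

text \<open>\<open>g\<close> may fail to be epi: the actual quotient is its image, which is in
  \<open>X\<close> as a subobject of \<open>Cod A g\<close>. In this form the lemma applies to
  kernels of arbitrary arrows into \<open>X\<close>.\<close>

lemma X_ext:
  assumes "is_kernel A g f" "noetherian_object A (Cod A f)" "Dom A f \<in> X" "Cod A g \<in> X"
  shows "Cod A f \<in> X"
proof -
  note fD = kernelD[OF assms(1)]
  obtain e m where em: "is_epi A e" "is_mono A m" "Dom A m = Cod A e" "Dom A e = Dom A g" "Cod A m = Cod A g" "m \<cdot> e = g"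
    using image[OF fD(1)] by metis
  have "is_kernel A e f" using kernel_comp_mono[of m e f] em assms(1) by simp
  then have "short_exact (noeth A) f e" by (rule short_exact_noethI[OF _ em(1) assms(2)])
  moreover have "Cod (noeth A) e \<in> X" using X_sub[OF em(2)] em(3,5) assms(4) by simp
  moreover have "Dom (noeth A) f \<in> X" using assms by simp
  ultimately have "Cod (noeth A) f \<in> X" using torsion_free unfolding torsion_free_class_def by blast
  then show ?thesis by simp
qed

lemma X_zero: "is_zero A z \<Longrightarrow> z \<in> X"
  using torsion_free is_zero_noeth unfolding torsion_free_class_def additive_subcategory_def by blast

lemma X_tensor: "x \<in> X \<Longrightarrow> invertible_object A L \<Longrightarrow> x \<boxtimes> L \<in> X"
  using L_closed unfolding L_closed_def by blast

text \<open>Artin--Rees in disguise: an arrow \<open>J \<otimes> Q \<rightarrow> Y\<close> into an object of \<open>X\<close> vanishes on \<open>J \<otimes> Z\<close> for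
  some subobject \<open>Z\<close> obtained from \<open>Q\<close> by repeatedly taking kernels of arrows into \<open>X\<close>. Of this
  description of \<open>Z\<close> only its consequence for membership in \<open>X\<close> is recorded.\<close>

definition absorbing :: "'o \<Rightarrow> bool" where
  "absorbing J \<longleftrightarrow> J \<in> Obj A \<and> (\<forall>Q f. noetherian_object A Q \<and> f \<in> Arr A \<and> Dom A f = J \<boxtimes> Q \<and> Cod A f \<in> X \<longrightarrow>
     (\<exists>z. is_mono A z \<and> Cod A z = Q \<and> zero_arrow A (f \<cdot> (Idn A J \<star> z)) \<and> (Dom A z \<in> X \<longrightarrow> Q \<in> X)))"

lemma absorbingD:
  assumes "absorbing J" "noetherian_object A Q" "f \<in> Arr A" "Dom A f = J \<boxtimes> Q" "Cod A f \<in> X"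
  shows "\<exists>z. is_mono A z \<and> Cod A z = Q \<and> zero_arrow A (f \<cdot> (Idn A J \<star> z)) \<and> (Dom A z \<in> X \<longrightarrow> Q \<in> X)"
  using assms unfolding absorbing_def by blast

text \<open>\<open>f\<close> corresponds to an arrow \<open>g\<close> from \<open>Q\<close> to
  \<open>Cod A f \<boxtimes> M\<close>, whose target is again in \<open>X\<close>. With
  \<open>z\<close> the kernel of \<open>g\<close>, \<open>Q\<close> is an extension of a subobject
  of that target by \<open>Dom A z\<close>.\<close>

lemma absorbing_invertible:
  assumes "inverses L M" shows "absorbing L"
  unfolding absorbing_def
proof (intro conjI allI impI, goal_cases)
  case 1
  then show ?case using inverses_obj assms by blast
next
  case (2 Q f)
  then have Q: "noetherian_object A Q" and f: "f \<in> Arr A" "Dom A f = L \<boxtimes> Q" "Cod A f \<in> X" by auto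
  note o = inverses_obj[OF assms] noetherian_obj[OF Q]
  obtain n where n: "\<And>a. a \<in> Obj A \<Longrightarrow> is_iso A (n a) \<and> Dom A (n a) = (a \<boxtimes> L) \<boxtimes> M \<and> Cod A (n a) = a"
    "\<And>f. f \<in> Arr A \<Longrightarrow> f \<cdot> n (Dom A f) = n (Cod A f) \<cdot> (f \<odot> L \<odot> M)"
    using inverses_natural_iso[OF assms] by blast
  have nD: "is_iso A (n a)" "n a \<in> Arr A" "Dom A (n a) = (a \<boxtimes> L) \<boxtimes> M" "Cod A (n a) = a" if "a \<in> Obj A" for a
    using n(1)[OF that] by auto
  note nQ = nD[OF o(3)]
  obtain k where k: "k \<in> Arr A" "Dom A k = Q" "Cod A k = (Q \<boxtimes> L) \<boxtimes> M" "k \<cdot> n Q = Idn A ((Q \<boxtimes> L) \<boxtimes> M)"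
    using isoE[OF nQ(1)] nQ by metis
  note sQ = sym_iso[OF o(3,1)]
  \<comment> \<open>The ideal stands on the left in \<open>absorbing\<close> while twists act on the
    right; the symmetry reconciles the two.\<close>
  define f' where "f' = f \<cdot> Sym A Q L"
  have f': "f' \<in> Arr A" "Dom A f' = Q \<boxtimes> L" "Cod A f' = Cod A f" unfolding f'_def using f sQ iso_arr[OF sQ(1)] by simp_all
  define g where "g = (f' \<odot> M) \<cdot> k"
  have g: "g \<in> Arr A" "Dom A g = Q" "Cod A g = Cod A f \<boxtimes> M" unfolding g_def using f' k o by simp_all
  have gn: "g \<cdot> n Q = f' \<odot> M" unfolding g_def using f' k nQ o by simp
  obtain z where z: "is_kernel A g z" using kernel_exists[OF g(1)] by blast
  note zD = kernelD[OF z]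
  have zQ: "Cod A z = Q" using zD g by simp
  have zo: "Dom A z \<in> Obj A" using zD by simp
  note nZ = nD[OF zo] and sZ = sym_iso[OF zo o(1)]
  \<comment> \<open>Back from \<open>g\<close> to \<open>f\<close>: naturality of \<open>n\<close>
    exposes \<open>(f' \<cdot> (z \<odot> L)) \<odot> M\<close>, and twisting by \<open>M\<close>
    reflects zero arrows.\<close>
  have "zero_arrow A ((g \<cdot> z) \<cdot> n (Dom A z))" by (rule zero_cmpR[OF zD(4)]) (use zD(2) zQ g nZ in auto)
  then have "zero_arrow A (g \<cdot> (z \<cdot> n (Dom A z)))" using zD(2) zQ g nZ by simp
  then have "zero_arrow A (g \<cdot> (n Q \<cdot> (z \<odot> L \<odot> M)))" using n(2)[OF zD(2)] zQ by simp
  moreover have "g \<cdot> n Q \<cdot> (z \<odot> L \<odot> M) = (f' \<odot> M) \<cdot> (z \<odot> L \<odot> M)"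
    by (rule cmp_extend[OF gn]) (use g nQ zD(2) zQ o in auto)
  ultimately have "zero_arrow A ((f' \<cdot> (z \<odot> L)) \<odot> M)" using rt_cmp[of "z \<odot> L" f' M] f' zD(2) zQ o by simp
  then have "zero_arrow A (f' \<cdot> (z \<odot> L))"
    using rt_zero_iff[OF inverses_sym[OF assms], of "f' \<cdot> (z \<odot> L)"] f' zD(2) zQ o by simp
  also have "f' \<cdot> (z \<odot> L) = f \<cdot> (Sym A Q L \<cdot> (z \<odot> L))"
    unfolding f'_def using f sQ iso_arr[OF sQ(1)] zD(2) zQ o by simp
  also have "\<dots> = f \<cdot> ((Idn A L \<star> z) \<cdot> Sym A (Dom A z) L)" using lt_sym[OF zD(2) o(1)] zQ by simp
  also have "\<dots> = (f \<cdot> (Idn A L \<star> z)) \<cdot> Sym A (Dom A z) L" using f sZ iso_arr[OF sZ(1)] zD(2) zQ o by simp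
  finally have "zero_arrow A (f \<cdot> (Idn A L \<star> z))"
    by (rule epi_zero[OF iso_epi[OF sZ(1)], rotated 2]) (use f sZ zD(2) zQ o in auto)
  moreover have "Q \<in> X" if "Dom A z \<in> X"
    using X_ext[OF z] zQ Q that g X_tensor[OF f(3)] inverses_sym[OF assms] invertible_iff by auto
  ultimately show ?case using kernel_mono[OF z] zQ by blast
qed

text \<open>The subobject found for \<open>f \<cdot> (e \<odot> Q)\<close> also serves for
  \<open>f\<close>, the epi \<open>e \<odot> Dom A z\<close> being cancelled.\<close>

lemma absorbing_quot:
  assumes "is_epi A e" "absorbing (Dom A e)" shows "absorbing (Cod A e)"
  unfolding absorbing_def
proof (intro conjI allI impI, goal_cases)
  case 1
  then show ?case using assms by simp
next
  case (2 Q f)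
  then have Q: "noetherian_object A Q" and f: "f \<in> Arr A" "Dom A f = Cod A e \<boxtimes> Q" "Cod A f \<in> X" by auto
  have ea: "e \<in> Arr A" using assms by simp
  have Qo: "Q \<in> Obj A" using noetherian_obj[OF Q] .
  have fe: "f \<cdot> (e \<odot> Q) \<in> Arr A" "Dom A (f \<cdot> (e \<odot> Q)) = Dom A e \<boxtimes> Q" "Cod A (f \<cdot> (e \<odot> Q)) \<in> X" using f ea Qo by auto
  obtain z where z: "is_mono A z" "Cod A z = Q" "zero_arrow A ((f \<cdot> (e \<odot> Q)) \<cdot> (Idn A (Dom A e) \<star> z))" "Dom A z \<in> X \<longrightarrow> Q \<in> X"
    using absorbingD[OF assms(2) Q fe] by blast
  have za: "z \<in> Arr A" using z by simp
  have "(f \<cdot> (e \<odot> Q)) \<cdot> (Idn A (Dom A e) \<star> z) = f \<cdot> ((e \<odot> Q) \<cdot> (Idn A (Dom A e) \<star> z))" using f ea za z(2) Qo by simp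
  also have "\<dots> = f \<cdot> ((Idn A (Cod A e) \<star> z) \<cdot> (e \<odot> Dom A z))" using interchange[OF ea za] z(2) by simp
  also have "\<dots> = (f \<cdot> (Idn A (Cod A e) \<star> z)) \<cdot> (e \<odot> Dom A z)" using f ea za z(2) Qo by simp
  finally have "zero_arrow A ((f \<cdot> (Idn A (Cod A e) \<star> z)) \<cdot> (e \<odot> Dom A z))" using z(3) by simp
  then have "zero_arrow A (f \<cdot> (Idn A (Cod A e) \<star> z))"
    by (rule epi_zero[OF rt_epi[OF assms(1)], rotated 3]) (use f ea za z(2) Qo in auto)
  then show ?case using z by blast
qed

text \<open>Two stages: \<open>z\<close> takes care of the restriction to \<open>Dom A i\<close>,
  whereupon the arrow on J \<otimes> Dom z descends along \<open>q\<close> by right exactness;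
  \<open>y\<close> inside \<open>Dom A z\<close> takes care of the descended arrow. The two
  implications about membership in \<open>X\<close> chain.\<close>

lemma absorbing_ext:
  assumes "is_kernel A q i" "is_epi A q" "absorbing (Dom A i)" "absorbing (Cod A q)"
  shows "absorbing (Cod A i)"
  unfolding absorbing_def
proof (intro conjI allI impI, goal_cases)
  case 1
  then show ?case using kernelD[OF assms(1)] by simp
next
  case (2 Q f)
  note iD = kernelD[OF assms(1)]
  have coker: "is_cokernel A i q" by (rule epi_cokernel_of_kernel[OF assms(2,1)])
  let ?J = "Cod A i"
  have J: "?J \<in> Obj A" "Dom A i \<in> Obj A" "Cod A q \<in> Obj A" using iD by auto
  have Q: "noetherian_object A Q" and f: "f \<in> Arr A" "Dom A f = ?J \<boxtimes> Q" "Cod A f \<in> X" using 2 by auto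
  have Qo: "Q \<in> Obj A" using noetherian_obj[OF Q] .
  have fi: "f \<cdot> (i \<odot> Q) \<in> Arr A" "Dom A (f \<cdot> (i \<odot> Q)) = Dom A i \<boxtimes> Q" "Cod A (f \<cdot> (i \<odot> Q)) \<in> X" using f iD Qo by auto
  obtain z where z: "is_mono A z" "Cod A z = Q" "zero_arrow A ((f \<cdot> (i \<odot> Q)) \<cdot> (Idn A (Dom A i) \<star> z))" "Dom A z \<in> X \<longrightarrow> Q \<in> X"
    using absorbingD[OF assms(3) Q fi] by blast
  have za: "z \<in> Arr A" using z by simp
  have zo: "Dom A z \<in> Obj A" using za by simp
  have zn: "noetherian_object A (Dom A z)" using noetherian_sub z Q by blast
  define h where "h = f \<cdot> (Idn A ?J \<star> z)"
  have h: "h \<in> Arr A" "Dom A h = ?J \<boxtimes> Dom A z" "Cod A h = Cod A f" unfolding h_def using f za z(2) J by simp_all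
  have "(f \<cdot> (i \<odot> Q)) \<cdot> (Idn A (Dom A i) \<star> z) = f \<cdot> ((i \<odot> Q) \<cdot> (Idn A (Dom A i) \<star> z))" using f iD(2) za z(2) Qo by simp
  also have "\<dots> = f \<cdot> ((Idn A ?J \<star> z) \<cdot> (i \<odot> Dom A z))" using interchange[OF iD(2) za] z(2) by simp
  also have "\<dots> = h \<cdot> (i \<odot> Dom A z)" unfolding h_def using f iD(2) za z(2) Qo J by simp
  finally have "zero_arrow A (h \<cdot> (i \<odot> Dom A z))" using z(3) by simp
  then obtain f2 where f2: "f2 \<in> Arr A" "Cod A f2 = Cod A h" "Dom A f2 = Cod A (q \<odot> Dom A z)" "f2 \<cdot> (q \<odot> Dom A z) = h"
    using cokernel_desc[OF rt_cokernel[OF coker zo], of h] h iD(2) zo by auto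
  have f2d: "Dom A f2 = Cod A q \<boxtimes> Dom A z" "Cod A f2 \<in> X" using f2 h f iD(1) zo by auto
  obtain y where y: "is_mono A y" "Cod A y = Dom A z" "zero_arrow A (f2 \<cdot> (Idn A (Cod A q) \<star> y))" "Dom A y \<in> X \<longrightarrow> Dom A z \<in> X"
    using absorbingD[OF assms(4) zn f2(1) f2d] by blast
  have ya: "y \<in> Arr A" using y by simp
  have yo: "Dom A y \<in> Obj A" using ya by simp
  have "f \<cdot> (Idn A ?J \<star> (z \<cdot> y)) = f \<cdot> ((Idn A ?J \<star> z) \<cdot> (Idn A ?J \<star> y))" using lt_cmp[OF ya za _ J(1)] y(2) by simp
  also have "\<dots> = h \<cdot> (Idn A ?J \<star> y)" unfolding h_def using f za z(2) ya y(2) J by simp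
  also have "\<dots> = f2 \<cdot> ((q \<odot> Dom A z) \<cdot> (Idn A ?J \<star> y))"
    by (rule cmp_extend[OF f2(4), symmetric]) (use f2(1,3) iD(1,3) ya y(2) zo J in auto)
  also have "\<dots> = f2 \<cdot> ((Idn A (Cod A q) \<star> y) \<cdot> (q \<odot> Dom A y))" using interchange[OF iD(1) ya] y(2) iD(3) by simp
  also have "\<dots> = (f2 \<cdot> (Idn A (Cod A q) \<star> y)) \<cdot> (q \<odot> Dom A y)" using f2(1) f2d(1) iD(1) ya y(2) yo by simp
  finally have eq: "f \<cdot> (Idn A ?J \<star> (z \<cdot> y)) = (f2 \<cdot> (Idn A (Cod A q) \<star> y)) \<cdot> (q \<odot> Dom A y)" .
  have "zero_arrow A ((f2 \<cdot> (Idn A (Cod A q) \<star> y)) \<cdot> (q \<odot> Dom A y))"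
    by (rule zero_cmpR[OF y(3)]) (use f2(1) f2d(1) iD(1) ya y(2) yo in auto)
  then have "zero_arrow A (f \<cdot> (Idn A ?J \<star> (z \<cdot> y)))" unfolding eq .
  moreover have "is_mono A (z \<cdot> y)" by (rule mono_cmp[OF y(1) z(1)]) (use y in simp)
  moreover have "Cod A (z \<cdot> y) = Q" "Dom A (z \<cdot> y) = Dom A y" using za ya y(2) z(2) by auto
  ultimately show ?case using y(4) z(4) by (intro exI[of _ "z \<cdot> y"]) simp
qed

lemma absorbing_zero:
  assumes "is_zero A J" shows "absorbing J"
  unfolding absorbing_def
proof (intro conjI allI impI, goal_cases)
  case 1
  then show ?case using zero_objD assms by blast
next
  case (2 Q f)
  then have f: "f \<in> Arr A" "Dom A f = J \<boxtimes> Q" "Q \<in> Obj A" using noetherian_obj by auto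
  have "zero_arrow A f" by (rule zero_arrowI[OF zero_tensor[OF assms f(3)]]) (use f in auto)
  then have "zero_arrow A (f \<cdot> (Idn A J \<star> Idn A Q))" by (rule zero_cmpR) (use f zero_objD[OF assms] in auto)
  then show ?case using f iso_mono[OF idn_iso[OF f(3)]] by (intro exI[of _ "Idn A Q"]) simp
qed

text \<open>A maximal absorbing subobject \<open>m\<close> is everything: a nonzero quotient by
  \<open>m\<close> would contain a nonzero quotient of an invertible object, which is absorbing, and
  its preimage would be absorbing and strictly larger.\<close>

lemma absorbing_noetherian:
  assumes "noetherian_object A J" shows "absorbing J"
proof -
  have Jo: "J \<in> Obj A" using assms noetherian_obj by blast
  obtain z where z: "is_zero A z" using zero_exists by blast
  obtain m0 where m0: "is_mono A m0" "Dom A m0 = z" "Cod A m0 = J" using mono_from_zero[OF z Jo] by blast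
  define P where "P m \<longleftrightarrow> is_mono A m \<and> Cod A m = J \<and> absorbing (Dom A m)" for m
  have "P m0" unfolding P_def using m0 absorbing_zero z by simp
  then obtain m where m: "P m" "\<And>m'. P m' \<Longrightarrow> subobject_le A m m' \<Longrightarrow> subobject_le A m' m"
    using noetherian_maximal[OF assms, of P m0] P_def by blast
  have mm: "is_mono A m" "Cod A m = J" "absorbing (Dom A m)" using m(1) unfolding P_def by auto
  have ma: "m \<in> Arr A" using mm by simp
  obtain q where q: "is_cokernel A m q" using cokernel_exists[OF ma] by blast
  note qD = cokernelD[OF q]
  show ?thesis
  proof (cases "is_zero A (Cod A q)")
    case True
    have "zero_arrow A q" by (rule zero_arrowI[OF True]) (use qD in auto)
    then have "is_epi A m" by (rule iso_epi[OF mono_zero_cokernel_iso[OF mm(1) q]])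
    then show ?thesis using absorbing_quot[of m] mm by simp
  next
    case False
    have qo: "Cod A q \<in> Obj A" using qD by simp
    obtain c e where c: "is_mono A c" "Cod A c = Cod A q" "\<not> is_zero A (Dom A c)" "is_epi A e" "invertible_object A (Dom A e)" "Cod A e = Dom A c"
      using invertible_quotient_sub[OF qo False] by blast
    have ac: "absorbing (Dom A c)" using absorbing_quot[OF c(4)] absorbing_invertible c(5,6) invertible_iff by metis
    obtain k t w where k: "is_mono A k" "Cod A k = Cod A m" "is_epi A t" "Dom A t = Dom A k" "Cod A t = Dom A c" "q \<cdot> k = c \<cdot> t"
      "is_kernel A t w" "Dom A w = Dom A m" "Cod A w = Dom A k" "subobject_le A m k" "\<not> subobject_le A k m"
      using preimage_kernel[OF mm(1) q c(1,2)] c(3) by blast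
    have "absorbing (Cod A w)" by (rule absorbing_ext[OF k(7,3)]) (use k(5,8) mm ac in auto)
    then have "P k" unfolding P_def using k(1,2,9) mm by simp
    then show ?thesis using m(2) k(10,11) by blast
  qed
qed

lemma mem_of_LAss_subset:
  assumes specialization: "\<And>M x. M \<in> Obj A \<Longrightarrow> x \<in> LSupp A M \<Longrightarrow> \<exists>y \<in> LAss A M. y \<in> LSpec_top A closure_of {x}"
    and M: "noetherian_object A M" and LAss: "LAss A M \<subseteq> LAss_class A X"
  shows "M \<in> X"
proof -
  have Mo: "M \<in> Obj A" using M noetherian_obj by blast
  obtain z where z: "is_zero A z" using zero_exists by blast
  obtain m0 where m0: "is_mono A m0" "Dom A m0 = z" "Cod A m0 = M" using mono_from_zero[OF z Mo] by blast
  define P where "P m \<longleftrightarrow> is_mono A m \<and> Cod A m = M \<and> Dom A m \<in> X" for m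
  have "P m0" unfolding P_def using m0 X_zero z by simp
  then obtain m where m: "P m" "\<And>m'. P m' \<Longrightarrow> subobject_le A m m' \<Longrightarrow> subobject_le A m' m"
    using noetherian_maximal[OF M, of P m0] P_def by blast
  have mm: "is_mono A m" "Cod A m = M" "Dom A m \<in> X" using m(1) unfolding P_def by auto
  have ma: "m \<in> Arr A" using mm by simp
  obtain q where q: "is_cokernel A m q" using cokernel_exists[OF ma] by blast
  note qD = cokernelD[OF q]
  have qo: "Cod A q \<in> Obj A" using qD by simp
  show ?thesis
  proof (cases "is_zero A (Cod A q)")
    case True
    have "zero_arrow A q" by (rule zero_arrowI[OF True]) (use qD in auto)
    from isomorphicI[OF mono_zero_cokernel_iso[OF mm(1) q this]] show ?thesis using X_isomorphic mm by blast
  next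
    case False
    obtain c where c: "is_mono A c" "Cod A c = Cod A q" "prime_object (Dom A c)"
      using prime_sub_exists[OF qo False] by blast
    let ?C = "Dom A c"
    have Co: "?C \<in> Obj A" using c by simp
    \<comment> \<open>In the notation of the overview, Q' is \<open>Dom A m\<close> and Q is
      \<open>Dom A k\<close>; \<open>w\<close> embeds Q' in Q and \<open>t\<close> is the projection
      of Q onto C.\<close>
    obtain k t w where k: "is_mono A k" "Cod A k = Cod A m" "is_epi A t" "Dom A t = Dom A k" "Cod A t = ?C" "q \<cdot> k = c \<cdot> t"
      "is_kernel A t w" "Dom A w = Dom A m" "Cod A w = Dom A k" "subobject_le A m k" "\<not> subobject_le A k m"
      using preimage_kernel[OF mm(1) q c(1,2)] prime_objectD(2)[OF c(3)] by blast
    note wD = kernelD[OF k(7)] and wm = k(8) and wQ = k(9)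
    have ka: "k \<in> Arr A" and ta: "t \<in> Arr A" using k by auto
    let ?Q = "Dom A k"
    have Q: "noetherian_object A ?Q" using noetherian_sub[OF k(1)] k(2) mm M by simp
    have Qo: "?Q \<in> Obj A" using ka by simp
    have notX: "?Q \<notin> X"
    proof
      assume "?Q \<in> X"
      then have "P k" unfolding P_def using k mm by simp
      then show False using m(2) k(10,11) by blast
    qed
    have C_notX: "?C \<notin> X"
    proof
      assume "?C \<in> X"
      then have "Cod A w \<in> X" by (intro X_ext[OF k(7)]) (use wQ Q wm mm k(5) in auto)
      then show False using notX wQ by simp
    qed
    obtain a where a: "annihilator ?C a" using annihilator_exists[OF Co] by blast
    have aD: "is_mono A a" "Cod A a = Unit A" "kills a ?C" "\<And>j. j \<in> Arr A \<Longrightarrow> Cod A j = Unit A \<Longrightarrow> kills j ?C \<Longrightarrow> subobject_le A j a"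
      using a unfolding annihilator_def by auto
    have aa: "a \<in> Arr A" using aD by simp
    let ?J = "Dom A a"
    have J: "?J \<in> Obj A" "absorbing ?J" using aa absorbing_noetherian[OF noetherian_sub[OF aD(1)]] aD(2) unit_noetherian by auto
    note lQ = lunit_simps[OF Qo]
    \<comment> \<open>The action of the annihilator J on Q. As J kills C, it lands in the kernel of
      \<open>t\<close>, so it can be read as an arrow \<open>f\<close> into an object of
      \<open>X\<close>, to which the absorbing property applies.\<close>
    define g where "g = LUnit A ?Q \<cdot> (a \<odot> ?Q)"
    have g: "g \<in> Arr A" "Dom A g = ?J \<boxtimes> ?Q" "Cod A g = ?Q" unfolding g_def using lQ aa aD(2) Qo by simp_all
    have "zero_arrow A (t \<cdot> g)" unfolding g_def using kills_quotient_iff[OF k(3) aa aD(2)] aD(3) k(4,5) by simp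
    then obtain f where f: "f \<in> Arr A" "Dom A f = ?J \<boxtimes> ?Q" "Cod A f = Dom A w" "w \<cdot> f = g"
      using kernel_lift[OF k(7), of g] g k(4) by auto
    have fX: "Cod A f \<in> X" using f wm mm by simp
    obtain z where z: "is_mono A z" "Cod A z = ?Q" "zero_arrow A (f \<cdot> (Idn A ?J \<star> z))" "Dom A z \<in> X \<longrightarrow> ?Q \<in> X"
      using absorbingD[OF J(2) Q f(1,2) fX] by blast
    let ?Z = "Dom A z"
    have za: "z \<in> Arr A" using z by simp
    have zo: "?Z \<in> Obj A" using za by simp
    \<comment> \<open>\<open>w \<cdot> f\<close> is the action of J on Q, so the vanishing of
      \<open>f\<close> on J \<otimes> Z says that the action on Z, followed by the embedding
      \<open>z\<close>, is zero.\<close>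
    have killsZ: "kills a ?Z"
    proof -
      have "zero_arrow A (w \<cdot> (f \<cdot> (Idn A ?J \<star> z)))" by (rule zero_cmpL[OF z(3)]) (use wD f J za z(2) in auto)
      moreover have "w \<cdot> f \<cdot> (Idn A ?J \<star> z) = g \<cdot> (Idn A ?J \<star> z)" by (rule cmp_extend[OF f(4)]) (use wD f J za z(2) in auto)
      ultimately have "zero_arrow A (g \<cdot> (Idn A ?J \<star> z))" by simp
      also have "g \<cdot> (Idn A ?J \<star> z) = LUnit A ?Q \<cdot> ((a \<odot> ?Q) \<cdot> (Idn A ?J \<star> z))"
        unfolding g_def using lQ aa aD(2) Qo J za z(2) by simp
      also have "(a \<odot> ?Q) \<cdot> (Idn A ?J \<star> z) = (Idn A (Unit A) \<star> z) \<cdot> (a \<odot> ?Z)" using interchange[OF aa za] z(2) aD(2) by simp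
      also have "LUnit A ?Q \<cdot> ((Idn A (Unit A) \<star> z) \<cdot> (a \<odot> ?Z)) = (z \<cdot> LUnit A ?Z) \<cdot> (a \<odot> ?Z)"
        by (rule cmp_extend) (use lunit_nat'[OF za] lQ aa aD(2) za z(2) zo in auto)
      finally have *: "zero_arrow A ((z \<cdot> LUnit A ?Z) \<cdot> (a \<odot> ?Z))" .
      note lZ = lunit_simps[OF zo]
      have "is_mono A (z \<cdot> LUnit A ?Z)" by (rule mono_cmp[OF iso_mono[OF lZ(1)] z(1)]) (use lZ in auto)
      then show ?thesis unfolding kills_def by (rule mono_zero[OF _ _ _ *]) (use lZ aa aD(2) za zo in auto)
    qed
    have tz: "t \<cdot> z \<in> Arr A" "Dom A (t \<cdot> z) = ?Z" "Cod A (t \<cdot> z) = ?C" using ta za z(2) k(4,5) by auto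
    obtain e i where ei: "is_epi A e" "is_mono A i" "Dom A i = Cod A e" "Dom A e = ?Z" "Cod A i = ?C" "i \<cdot> e = t \<cdot> z"
      using image[OF tz(1)] tz by metis
    have ea: "e \<in> Arr A" "i \<in> Arr A" using ei by auto
    \<comment> \<open>Otherwise Z would lie in Q' and so belong to \<open>X\<close>, and the choice
      of \<open>z\<close> would put Q in \<open>X\<close>.\<close>
    have "\<not> is_zero A (Cod A e)"
    proof
      assume zz: "is_zero A (Cod A e)"
      have "zero_arrow A e" by (rule zero_arrowI[OF zz]) (use ea in auto)
      then have "zero_arrow A (i \<cdot> e)" by (rule zero_cmpL) (use ea ei in auto)
      then have "zero_arrow A (t \<cdot> z)" unfolding ei(6) .
      then obtain v where v: "v \<in> Arr A" "Dom A v = ?Z" "Cod A v = Dom A w" "w \<cdot> v = z"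
        using kernel_lift[OF k(7), of z] za z(2) k(4) by auto
      have "is_mono A v" by (rule mono_cancel[of w v]) (use v wD z in auto)
      then have "?Z \<in> X" using X_sub[of v] v wm mm by simp
      then show False using z(4) notX by blast
    qed
    then obtain s where s: "is_mono A s" "Cod A s = Cod A e" "prime_object (Dom A s)" using prime_sub_exists[of "Cod A e"] ea by auto
    let ?D = "Dom A s"
    have sa: "s \<in> Arr A" using s by simp
    have "is_mono A (i \<cdot> s)" by (rule mono_cmp[OF s(1) ei(2)]) (use s ei in simp)
    \<comment> \<open>D is a nonzero subobject of the prime C, so the two have the same
      annihilator.\<close>
    then have killsD: "kills j ?D \<longleftrightarrow> kills j ?C" if j: "j \<in> Arr A" "Cod A j = Unit A" for j
      using prime_objectD(4)[OF c(3), of "i \<cdot> s" j] prime_objectD(2)[OF s(3)] sa ea s(2) ei(3,5) j by simp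
    have D_LSupp: "orbit_class ?D \<in> LSupp A ?Z"
    proof -
      \<comment> \<open>D is a subobject of the image of Z in C; its preimage in Z shows it as a
        subquotient of Z.\<close>
      obtain k' t' where kt: "is_mono A k'" "t' \<in> Arr A" "Cod A k' = Dom A e" "Dom A t' = Dom A k'" "Cod A t' = Dom A s" "e \<cdot> k' = s \<cdot> t'"
        "is_epi A e \<Longrightarrow> is_epi A t'" "is_mono A e \<Longrightarrow> is_mono A t'"
        "\<And>x y. x \<in> Arr A \<Longrightarrow> y \<in> Arr A \<Longrightarrow> Cod A x = Dom A e \<Longrightarrow> Cod A y = Dom A s \<Longrightarrow> Dom A x = Dom A y \<Longrightarrow> e \<cdot> x = s \<cdot> y \<Longrightarrow>
         \<exists>w \<in> Arr A. Dom A w = Dom A x \<and> Cod A w = Dom A k' \<and> k' \<cdot> w = x"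
        by (rule preimageE[OF ea(1) s(1,2)]) (rule that)
      show ?thesis using LSuppI[OF kt(1) kt(7)[OF ei(1)] kt(4)] prime_monoform[OF s(3)] kt(3,5) ei(4) by simp
    qed
    obtain y where y: "y \<in> LAss A ?Z" "y \<in> LSpec_top A closure_of {orbit_class ?D}" using specialization[OF zo D_LSupp] by blast
    obtain h where h: "is_mono A h" "Cod A h = ?Z" "monoform A (Dom A h)" "y = orbit_class (Dom A h)" using y(1) by (rule LAssE)
    have ha: "h \<in> Arr A" using h by simp
    \<comment> \<open>A point of \<open>LAss\<close> comes with a monoform representative only; a
      prime inside it has the same atom and brings annihilators into play.\<close>
    obtain p where p: "is_mono A p" "Cod A p = Dom A h" "prime_object (Dom A p)"
      using prime_sub_exists[OF monoformD(1,2)[OF h(3)]] by blast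
    let ?E = "Dom A p"
    have pa: "p \<in> Arr A" using p by simp
    have Eo: "?E \<in> Obj A" using pa by simp
    have yE: "y = orbit_class ?E" using atom_sub[of p] p h prime_objectD(2)[OF p(3)] by simp
    have hp: "is_mono A (h \<cdot> p)" "Dom A (h \<cdot> p) = ?E" "Cod A (h \<cdot> p) = ?Z" using mono_cmp[OF p(1) h(1)] p h ha pa by simp_all
    have "y \<in> LSupp A ?E" using LAss_subset_LSupp[of ?E] LAss_monoform[OF prime_monoform[OF p(3)]] yE by blast
    \<comment> \<open>\<open>LSupp A ?E\<close> is an open neighbourhood of \<open>y\<close>, so it
      meets the singleton whose closure contains \<open>y\<close>.\<close>
    then have "orbit_class ?D \<in> LSupp A ?E" using y(2) openin_LSupp[OF Eo] unfolding in_closure_of by blast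
    then have ED: "kills j ?E \<Longrightarrow> kills j ?D" if "j \<in> Arr A" "Cod A j = Unit A" for j
      using LSupp_kills_prime[OF s(3)] that by blast
    \<comment> \<open>Conversely, what kills C factors through \<open>a\<close>, which kills Z and
      therefore its subobject E.\<close>
    have CE: "kills j ?E" if j: "j \<in> Arr A" "Cod A j = Unit A" "kills j ?C" for j
    proof -
      obtain u where u: "u \<in> Arr A" "Dom A u = Dom A j" "Cod A u = ?J" "a \<cdot> u = j" using subobject_leE[OF aD(4)[OF j]] by metis
      have "kills (a \<cdot> u) ?Z" by (rule kills_cmp[OF killsZ aa]) (use u zo in auto)
      then have "kills j (Cod A (h \<cdot> p))" using u(4) hp by simp
      from kills_sub[OF this hp(1) j(1,2)] show ?thesis using hp by simp
    qed
    have killsE: "kills j ?E \<longleftrightarrow> kills j ?C" if "j \<in> Arr A" "Cod A j = Unit A" for j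
      using ED CE killsD that by blast
    have "y \<in> LAss A ?Z" by (rule y)
    also have "LAss A ?Z \<subseteq> LAss A ?Q" using LAss_mono[OF z(1)] z(2) by simp
    also have "LAss A ?Q \<subseteq> LAss A M" using LAss_mono[OF k(1)] k(2) mm by simp
    also note LAss
    finally obtain x where x: "x \<in> X" "y \<in> LAss A x" unfolding LAss_class_def by blast
    obtain h' where h': "is_mono A h'" "Cod A h' = x" "monoform A (Dom A h')" "y = orbit_class (Dom A h')" using x(2) by (rule LAssE)
    \<comment> \<open>The orbit of E also occurs in an object of \<open>X\<close>, which yields a
      prime F in \<open>X\<close> with the annihilator of C. C is then a twist of F, hence in
      \<open>X\<close> by L-closedness.\<close>
    obtain p' where p': "is_mono A p'" "Cod A p' = Dom A h'" "prime_object (Dom A p')"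
      using prime_sub_exists[OF monoformD(1,2)[OF h'(3)]] by blast
    let ?F = "Dom A p'"
    have "Dom A h' \<in> X" using X_sub[OF h'(1)] h'(2) x by simp
    then have FX: "?F \<in> X" using X_sub[OF p'(1)] p'(2) by simp
    have "orbit_class ?F = orbit_class ?E" using atom_sub[of p'] p' h' prime_objectD(2)[OF p'(3)] yE by simp
    then have "kills j ?F \<longleftrightarrow> kills j ?C" if "j \<in> Arr A" "Cod A j = Unit A" for j
      using prime_kills_eq[OF p'(3) p(3) _ that] killsE[OF that] by blast
    then obtain K N where KN: "invertible_object A K" "invertible_object A N" "isomorphic A (?F \<boxtimes> K) (?C \<boxtimes> N)"
      using prime_determined_by_annihilator[OF p'(3) c(3)] by blast
    obtain N' where N': "inverses N N'" using KN(2) invertible_iff by blast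
    have "?C \<boxtimes> N \<in> X" using X_isomorphic[OF KN(3)] X_tensor[OF FX KN(1)] by blast
    then have "(?C \<boxtimes> N) \<boxtimes> N' \<in> X" using X_tensor inverses_sym[OF N'] invertible_iff by blast
    then have "?C \<in> X" using X_isomorphic[OF inverses_cancel[OF N' Co]] by blast
    then show ?thesis using C_notX by blast
  qed
qed

lemma LAss_inv_LAss_class:
  assumes "\<And>M x. M \<in> Obj A \<Longrightarrow> x \<in> LSupp A M \<Longrightarrow> \<exists>y \<in> LAss A M. y \<in> LSpec_top A closure_of {x}"
  shows "LAss_inv A (LAss_class A X) = X"
proof
  show "LAss_inv A (LAss_class A X) \<subseteq> X" using mem_of_LAss_subset[OF assms] unfolding LAss_inv_def by auto
  show "X \<subseteq> LAss_inv A (LAss_class A X)" using X_noetherian unfolding LAss_inv_def LAss_class_def by auto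
qed

end

context invertibly_generated
begin

text \<open>Everything rests on \<open>LAss_mono\<close> and \<open>LAss_ext\<close>; a binary
  coproduct is treated as an extension through \<open>coproduct_noeth_kernel\<close>.\<close>

lemma torsion_free_LAss_inv: "torsion_free_class (noeth A) (LAss_inv A \<Phi>)"
proof -
  have mem: "x \<in> LAss_inv A \<Phi> \<longleftrightarrow> noetherian_object A x \<and> LAss A x \<subseteq> \<Phi>" for x unfolding LAss_inv_def by simp
  have ext: "c \<in> LAss_inv A \<Phi>" if "is_kernel A g f" "Cod A f = c" "noetherian_object A c" "Dom A f \<in> LAss_inv A \<Phi>" "Cod A g \<in> LAss_inv A \<Phi>" for f g c
    using LAss_ext[OF that(1)] that(2-5) unfolding mem by blast
  show ?thesis unfolding torsion_free_class_def additive_subcategory_def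
  proof (intro conjI allI ballI impI)
    show "LAss_inv A \<Phi> \<subseteq> Obj (noeth A)" using mem by auto
    show "b \<in> LAss_inv A \<Phi>" if ab: "a \<in> LAss_inv A \<Phi>" "isomorphic (noeth A) a b" for a b
    proof -
      have iso: "isomorphic A a b" using isomorphic_noeth ab by blast
      then show ?thesis using LAss_isomorphic[OF isomorphic_sym[OF iso]] noetherian_isomorphic[OF _ iso] ab(1) unfolding mem by blast
    qed
    show "z \<in> LAss_inv A \<Phi>" if z: "is_zero (noeth A) z" for z
    proof -
      have "is_zero A z" using z is_zero_noeth by blast
      then show ?thesis using noetherian_zero Ass_zero unfolding mem LAss_def by simp
    qed
    show "c \<in> LAss_inv A \<Phi>" if Y: "range Y \<subseteq> LAss_inv A \<Phi> \<and> is_coproduct (noeth A) UNIV Y c i" for Y :: "bool \<Rightarrow> 'o" and c i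
    proof -
      have cp: "is_coproduct (noeth A) UNIV Y c i" using Y by blast
      obtain p where p: "is_kernel A p (i True)" "Cod A p = Y False" using coproduct_noeth_kernel[OF cp] by blast
      have c: "noetherian_object A c" using cp unfolding is_coproduct_def by simp
      have "i True \<in> Hom (noeth A) (Y True) c" using cp unfolding is_coproduct_def by blast
      then have i: "Cod A (i True) = c" "Dom A (i True) = Y True" by auto
      show ?thesis by (rule ext[OF p(1)]) (use i c p Y in auto)
    qed
    show "Dom (noeth A) m \<in> LAss_inv A \<Phi>" if m: "is_mono (noeth A) m \<and> Cod (noeth A) m \<in> LAss_inv A \<Phi>" for m
    proof -
      have m: "is_mono A m" "Cod A m \<in> LAss_inv A \<Phi>" using m is_mono_noeth by auto
      then show ?thesis using LAss_mono[OF m(1)] noetherian_sub[OF m(1)] unfolding mem by auto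
    qed
    show "Cod (noeth A) f \<in> LAss_inv A \<Phi>"
      if h: "short_exact (noeth A) f g \<and> Dom (noeth A) f \<in> LAss_inv A \<Phi> \<and> Cod (noeth A) g \<in> LAss_inv A \<Phi>" for f g
    proof -
      have k: "is_kernel A g f" using short_exact_noethD h by blast
      have "f \<in> Arr (noeth A)" using h unfolding short_exact_def is_kernel_def by blast
      then show ?thesis using ext[OF k] h by simp
    qed
  qed
qed

lemma L_closed_LAss_inv: "L_closed A (LAss_inv A \<Phi>)"
  unfolding L_closed_def
proof (intro ballI allI impI)
  fix x L assume x: "x \<in> LAss_inv A \<Phi>" and "invertible_object A L"
  then obtain M where L: "inverses L M" using invertible_iff by blast
  have xn: "noetherian_object A x" using x unfolding LAss_inv_def by simp
  show "x \<boxtimes> L \<in> LAss_inv A \<Phi>"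
    using x noetherian_tensor[OF L xn] LAss_tensor[OF L noetherian_obj[OF xn]] unfolding LAss_inv_def by auto
qed

text \<open>Each orbit is the whole \<open>LAss\<close> of a noetherian object: a prime inside a
  monoform representative is noetherian and defines the same atom.\<close>

lemma LAss_class_LAss_inv:
  assumes "\<Phi> \<subseteq> LSpec A" shows "LAss_class A (LAss_inv A \<Phi>) = \<Phi>"
proof
  show "LAss_class A (LAss_inv A \<Phi>) \<subseteq> \<Phi>" unfolding LAss_class_def LAss_inv_def by auto
  show "\<Phi> \<subseteq> LAss_class A (LAss_inv A \<Phi>)"
  proof
    fix x assume x: "x \<in> \<Phi>"
    then obtain H where H: "monoform A H" "x = orbit_class H" using assms LSpec_iff by blast
    obtain m where m: "is_mono A m" "Cod A m = H" "prime_object (Dom A m)"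
      using prime_sub_exists[OF monoformD(1,2)[OF H(1)]] by blast
    have "orbit_class (Dom A m) = x" using atom_sub[of m] m H prime_objectD(2)[OF m(3)] by simp
    then have "LAss A (Dom A m) = {x}" using LAss_monoform[OF prime_monoform[OF m(3)]] by simp
    then show "x \<in> LAss_class A (LAss_inv A \<Phi>)"
      unfolding LAss_class_def LAss_inv_def using noetherian_prime[OF m(3)] x by (intro UN_I[of "Dom A m"]) auto
  qed
qed

end

section \<open>Finitely presented objects\<close>

lemma universe_card_facts:
  assumes "universe_card \<kappa>"
  shows "Card_order \<kappa>" "stable \<kappa>"
proof -
  show c: "Card_order \<kappa>" using assms unfolding universe_card_def by blast
  have "cinfinite \<kappa>" using assms cinfinite_mono[OF ordLess_imp_ordLeq natLeq_cinfinite] unfolding universe_card_def by blast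
  then show "stable \<kappa>" using c assms regularCard_stable unfolding universe_card_def cinfinite_def by blast
qed

lemma small_subset: "small \<kappa> B \<Longrightarrow> A \<subseteq> B \<Longrightarrow> small \<kappa> A"
  unfolding small_def using card_of_mono1 ordLeq_ordLess_trans by blast

lemma small_image: "small \<kappa> A \<Longrightarrow> small \<kappa> (f ` A)"
  unfolding small_def using card_of_image ordLeq_ordLess_trans by blast

lemma small_UN:
  assumes "universe_card \<kappa>" "small \<kappa> I" "\<And>i. i \<in> I \<Longrightarrow> small \<kappa> (A i)"
  shows "small \<kappa> (\<Union>i \<in> I. A i)"
  using assms stable_UNION[OF universe_card_facts(2)[OF assms(1)]] unfolding small_def by blast

lemma small_Times:
  assumes "universe_card \<kappa>" "small \<kappa> A" "small \<kappa> B" shows "small \<kappa> (A \<times> B)"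
  using assms(2,3) unfolding small_def by (rule stable_elim[OF universe_card_facts(2)[OF assms(1)]])

lemma small_imp_inj:
  fixes \<kappa> :: "'k rel"
  assumes "universe_card \<kappa>" "small \<kappa> A"
  shows "\<exists>f :: 'a \<Rightarrow> 'k. inj_on f A \<and> f ` A \<subseteq> Field \<kappa>"
proof -
  have "|A| \<le>o |Field \<kappa>|"
    using assms(2) card_of_Field_ordIso[OF universe_card_facts(1)[OF assms(1)]]
    unfolding small_def by (meson ordIso_symmetric ordLeq_ordIso_trans ordLess_imp_ordLeq)
  then show ?thesis using card_of_ordLeq by metis
qed

text \<open>The strong limit property is stated for subsets of \<open>Field \<kappa>\<close>, so
  \<open>T\<close> is moved there by an injection, and finite subsets are recovered from the power
  set of its image.\<close>

lemma small_finite_subsets: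
  fixes \<kappa> :: "'k rel" and T :: "'a set"
  assumes "universe_card \<kappa>" "small \<kappa> T" shows "small \<kappa> {F. finite F \<and> F \<subseteq> T}"
proof -
  obtain f :: "'a \<Rightarrow> 'k" where f: "inj_on f T" "f ` T \<subseteq> Field \<kappa>" using small_imp_inj[OF assms] by blast
  have "small \<kappa> (Pow (f ` T))" using assms(1) f(2) small_image[OF assms(2), of f] unfolding universe_card_def small_def by blast
  then have "small \<kappa> ((\<lambda>S. {x \<in> T. f x \<in> S}) ` Pow (f ` T))" by (rule small_image)
  moreover have "{F. finite F \<and> F \<subseteq> T} \<subseteq> (\<lambda>S. {x \<in> T. f x \<in> S}) ` Pow (f ` T)"
  proof
    fix F assume F: "F \<in> {F. finite F \<and> F \<subseteq> T}"
    then have "F = {x \<in> T. f x \<in> f ` F}" using inj_on_image_mem_iff[OF f(1)] by blast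
    moreover have "f ` F \<in> Pow (f ` T)" using F by blast
    ultimately show "F \<in> (\<lambda>S. {x \<in> T. f x \<in> S}) ` Pow (f ` T)" by blast
  qed
  ultimately show ?thesis by (rule small_subset)
qed

context abelian_category
begin

text \<open>\<open>m\<close> plays the part of the sum of the images of the arrows in
  \<open>F\<close>. The inductive step takes the preimage of the image of \<open>t\<close> in the
  quotient by \<open>m\<close>, an extension of noetherian objects.\<close>

lemma noetherian_sub_containing:
  assumes "finite F" "\<And>t. t \<in> F \<Longrightarrow> t \<in> Arr C \<and> Cod C t = P \<and> noetherian_object C (Dom C t)" "P \<in> Obj C"
  shows "\<exists>m. is_mono C m \<and> Cod C m = P \<and> noetherian_object C (Dom C m) \<and>
    (\<forall>t \<in> F. \<exists>h \<in> Arr C. Dom C h = Dom C t \<and> Cod C h = Dom C m \<and> m \<cdot> h = t)"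
  using assms(1,2)
proof (induction F)
  case empty
  obtain z where z: "is_zero C z" using zero_exists by blast
  then obtain m where "is_mono C m" "Dom C m = z" "Cod C m = P" using mono_from_zero[OF z assms(3)] by blast
  then show ?case using noetherian_zero[OF z] by blast
next
  case (insert t F)
  obtain m where m: "is_mono C m" "Cod C m = P" "noetherian_object C (Dom C m)"
    "\<forall>t \<in> F. \<exists>h \<in> Arr C. Dom C h = Dom C t \<and> Cod C h = Dom C m \<and> m \<cdot> h = t" using insert by blast
  have t: "t \<in> Arr C" "Cod C t = P" "noetherian_object C (Dom C t)" using insert by auto
  have ma: "m \<in> Arr C" using m by simp
  obtain q where q: "is_cokernel C m q" using cokernel_exists[OF ma] by blast
  note qD = cokernelD[OF q]
  have qt: "q \<cdot> t \<in> Arr C" "Dom C (q \<cdot> t) = Dom C t" "Cod C (q \<cdot> t) = Cod C q" using qD m t by auto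
  obtain e c where ec: "is_epi C e" "is_mono C c" "Dom C c = Cod C e" "Dom C e = Dom C t" "Cod C c = Cod C q" "c \<cdot> e = q \<cdot> t"
    using image[OF qt(1)] qt by metis
  have en: "noetherian_object C (Cod C e)" using noetherian_quot[OF ec(1)] ec t by simp
  obtain k t' w where k: "is_mono C k" "Cod C k = Cod C m" "is_epi C t'" "Dom C t' = Dom C k" "Cod C t' = Dom C c" "q \<cdot> k = c \<cdot> t'"
      "is_kernel C t' w" "k \<cdot> w = m" "Dom C w = Dom C m" "Cod C w = Dom C k"
    using preimage_kernel[OF m(1) q ec(2,5)] by blast
  note wD = kernelD[OF k(7)] and wm = k(9) and wk = k(10)
  have ka: "k \<in> Arr C" "t' \<in> Arr C" "c \<in> Arr C" "e \<in> Arr C" using k ec by auto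
  have kn: "noetherian_object C (Dom C k)" using noetherian_ext[OF k(7)] wm wk m(3) k(5) ec(3) en by simp
  obtain r where r: "is_cokernel C k r" using cokernel_exists[OF ka(1)] by blast
  note rD = cokernelD[OF r]
  have lift: "\<exists>h \<in> Arr C. Dom C h = Dom C s \<and> Cod C h = Dom C k \<and> k \<cdot> h = s"
    if s: "s \<in> Arr C" "Cod C s = P" "zero_arrow C (r \<cdot> s)" for s
    using kernel_lift[OF mono_kernel_of_cokernel[OF k(1) r], of s] s rD k(2) m(2) by simp
  have rm: "zero_arrow C (r \<cdot> m)"
  proof -
    have "zero_arrow C ((r \<cdot> k) \<cdot> w)" by (rule zero_cmpR[OF rD(4)]) (use wD wk rD ka in auto)
    then show ?thesis using wD wk rD ka k(8) by simp
  qed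
  \<comment> \<open>\<open>r\<close> kills \<open>m\<close> and so factors through \<open>q\<close>
    as \<open>v\<close>. Then \<open>v \<cdot> c\<close> vanishes because it does after the epi
    \<open>t'\<close>, and \<open>r \<cdot> t\<close> equals
    \<open>(v \<cdot> c) \<cdot> e\<close>.\<close>
  have "zero_arrow C (r \<cdot> t)"
  proof -
    obtain v where v: "v \<in> Arr C" "Dom C v = Cod C q" "v \<cdot> q = r" using cokernel_desc[OF q, of r] rm rD k(2) by auto
    have "v \<cdot> q \<cdot> k = r \<cdot> k" by (rule cmp_extend[OF v(3)]) (use v qD ka k(2) in auto)
    then have "(v \<cdot> c) \<cdot> t' = r \<cdot> k" using k(6) v ka k(5) ec(5) by simp
    then have "zero_arrow C ((v \<cdot> c) \<cdot> t')" using rD by simp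
    then have "zero_arrow C (v \<cdot> c)" by (rule epi_zero[OF k(3), rotated 2]) (use v ka k(5) ec(5) in auto)
    then have "zero_arrow C ((v \<cdot> c) \<cdot> e)" by (rule zero_cmpR) (use v ka ec(3,5) in auto)
    also have "(v \<cdot> c) \<cdot> e = v \<cdot> (q \<cdot> t)" using v ka ec(3,5,6) by simp
    also have "\<dots> = r \<cdot> t" by (rule cmp_extend[OF v(3)]) (use v qD t m(2) in auto)
    finally show ?thesis .
  qed
  then have ht: "\<exists>h \<in> Arr C. Dom C h = Dom C t \<and> Cod C h = Dom C k \<and> k \<cdot> h = t" using lift t by blast
  have hF: "\<exists>h \<in> Arr C. Dom C h = Dom C s \<and> Cod C h = Dom C k \<and> k \<cdot> h = s" if s: "s \<in> F" for s
  proof (rule lift)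
    show "s \<in> Arr C" "Cod C s = P" using insert.prems s by auto
    obtain h where h: "h \<in> Arr C" "Cod C h = Dom C m" "m \<cdot> h = s" using m(4) s by blast
    have "zero_arrow C ((r \<cdot> m) \<cdot> h)" by (rule zero_cmpR[OF rm]) (use h ma rD k(2) in auto)
    then show "zero_arrow C (r \<cdot> s)" using h ma rD k(2) by simp
  qed
  show ?case using k(1,2) m(2) kn ht hF by (intro exI[of _ k]) simp
qed

text \<open>The quotient of \<open>P\<close> by the sum of the images of the arrows in
  \<open>F\<close>, given by its universal property so that no coproduct of their domains has to be
  formed.\<close>

definition joint_cokernel :: "'o \<Rightarrow> 'm set \<Rightarrow> 'm \<Rightarrow> bool" where
  "joint_cokernel P F q \<longleftrightarrow> is_epi C q \<and> Dom C q = P \<and> (\<forall>t \<in> F. zero_arrow C (q \<cdot> t)) \<and>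
    (\<forall>g \<in> Arr C. Dom C g = P \<and> (\<forall>t \<in> F. zero_arrow C (g \<cdot> t)) \<longrightarrow>
       (\<exists>u \<in> Arr C. Dom C u = Cod C q \<and> Cod C u = Cod C g \<and> u \<cdot> q = g))"

lemma joint_cokernel_exists:
  assumes "finite F" "\<And>t. t \<in> F \<Longrightarrow> t \<in> Arr C \<and> Cod C t = P" "P \<in> Obj C"
  shows "\<exists>q. joint_cokernel P F q"
  using assms(1,2)
proof (induction F)
  case empty
  have "joint_cokernel P {} (Idn C P)" unfolding joint_cokernel_def
    using iso_epi[OF idn_iso[OF assms(3)]] assms(3) by (auto intro!: bexI)
  then show ?case by blast
next
  case (insert t F)
  obtain q where q: "joint_cokernel P F q" using insert by blast
  have qD: "is_epi C q" "Dom C q = P" "\<And>s. s \<in> F \<Longrightarrow> zero_arrow C (q \<cdot> s)"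
    and qu: "\<And>g. g \<in> Arr C \<Longrightarrow> Dom C g = P \<Longrightarrow> (\<And>s. s \<in> F \<Longrightarrow> zero_arrow C (g \<cdot> s)) \<Longrightarrow>
       \<exists>u \<in> Arr C. Dom C u = Cod C q \<and> Cod C u = Cod C g \<and> u \<cdot> q = g"
    using q unfolding joint_cokernel_def by blast+
  have t: "t \<in> Arr C" "Cod C t = P" using insert by auto
  have qa: "q \<in> Arr C" using qD by simp
  have qt: "q \<cdot> t \<in> Arr C" "Cod C (q \<cdot> t) = Cod C q" using qa qD t by auto
  obtain c where c: "is_cokernel C (q \<cdot> t) c" using cokernel_exists[OF qt(1)] by blast
  note cD = cokernelD[OF c]
  have cq: "is_epi C (c \<cdot> q)" by (rule epi_cmp[OF qD(1) cokernel_epi[OF c]]) (use cD qt in auto)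
  have "joint_cokernel P (insert t F) (c \<cdot> q)" unfolding joint_cokernel_def
  proof (intro conjI ballI impI)
    show "Dom C (c \<cdot> q) = P" using qa qD(2) cD qt by simp
    show "zero_arrow C ((c \<cdot> q) \<cdot> s)" if s: "s \<in> insert t F" for s
    proof -
      have sa: "s \<in> Arr C" "Cod C s = P" using insert.prems s by auto
      have "zero_arrow C (c \<cdot> (q \<cdot> s))"
      proof (cases "s = t")
        case False
        then have "zero_arrow C (q \<cdot> s)" using s qD(3) by blast
        then show ?thesis by (rule zero_cmpL) (use qD(2) sa cD qt qa in auto)
      qed (use cD in simp)
      then show ?thesis using sa qa qD(2) cD qt by simp
    qed
    fix g assume g: "g \<in> Arr C" "Dom C g = P \<and> (\<forall>s \<in> insert t F. zero_arrow C (g \<cdot> s))"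
    obtain u where u: "u \<in> Arr C" "Dom C u = Cod C q" "Cod C u = Cod C g" "u \<cdot> q = g" using qu[of g] g by blast
    have "u \<cdot> q \<cdot> t = g \<cdot> t" by (rule cmp_extend[OF u(4)]) (use u qa qD(2) t in auto)
    then have "zero_arrow C (u \<cdot> (q \<cdot> t))" using g by simp
    then obtain v where v: "v \<in> Arr C" "Cod C v = Cod C u" "Dom C v = Cod C c" "v \<cdot> c = u"
      using cokernel_desc[OF c, of u] u qt by auto
    have "v \<cdot> c \<cdot> q = u \<cdot> q" by (rule cmp_extend[OF v(4)]) (use v cD qa qt in auto)
    then show "\<exists>u\<in>Arr C. Dom C u = Cod C (c \<cdot> q) \<and> Cod C u = Cod C g \<and> u \<cdot> c \<cdot> q = g"
      using u v(1-3) cD qa qt by (intro bexI[of _ v]) simp_all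
  qed (fact cq)
  then show ?case by blast
qed

text \<open>The cokernels of the images of finitely many arrows from noetherian generators to \<open>P\<close> form a
  filtered system with colimit \<open>0\<close>; finite presentation makes the arrow from \<open>P\<close> to one of them
  zero, so that \<open>P\<close> is a finite sum of images of noetherian objects. The finite sets of arrows are
  encoded by \<open>enc\<close> because index categories must have their objects in \<open>'k\<close>.\<close>

lemma finitely_presented_noetherian:
  fixes \<kappa> :: "'k rel"
  assumes \<kappa>: "universe_card \<kappa>" and ls: "locally_small \<kappa> C" and ln: "locally_noetherian \<kappa> C"
    and fp: "finitely_presented \<kappa> C P"
  shows "noetherian_object C P"
proof -
  have Po: "P \<in> Obj C" using fp unfolding finitely_presented_def by blast
  obtain S where S: "small \<kappa> S" "generating C S" "\<And>M. M \<in> S \<Longrightarrow> noetherian_object C M"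
    using ln unfolding locally_noetherian_def by blast
  define T where "T = (\<Union>s \<in> S. Hom C s P)"
  have "small \<kappa> T" unfolding T_def
    by (rule small_UN[OF \<kappa> S(1)]) (use S(3) noetherian_obj ls Po in \<open>auto simp only: locally_small_def\<close>)
  have T: "t \<in> Arr C" "Cod C t = P" "noetherian_object C (Dom C t)" if "t \<in> T" for t
    using that S(3) unfolding T_def by auto
  define \<F> where "\<F> = {F. finite F \<and> F \<subseteq> T}"
  have \<F>_small: "small \<kappa> \<F>" unfolding \<F>_def using small_finite_subsets[OF \<kappa> \<open>small \<kappa> T\<close>] .
  obtain enc :: "'m set \<Rightarrow> 'k" where enc: "inj_on enc \<F>" using small_imp_inj[OF \<kappa> \<F>_small] by blast
  define dec where "dec = inv_into \<F> enc"
  have dec [simp]: "dec (enc F) = F" if "F \<in> \<F>" for F unfolding dec_def using inv_into_f_f[OF enc that] .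
  have "\<exists>q. joint_cokernel P F q" if "F \<in> \<F>" for F
    using joint_cokernel_exists[of F P] that T Po unfolding \<F>_def by blast
  then obtain q where q: "\<And>F. F \<in> \<F> \<Longrightarrow> joint_cokernel P F (q F)" by metis
  have qD: "is_epi C (q F)" "q F \<in> Arr C" "Dom C (q F) = P" if "F \<in> \<F>" for F
    using q[OF that] unfolding joint_cokernel_def by auto
  have q0: "zero_arrow C (q F \<cdot> t)" if "F \<in> \<F>" "t \<in> F" for F t
    using q[OF that(1)] that(2) unfolding joint_cokernel_def by blast
  have qu: "\<exists>u \<in> Arr C. Dom C u = Cod C (q F) \<and> Cod C u = Cod C g \<and> u \<cdot> q F = g"
    if "F \<in> \<F>" "g \<in> Arr C" "Dom C g = P" "\<And>t. t \<in> F \<Longrightarrow> zero_arrow C (g \<cdot> t)" for F g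
    using q[OF that(1)] that(2-4) unfolding joint_cokernel_def by blast
  \<comment> \<open>The canonical arrow from P/F to P/G for \<open>F \<subseteq> G\<close>, where
    P/F is the quotient of \<open>P\<close> by the images of the arrows in \<open>F\<close>.\<close>
  define tr where "tr F G = (SOME u. u \<in> Arr C \<and> Dom C u = Cod C (q F) \<and> Cod C u = Cod C (q G) \<and> u \<cdot> q F = q G)" for F G
  have tr: "tr F G \<in> Arr C" "Dom C (tr F G) = Cod C (q F)" "Cod C (tr F G) = Cod C (q G)" "tr F G \<cdot> q F = q G"
    if FG: "F \<in> \<F>" "G \<in> \<F>" "F \<subseteq> G" for F G
  proof -
    have "\<exists>u. u \<in> Arr C \<and> Dom C u = Cod C (q F) \<and> Cod C u = Cod C (q G) \<and> u \<cdot> q F = q G"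
      using qu[OF FG(1) qD(2,3)[OF FG(2)]] q0[OF FG(2)] FG(3) by blast
    from someI_ex[OF this] show "tr F G \<in> Arr C" "Dom C (tr F G) = Cod C (q F)" "Cod C (tr F G) = Cod C (q G)" "tr F G \<cdot> q F = q G"
      unfolding tr_def by auto
  qed
  have tr_refl: "tr F F = Idn C (Cod C (q F))" if F: "F \<in> \<F>" for F
  proof -
    note t = tr[OF F F order_refl] and qF = qD[OF F]
    have "tr F F \<cdot> q F = Idn C (Cod C (q F)) \<cdot> q F" using t(4) qF by simp
    then show ?thesis by (rule epiD[OF qF(1)]) (use t(1-3) qF in auto)
  qed
  have tr_trans: "tr G H \<cdot> tr F G = tr F H" if h: "F \<in> \<F>" "G \<in> \<F>" "H \<in> \<F>" "F \<subseteq> G" "G \<subseteq> H" for F G H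
  proof -
    note a = tr[OF h(1,2,4)] and b = tr[OF h(2,3,5)] and c = tr[OF h(1,3) order_trans[OF h(4,5)]] and qF = qD[OF h(1)]
    have "(tr G H \<cdot> tr F G) \<cdot> q F = tr F H \<cdot> q F" using a b c qF by simp
    then show ?thesis by (rule epiD[OF qF(1)]) (use a(1-3) b(1-3) c(1-3) qF in auto)
  qed
  define J :: "('k, 'k \<times> 'k) cat" where
    "J = \<lparr>Obj = enc ` \<F>, Arr = {(enc F, enc G) | F G. F \<in> \<F> \<and> G \<in> \<F> \<and> F \<subseteq> G}, Dom = fst, Cod = snd,
      Idn = (\<lambda>a. (a, a)), Cmp = (\<lambda>g f. (fst f, snd g))\<rparr>"
  have J: "Obj J = enc ` \<F>" "Arr J = {(enc F, enc G) | F G. F \<in> \<F> \<and> G \<in> \<F> \<and> F \<subseteq> G}" "Dom J = fst" "Cod J = snd"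
    "Idn J = (\<lambda>a. (a, a))" "Cmp J = (\<lambda>g f. (fst f, snd g))" unfolding J_def by simp_all
  have enc_eq: "enc F = enc G \<longleftrightarrow> F = G" if "F \<in> \<F>" "G \<in> \<F>" for F G using enc that by (simp add: inj_on_eq_iff)
  have cat: "category J"
    by (unfold_locales; simp only: in_Hom J; force simp: enc_eq)
  have un: "F \<union> G \<in> \<F>" if "F \<in> \<F>" "G \<in> \<F>" for F G using that unfolding \<F>_def by auto
  have e0: "{} \<in> \<F>" unfolding \<F>_def by simp
  have sf: "small_filtered \<kappa> J" unfolding small_filtered_def
  proof (intro conjI)
    show "small \<kappa> (Obj J)" unfolding J by (rule small_image[OF \<F>_small])
    have "Arr J \<subseteq> enc ` \<F> \<times> enc ` \<F>" unfolding J by auto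
    then show "small \<kappa> (Arr J)" using small_subset[OF small_Times[OF \<kappa> small_image[OF \<F>_small] small_image[OF \<F>_small]]] by blast
    show "Obj J \<noteq> {}" unfolding J using e0 by blast
    show "\<forall>i\<in>Obj J. \<forall>j\<in>Obj J. \<exists>k\<in>Obj J. Hom J i k \<noteq> {} \<and> Hom J j k \<noteq> {}"
    proof (intro ballI)
      fix i j assume "i \<in> Obj J" "j \<in> Obj J"
      then obtain F G where FG: "F \<in> \<F>" "G \<in> \<F>" "i = enc F" "j = enc G" unfolding J by blast
      have "(i, enc (F \<union> G)) \<in> Hom J i (enc (F \<union> G))" "(j, enc (F \<union> G)) \<in> Hom J j (enc (F \<union> G))"
        unfolding in_Hom J using FG un[OF FG(1,2)] by auto
      moreover have "enc (F \<union> G) \<in> Obj J" unfolding J using un[OF FG(1,2)] by blast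
      ultimately show "\<exists>k\<in>Obj J. Hom J i k \<noteq> {} \<and> Hom J j k \<noteq> {}" by blast
    qed
    show "\<forall>i j. \<forall>f\<in>Hom J i j. \<forall>g\<in>Hom J i j. \<exists>k. \<exists>h\<in>Hom J j k. h \<cdot>\<^bsub>J\<^esub> f = h \<cdot>\<^bsub>J\<^esub> g"
    proof (intro allI ballI)
      fix i j f g assume fg: "f \<in> Hom J i j" "g \<in> Hom J i j"
      then have "f = g" unfolding in_Hom J by (auto simp: prod_eq_iff)
      moreover have "(j, j) \<in> Hom J j j"
      proof -
        have "j \<in> Obj J" using fg(1) category.dom_cod[OF cat] unfolding in_Hom by blast
        then show ?thesis using category.idn_in_Hom[OF cat] J(5) by simp
      qed
      ultimately show "\<exists>k. \<exists>h\<in>Hom J j k. h \<cdot>\<^bsub>J\<^esub> f = h \<cdot>\<^bsub>J\<^esub> g" by blast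
    qed
  qed (fact cat)
  define D :: "('k, 'k \<times> 'k, 'o, 'm) func" where
    "D = \<lparr>FObj = (\<lambda>a. Cod C (q (dec a))), FArr = (\<lambda>f. tr (dec (fst f)) (dec (snd f)))\<rparr>"
  have D: "FObj D = (\<lambda>a. Cod C (q (dec a)))" "FArr D = (\<lambda>f. tr (dec (fst f)) (dec (snd f)))" unfolding D_def by simp_all
  have isfun: "is_functor J C D" unfolding is_functor_def
  proof (intro conjI ballI impI)
    fix i assume "i \<in> Obj J"
    then obtain F where F: "F \<in> \<F>" "i = enc F" unfolding J by blast
    show "FObj D i \<in> Obj C" "FArr D (Idn J i) = Idn C (FObj D i)" unfolding D J using F qD[OF F(1)] tr_refl[OF F(1)] by simp_all
  next
    fix f assume "f \<in> Arr J"
    then obtain F G where F: "F \<in> \<F>" "G \<in> \<F>" "F \<subseteq> G" "f = (enc F, enc G)" unfolding J by blast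
    show "FArr D f \<in> Hom C (FObj D (Dom J f)) (FObj D (Cod J f))" unfolding D J using F tr[OF F(1-3)] by simp
    fix g assume "g \<in> Arr J" "Dom J g = Cod J f"
    then obtain H where H: "H \<in> \<F>" "G \<subseteq> H" "g = (enc G, enc H)" unfolding J using F enc_eq by auto
    show "FArr D (g \<cdot>\<^bsub>J\<^esub> f) = FArr D g \<cdot> FArr D f" unfolding D J using F H tr_trans[OF F(1,2) H(1) F(3) H(2)] by simp
  qed (use cat category_axioms in auto)
  obtain z where z: "is_zero C z" using zero_exists by blast
  have "\<exists>f. f \<in> Arr C \<and> Dom C f = a \<and> Cod C f = z" if "a \<in> Obj C" for a using zero_obj_ex(1)[OF z that] by blast
  then obtain \<zeta> where \<zeta>: "\<And>a. a \<in> Obj C \<Longrightarrow> \<zeta> a \<in> Arr C \<and> Dom C (\<zeta> a) = a \<and> Cod C (\<zeta> a) = z" by metis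
  define s where "s a = \<zeta> (FObj D a)" for a
  have objD: "FObj D a \<in> Obj C" if "a \<in> Obj J" for a using isfun that unfolding is_functor_def by blast
  have s: "s a \<in> Arr C" "Dom C (s a) = FObj D a" "Cod C (s a) = z" if "a \<in> Obj J" for a
    unfolding s_def using \<zeta>[OF objD[OF that]] by auto
  have arrD: "FArr D f \<in> Arr C" "Dom C (FArr D f) = FObj D (Dom J f)" "Cod C (FArr D f) = FObj D (Cod J f)"
    "Dom J f \<in> Obj J" "Cod J f \<in> Obj J" if "f \<in> Arr J" for f
    using isfun that category.dom_cod[OF cat that] unfolding is_functor_def by auto
  have colim: "is_colimit J C D z s" unfolding is_colimit_def
  proof (intro conjI allI impI)
    show "is_cocone J C D z s" unfolding is_cocone_def
    proof (intro conjI ballI)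
      show "z \<in> Obj C" by (rule zero_objD[OF z])
      show "s i \<in> Hom C (FObj D i) z" if "i \<in> Obj J" for i using s[OF that] by simp
      show "s (Cod J f) \<cdot> FArr D f = s (Dom J f)" if f: "f \<in> Arr J" for f
        by (rule zero_obj_unique[OF z]) (use s[OF arrD(4)[OF f]] s[OF arrD(5)[OF f]] arrD(1-3)[OF f] in auto)
    qed
    fix d t assume cc: "is_cocone J C D d t"
    then have d: "d \<in> Obj C" and t: "\<And>i. i \<in> Obj J \<Longrightarrow> t i \<in> Arr C \<and> Dom C (t i) = FObj D i \<and> Cod C (t i) = d"
      and tn: "\<And>f. f \<in> Arr J \<Longrightarrow> t (Cod J f) \<cdot> FArr D f = t (Dom J f)"
      unfolding is_cocone_def by auto
    have tz: "zero_arrow C (t i)" if i: "i \<in> Obj J" for i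
    proof -
      obtain F where F: "F \<in> \<F>" "i = enc F" using i unfolding J by blast
      note qF = qD[OF F(1)]
      have ti: "t i \<in> Arr C" "Dom C (t i) = Cod C (q F)" "Cod C (t i) = d" using t[OF i] F unfolding D by auto
      \<comment> \<open>An arrow \<open>x\<close> from a generator dies at the stage
        \<open>insert x F\<close>, so a cocone component kills all of them; the generators then
        force the component to vanish.\<close>
      have kill: "zero_arrow C ((t i \<cdot> q F) \<cdot> x)" if x: "x \<in> T" for x
      proof -
        define G where "G = insert x F"
        have G: "G \<in> \<F>" "F \<subseteq> G" "x \<in> G" using F x unfolding G_def \<F>_def by auto
        note qG = qD[OF G(1)] and trG = tr[OF F(1) G(1,2)]
        have j: "enc G \<in> Obj J" unfolding J using G by blast
        have tj: "t (enc G) \<in> Arr C" "Dom C (t (enc G)) = Cod C (q G)" "Cod C (t (enc G)) = d" using t[OF j] G unfolding D by auto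
        have "(enc F, enc G) \<in> Arr J" unfolding J using F G by blast
        from tn[OF this] have eq: "t (enc G) \<cdot> tr F G = t i" unfolding D J using F G by simp
        have "(t i \<cdot> q F) = t (enc G) \<cdot> (tr F G \<cdot> q F)" unfolding eq[symmetric] using tj trG(1-3) qF by simp
        then have eq2: "t i \<cdot> q F = t (enc G) \<cdot> q G" unfolding trG(4) .
        have "zero_arrow C (t (enc G) \<cdot> (q G \<cdot> x))" by (rule zero_cmpL[OF q0[OF G(1,3)]]) (use tj qG T[OF x] in auto)
        then show ?thesis unfolding eq2 using tj qG T[OF x] by simp
      qed
      have "zero_arrow C (t i \<cdot> q F)"
      proof (rule ccontr)
        assume nz: "\<not> zero_arrow C (t i \<cdot> q F)"
        obtain n where n: "zero_arrow C n" "Dom C n = P" "Cod C n = d" using zero_arrow_exists[OF Po d] by blast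
        have hom: "t i \<cdot> q F \<in> Hom C P d" "n \<in> Hom C P d" using ti qF n by auto
        have "t i \<cdot> q F \<noteq> n" using nz n by blast
        then obtain M x where x: "M \<in> S" "x \<in> Hom C M P" "(t i \<cdot> q F) \<cdot> x \<noteq> n \<cdot> x"
          using S(2) hom unfolding generating_def by blast
        then have xT: "x \<in> T" unfolding T_def by blast
        have "zero_arrow C (n \<cdot> x)" by (rule zero_cmpR[OF n(1)]) (use x n in auto)
        then have "(t i \<cdot> q F) \<cdot> x = n \<cdot> x" by (rule zero_arrow_unique[OF kill[OF xT]]) (use x n ti qF in auto)
        then show False using x by simp
      qed
      then show ?thesis by (rule epi_zero[OF qF(1), rotated 2]) (use ti in auto)
    qed
    obtain u where u: "u \<in> Arr C" "Dom C u = z" "Cod C u = d" using zero_obj_ex(2)[OF z d] by blast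
    show "\<exists>!u. u \<in> Hom C z d \<and> (\<forall>i\<in>Obj J. u \<cdot> s i = t i)"
    proof (rule ex1I[of _ u])
      have "u \<cdot> s i = t i" if i: "i \<in> Obj J" for i
      proof (rule zero_arrow_unique[OF _ tz[OF i]])
        have "zero_arrow C u" by (rule zero_arrowI[OF z]) (use u in auto)
        then show "zero_arrow C (u \<cdot> s i)" by (rule zero_cmpR) (use s[OF i] u in auto)
      qed (use s[OF i] t[OF i] u in auto)
      then show "u \<in> Hom C z d \<and> (\<forall>i\<in>Obj J. u \<cdot> s i = t i)" using u by simp
      fix v assume "v \<in> Hom C z d \<and> (\<forall>i\<in>Obj J. v \<cdot> s i = t i)"
      then show "v = u" by (intro zero_obj_unique[OF z]) (use u in auto)
    qed
  qed (fact isfun)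
  have i0: "enc {} \<in> Obj J" unfolding J using e0 by blast
  note q_empty = qD[OF e0]
  have d0: "FObj D (enc {}) = Cod C (q {})" unfolding D using e0 by simp
  have qh: "q {} \<in> Hom C P (FObj D (enc {}))" using q_empty d0 by simp
  obtain n where n: "zero_arrow C n" "Dom C n = P" "Cod C n = Cod C (q {})"
    using zero_arrow_exists[of P "Cod C (q {})"] Po q_empty by auto
  have nh: "n \<in> Hom C P (FObj D (enc {}))" using n d0 by simp
  \<comment> \<open>The stage of the empty set is \<open>P\<close> up to isomorphism. There
    \<open>q {}\<close> and the zero arrow \<open>n\<close> become equal in the colimit, so the
    injectivity clause of finite presentation makes them agree at some finite stage
    \<open>F\<close>, where the quotient of \<open>P\<close> is therefore zero.\<close>
  have "s (enc {}) \<cdot> q {} = s (enc {}) \<cdot> n"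
    by (rule zero_obj_unique[OF z]) (use s[OF i0] q_empty n d0 in auto)
  moreover have "\<forall>i \<in> Obj J. \<forall>j \<in> Obj J. \<forall>g \<in> Hom C P (FObj D i). \<forall>h \<in> Hom C P (FObj D j).
           s i \<cdot> g = s j \<cdot> h \<longrightarrow> (\<exists>k. \<exists>u \<in> Hom J i k. \<exists>v \<in> Hom J j k. FArr D u \<cdot> g = FArr D v \<cdot> h)"
    using fp sf colim unfolding finitely_presented_def by blast
  ultimately obtain k u v where k: "u \<in> Hom J (enc {}) k" "v \<in> Hom J (enc {}) k" "FArr D u \<cdot> q {} = FArr D v \<cdot> n"
    using i0 qh nh by blast
  have "k \<in> Obj J" using k(1) category.dom_cod[OF cat] unfolding in_Hom by blast
  then obtain F where F: "F \<in> \<F>" "k = enc F" unfolding J by blast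
  have uv: "u = (enc {}, enc F)" "v = (enc {}, enc F)" using k(1,2) F unfolding in_Hom J by (auto simp: prod_eq_iff)
  note t = tr[OF e0 F(1) empty_subsetI] and qF = qD[OF F(1)]
  have "tr {} F \<cdot> q {} = tr {} F \<cdot> n" using k(3) F e0 unfolding uv D by simp
  moreover have "zero_arrow C (tr {} F \<cdot> n)" by (rule zero_cmpL[OF n(1)]) (use t n in auto)
  ultimately have qF0: "zero_arrow C (q F)" using t(4) by simp
  have Ff: "finite F" "F \<subseteq> T" using F unfolding \<F>_def by auto
  have FT: "t \<in> Arr C \<and> Cod C t = P \<and> noetherian_object C (Dom C t)" if "t \<in> F" for t
    using T Ff(2) that by blast
  obtain m where m: "is_mono C m" "Cod C m = P" "noetherian_object C (Dom C m)"
    "\<And>t. t \<in> F \<Longrightarrow> \<exists>h \<in> Arr C. Dom C h = Dom C t \<and> Cod C h = Dom C m \<and> m \<cdot> h = t"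
    using noetherian_sub_containing[OF Ff(1) FT Po] by blast
  have ma: "m \<in> Arr C" using m by simp
  obtain r where r: "is_cokernel C m r" using cokernel_exists[OF ma] by blast
  note rD = cokernelD[OF r]
  \<comment> \<open>All arrows in \<open>F\<close> factor through \<open>m\<close>, so its cokernel
    \<open>r\<close> factors through \<open>q F\<close>, which is zero. Hence \<open>m\<close> is
    all of \<open>P\<close>.\<close>
  have "zero_arrow C (r \<cdot> t)" if tF: "t \<in> F" for t
  proof -
    obtain h where h: "h \<in> Arr C" "Cod C h = Dom C m" "m \<cdot> h = t" using m(4)[OF tF] by blast
    have "zero_arrow C ((r \<cdot> m) \<cdot> h)" by (rule zero_cmpR[OF rD(4)]) (use h ma rD in auto)
    then show ?thesis using h ma rD by simp
  qed
  then obtain w where w: "w \<in> Arr C" "Dom C w = Cod C (q F)" "w \<cdot> q F = r" using qu[OF F(1) rD(2)] rD m(2) by auto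
  have "zero_arrow C (w \<cdot> q F)" by (rule zero_cmpL[OF qF0]) (use w in auto)
  then have "zero_arrow C r" unfolding w(3) .
  then have "is_epi C m" by (rule iso_epi[OF mono_zero_cokernel_iso[OF m(1) r]])
  then show ?thesis using noetherian_quot m by blast
qed

end

theorem theorem3:
  fixes \<kappa> :: "'k rel" and A :: "('o, 'm) smcat"
  assumes "universe_card \<kappa>"
    and "grothendieck_cosmos \<kappa> A"
    and "locally_noetherian \<kappa> A"
    and "finitely_presented \<kappa> A (Unit A)"
    and "\<exists>G. small \<kappa> G \<and> generating A G \<and> (\<forall>M \<in> G. invertible_filtered A M)"
    and "\<forall>M \<in> Obj A. \<forall>x \<in> LSupp A M. \<exists>y \<in> LAss A M. y \<in> LSpec_top A closure_of {x}"
  shows "let T = {X. torsion_free_class (noeth A) X \<and> L_closed A X}; P = Pow (LSpec A) in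
    bij_betw (LAss_inv A) P T \<and> bij_betw (LAss_class A) T P \<and>
    (\<forall>\<Phi> \<in> P. LAss_class A (LAss_inv A \<Phi>) = \<Phi>) \<and>
    (\<forall>X \<in> T. LAss_inv A (LAss_class A X) = X) \<and>
    mono_on P (LAss_inv A) \<and> mono_on T (LAss_class A)"
proof -
  have cosmos: "symmetric_monoidal A" "monoidal_closed A" "abelian_category A" "locally_small \<kappa> A"
    using assms(2) unfolding grothendieck_cosmos_def grothendieck_category_def abelian_category_def by auto
  obtain G where G: "generating A G" "\<And>M. M \<in> G \<Longrightarrow> invertible_filtered A M" using assms(5) by blast
  have unit: "noetherian_object A (Unit A)"
    using abelian_category.finitely_presented_noetherian[OF cosmos(3) assms(1) cosmos(4) assms(3,4)] .
  interpret invertibly_generated A G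
    by (intro invertibly_generated.intro closed_monoidal_abelian.intro closed_monoidal_abelian_axioms.intro
        invertibly_generated_axioms.intro cosmos G unit)
  define T where "T = {X. torsion_free_class (noeth A) X \<and> L_closed A X}"
  define P where "P = Pow (LSpec A)"
  have 1: "LAss_class A (LAss_inv A \<Phi>) = \<Phi>" if "\<Phi> \<in> P" for \<Phi>
    using LAss_class_LAss_inv that unfolding P_def by blast
  have 2: "LAss_inv A (LAss_class A X) = X" if "X \<in> T" for X
  proof -
    interpret L_closed_torsion_free A G X by unfold_locales (use that in \<open>auto simp: T_def\<close>)
    show ?thesis by (rule LAss_inv_LAss_class) (use assms(6) in blast)
  qed
  have 3: "LAss_inv A \<Phi> \<in> T" for \<Phi> unfolding T_def using torsion_free_LAss_inv L_closed_LAss_inv by blast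
  have 4: "LAss_class A X \<in> P" for X unfolding P_def LAss_class_def using LAss_subset_LSpec by blast
  have "bij_betw (LAss_inv A) P T" by (rule bij_betw_byWitness[of _ "LAss_class A"]) (use 1 2 3 4 in auto)
  moreover have "bij_betw (LAss_class A) T P" by (rule bij_betw_byWitness[of _ "LAss_inv A"]) (use 1 2 3 4 in auto)
  moreover have "mono_on P (LAss_inv A)" by (rule mono_onI) (auto simp: LAss_inv_def)
  moreover have "mono_on T (LAss_class A)" by (rule mono_onI) (auto simp: LAss_class_def)
  ultimately show ?thesis unfolding Let_def T_def[symmetric] P_def[symmetric] using 1 2 by blast
qed

end
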